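(* Let $\omega:[0,\infty)\to[0,\infty)$ be a modulus, and let $$\theta_\omega(\varepsilon) := \sup_{r\ge 0}\Big(\omega(r)-\frac{r}{\varepsilon}\Big),\qquad \varepsilon>0.$$ Consider the reflected equation $$(\ast)\qquad dZ_t = AZ_t\,d\lambda_t - e_1\,dt + e_1\,dK_t,\qquad Z\cdot e_1\ge 0,\qquad dK = 1_{\{Z\cdot e_1=0\}}|dK|$$ on $[0,1]$. (i) If $\theta_\omega$ satisfies Osgood's condition $\displaystyle\int_{0^+}\frac{dx}{\theta_\omega(x)}=+\infty$, then for any $\lambda\in\mathcal{C}_\omega$ and any initial condition $Z_0\in[0,\infty)\times\mathbb{R}$, equation $(\ast)$ admits a unique solution $Z$ on $[0,1]$ started from $Z_0$. (ii) If $\displaystyle\int_{0^+}\frac{dx}{\theta_\omega(x)}<+\infty$ and in addition $$\limsup_{\delta\to 0}\frac{\omega(2\delta)}{2\omega(\delta)}<1,$$ then there exists $\lambda\in\mathcal{C}_\omega$ such that $(\ast)$ admits multiple (i.e. at least two distinct) solutions $Z$ on $[0,1]$ with $Z_0=0$.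
   Context: A modulus is a function $\omega:[0,\infty)\to[0,\infty)$ which is continuous, nondecreasing, subadditive ($\omega(a+b)\le\omega(a)+\omega(b)$ for all $a,b\ge0$) and satisfies $\omega(0)=0$. For a modulus $\omega$, $$\mathcal{C}_\omega=\{f:[0,1]\to\mathbb{R}:\ |f(t)-f(s)|\le\omega(|t-s|)\ \ \forall\, 0\le s<t\le 1\}.$$ The integral $\int_{0^+}$ means $\int_0^{a}$ for small $a>0$, with the convention $1/0=+\infty$. $(e_1,e_2)$ is the canonical basis of $\mathbb{R}^2$ and $A=\begin{pmatrix}0&1\\1&0\end{pmatrix}$. For a function $f$ of a real variable, $f_{s,t}:=f(t)-f(s)$. Definition of solution. For $\lambda:[0,1]\to\mathbb{R}$ continuous, a solution of $(\ast)$ on $[0,1]$ is a pair $(Z,K)$ with $Z:[0,1]\to\mathbb{R}^2$, $K:[0,1]\to\mathbb{R}$, $K$ cadlag and nondecreasing, such that $Z_t\cdot e_1\ge 0$ for all $t$, the measure $dK$ is carried by $\{t: Z_t\cdot e_1=0\}$, and for all $0\le s\le t\le1$ $$Z_t = e^{A\lambda_{s,t}}Z_s+\int_s^t \big(e^{A\lambda_{u,t}}e_1\big)(dK_u-du),$$ the integral being a Stieltjes integral over $(s,t]$. One says that $Z$ itself is a solution if there exists $K$ such that $(Z,K)$ is a solution; uniqueness and multiplicity of solutions refer to $Z$. *)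

theory Defs
  imports "HOL-Analysis.Analysis"
begin

text \<open>
  Functions on \<open>[0,\<infinity>)\<close> or \<open>[0,1]\<close> are total functions on \<open>real\<close>; only their values on
  the intended domain matter.
\<close>

definition modulus :: "(real \<Rightarrow> real) \<Rightarrow> bool" where
  "modulus \<omega> \<longleftrightarrow>
     (\<forall>r\<ge>0. \<omega> r \<ge> 0) \<and> continuous_on {0..} \<omega> \<and> mono_on {0..} \<omega> \<and>
     (\<forall>a\<ge>0. \<forall>b\<ge>0. \<omega> (a + b) \<le> \<omega> a + \<omega> b) \<and> \<omega> 0 = 0"

definition C_class :: "(real \<Rightarrow> real) \<Rightarrow> (real \<Rightarrow> real) set" where
  "C_class \<omega> = {f. \<forall>s t. 0 \<le> s \<and> s < t \<and> t \<le> 1 \<longrightarrow> \<bar>f t - f s\<bar> \<le> \<omega> \<bar>t - s\<bar>}"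

text \<open>The supremum can be \<open>\<infinity>\<close> when \<open>\<epsilon>\<close> is not small.\<close>

definition theta :: "(real \<Rightarrow> real) \<Rightarrow> real \<Rightarrow> ereal" where
  "theta \<omega> \<epsilon> = (SUP r\<in>{0..}. ereal (\<omega> r - r / \<epsilon>))"

text \<open>
  The integral of \<open>1 / \<theta>\<close> over \<open>(0,a)\<close>. In \<open>ereal\<close>, \<open>1 / 0 = \<infinity>\<close> and \<open>1 / \<infinity> = 0\<close>.
\<close>

definition recip_integral :: "(real \<Rightarrow> ereal) \<Rightarrow> real \<Rightarrow> ennreal" where
  "recip_integral \<theta> a = (\<integral>\<^sup>+x\<in>{0<..<a}. e2ennreal (1 / \<theta> x) \<partial>lborel)"

definition cadlag01 :: "(real \<Rightarrow> real) \<Rightarrow> bool" where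
  "cadlag01 K \<longleftrightarrow>
     (\<forall>t\<in>{0..<1}. continuous (at_right t) K) \<and>
     (\<forall>t\<in>{0<..1}. \<exists>l. (K \<longlongrightarrow> l) (at_left t))"

text \<open>
  The Stieltjes measure \<open>dK\<close> of a function \<open>K\<close> on \<open>[0,1]\<close>: \<open>K\<close> is extended by constants to
  the real line, so \<open>dK\<close> lives on \<open>(0,1]\<close> and gives \<open>K t - K s\<close> to \<open>(s,t]\<close>.
\<close>

definition stieltjes01 :: "(real \<Rightarrow> real) \<Rightarrow> real measure" where
  "stieltjes01 K = interval_measure (\<lambda>t. K (max 0 (min 1 t)))"

text \<open>
  The matrix exponential. The type \<open>real^'n^'n\<close> is not a normed algebra in the library, so
  the library \<open>exp\<close> does not apply.
\<close>

definition mexp :: "real^'n^'n \<Rightarrow> real^'n^'n" where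
  "mexp M = (\<Sum>n. (1 / fact n) *\<^sub>R (((\<lambda>N. M ** N) ^^ n) (mat 1)))"

definition e1 :: "real^2" where
  "e1 = axis 1 1"

definition swapA :: "real^2^2" where
  "swapA = vector [vector [0, 1], vector [1, 0]]"

text \<open>
  Continuity of \<open>lam\<close> on \<open>[0,1]\<close> is presupposed; it holds for every \<open>lam\<close> in \<open>C_class \<omega>\<close>
  with \<open>\<omega>\<close> a modulus.
\<close>

definition solution_pair ::
    "(real \<Rightarrow> real) \<Rightarrow> (real \<Rightarrow> real^2) \<Rightarrow> (real \<Rightarrow> real) \<Rightarrow> bool" where
  "solution_pair lam Z K \<longleftrightarrow>
     cadlag01 K \<and> mono_on {0..1} K \<and>
     (\<forall>t\<in>{0..1}. Z t \<bullet> e1 \<ge> 0) \<and>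
     (AE t in stieltjes01 K. t \<in> {0..1} \<longrightarrow> Z t \<bullet> e1 = 0) \<and>
     (\<forall>s t. 0 \<le> s \<and> s \<le> t \<and> t \<le> 1 \<longrightarrow>
        Z t = mexp ((lam t - lam s) *\<^sub>R swapA) *v Z s
            + ((LINT u:{s<..t}|stieltjes01 K. mexp ((lam t - lam u) *\<^sub>R swapA) *v e1)
               - (LINT u:{s<..t}|lborel. mexp ((lam t - lam u) *\<^sub>R swapA) *v e1)))"

definition solution :: "(real \<Rightarrow> real) \<Rightarrow> (real \<Rightarrow> real^2) \<Rightarrow> bool" where
  "solution lam Z \<longleftrightarrow> (\<exists>K. solution_pair lam Z K)"

end

theory Submission
  imports Defs
begin

text \<open>
  In the coordinates $p = e^{-\lambda}(x+y)$, $q = e^{\lambda}(x-y)$ the equation reads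
  $dp = e^{-\lambda}(dK-dt)$, $dq = e^{\lambda}(dK-dt)$, and $d(-pq) = 2x\,dt$ because $x\,dK = 0$.
  Hence $-pq = y^2-x^2$ is nondecreasing. Where it is positive and $y > 0$, write
  $x = R \sinh\varphi$, $y = R\cosh\varphi$; then $R' = \sinh\varphi$ and
  $d\varphi = d\lambda - (\cosh\varphi/R)\,dt + dK/R$, a Skorokhod problem with additive noise and
  Lipschitz drift, which is well posed. So only the origin matters. A solution that leaves the
  origin satisfies $\varphi_t \le \sup_r(\omega(r) - r/R_t) = \theta_\omega(R_t)$ since the last
  visit of $x$ to $0$, so $R' \le C\,\theta_\omega(R)$ starting from $R = 0$, which Osgood's
  condition forbids; thus the solution stays at the origin.

  Conversely, one prescribes $\varphi$ as a chain of tents on blocks accumulating at time $0$, sets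
  $R = \int \sinh\varphi$, and chooses the local time inside $\{\varphi = 0\}$ so that
  $\lambda = \varphi + \int \cosh\varphi/R - \int dK/R$ vanishes at all ends of blocks. Such a
  $\lambda$ has modulus $\omega$ as soon as $\cosh\varphi/R$ is at most the slope of the tent. The
  condition on $\omega(2\delta)$ makes $\theta_\omega(\varepsilon)$ comparable with $\omega(\delta)$
  at $\varepsilon = \delta/\omega(\delta)$, and then convergence of $\int dx/\theta_\omega$ says
  exactly that blocks of dyadic lengths with this property fit into finite time.
\<close>

text \<open>The path \<lambda> is merely continuous, so nothing may be differentiated along it. The
  factors in p and q remove its increments from the equation: it survives only as a continuous
  coefficient of dt and dK, and additively in the angle. This dictates the choice of coordinates.
  The case y < 0 follows from y > 0, since exchanging p and q and changing the sign of \<lambda>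
  preserves the equation.

  The constants of the construction form one budget. On a block the tent, the integral of cosh
  \<phi> / R and L change at rates at most 1, 1 and 3 times the slope \<open>sl\<close>; the 3
  arises because L returns on one third of a block what the integral collects on all of it.
  Subadditivity gives only \<omega>(d) \<ge> (d/\<rho>) \<omega>(\<rho>) / 2, and increments across
  several blocks are split in two, so \<open>sl\<close> = \<omega>(\<rho>) / (20 \<rho>) with 20 =
  (1 + 1 + 3) * 2 * 2. As cosh \<phi> \<le> 2, the bound cosh \<phi> / R \<le> \<open>sl\<close>
  needs R \<ge> 40 \<rho> / \<omega>(\<rho>); a block adds \<rho> \<omega>(\<rho>) / 360 to R,
  whence 14400 = 40 * 360. The cap 60 = 20 * 3 on \<omega>(\<rho>) keeps \<phi> \<le> 1.\<close>

section \<open>Increment calculus with respect to time and local time\<close>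

lemma continuous_on_at_right:
  fixes f :: "real \<Rightarrow> real"
  assumes "continuous_on {a..b} f" "a \<le> t" "t < b"
  shows "(f \<longlongrightarrow> f t) (at_right t)"
proof -
  have "continuous_on {t..b} f" using assms by (auto intro: continuous_on_subset)
  then have "(f \<longlongrightarrow> f t) (at t within {t..b})" using assms unfolding continuous_on_def by force
  then show ?thesis using at_within_Icc_at_right[OF assms(3)] by simp
qed

lemma continuous_on_at_left:
  fixes f :: "real \<Rightarrow> real"
  assumes "continuous_on {a..b} f" "a < t" "t \<le> b"
  shows "(f \<longlongrightarrow> f t) (at_left t)"
proof -
  have "continuous_on {a..t} f" using assms by (auto intro: continuous_on_subset)
  then have "(f \<longlongrightarrow> f t) (at t within {a..t})" using assms unfolding continuous_on_def by force
  then show ?thesis using at_within_Icc_at_left[OF assms(2)] by simp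
qed

lemma eq_at_left_endpoint:
  fixes f :: "real \<Rightarrow> real"
  assumes f: "continuous_on {a..b} f" and ab: "a < b" and c: "\<And>u. a < u \<Longrightarrow> u \<le> b \<Longrightarrow> f u = c"
  shows "f a = c"
proof -
  have "\<forall>\<^sub>F u in at_right a. f u = c" by (rule eventually_at_rightI[OF _ ab]) (simp add: c)
  then have "(f \<longlongrightarrow> c) (at_right a)" by (rule tendsto_eventually)
  with continuous_on_at_right[OF f order_refl ab] show ?thesis
    by (rule tendsto_unique[OF trivial_limit_at_right_real])
qed

lemma last_root:
  fixes f :: "real \<Rightarrow> real"
  assumes f: "continuous_on {a..b} f" and a: "f a = 0" "a \<le> b"
  obtains c where "a \<le> c" "c \<le> b" "f c = 0" "\<And>u. c < u \<Longrightarrow> u \<le> b \<Longrightarrow> f u \<noteq> 0"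
proof -
  define S where "S = {s \<in> {a..b}. f s = 0}"
  have "closed S" unfolding S_def using continuous_closed_preimage_constant[OF f closed_atLeastAtMost, of 0]
    by (simp add: vimage_def Collect_conj_eq[symmetric] Int_def)
  moreover have bd: "bdd_above S" by (rule bdd_aboveI[of _ b]) (simp add: S_def)
  moreover have "S \<noteq> {}" using a by (auto simp: S_def)
  ultimately have "Sup S \<in> S" using closed_contains_Sup by blast
  then obtain c where c: "c = Sup S" "a \<le> c" "c \<le> b" "f c = 0" by (simp add: S_def)
  have "f u \<noteq> 0" if "c < u" "u \<le> b" for u
    using that c(1,2) cSup_upper[OF _ bd, of u] by (force simp: S_def)
  then show thesis using that c by blast
qed

text \<open>
  \<open>incr a b K f \<alpha> \<beta>\<close> says $df = \alpha\,dt + \beta\,dK$ on $[a,b]$, with an error that is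
  uniformly $o(\Delta t + \Delta K)$ on short intervals. For a monotone \<open>K\<close> such errors sum to
  zero over fine partitions, so this notion has a chain rule and determines \<open>f\<close> up to a
  constant, without any Stieltjes integral.
\<close>

definition negligible :: "real \<Rightarrow> real \<Rightarrow> (real \<Rightarrow> real) \<Rightarrow> (real \<Rightarrow> real \<Rightarrow> real) \<Rightarrow> bool" where
  "negligible a b K G \<longleftrightarrow> (\<forall>e>0. \<exists>d>0. \<forall>s t. a \<le> s \<and> s \<le> t \<and> t \<le> b \<and> t - s < d \<longrightarrow>
     \<bar>G s t\<bar> \<le> e * ((t - s) + (K t - K s)))"

definition incr :: "real \<Rightarrow> real \<Rightarrow> (real \<Rightarrow> real) \<Rightarrow> (real \<Rightarrow> real) \<Rightarrow> (real \<Rightarrow> real) \<Rightarrow> (real \<Rightarrow> real) \<Rightarrow> bool" where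
  "incr a b K f \<alpha> \<beta> \<longleftrightarrow> negligible a b K (\<lambda>s t. f t - f s - \<alpha> s * (t - s) - \<beta> s * (K t - K s))"

lemma neglI:
  assumes "\<And>e. e > 0 \<Longrightarrow> \<exists>d>0. \<forall>s t. a \<le> s \<and> s \<le> t \<and> t \<le> b \<and> t - s < d \<longrightarrow>
     \<bar>G s t\<bar> \<le> e * ((t - s) + (K t - K s))"
  shows "negligible a b K G"
  using assms unfolding negligible_def by blast

lemma neglD:
  assumes "negligible a b K G" "e > 0"
  obtains d where "d > 0" "\<And>s t. a \<le> s \<Longrightarrow> s \<le> t \<Longrightarrow> t \<le> b \<Longrightarrow> t - s < d \<Longrightarrow>
     \<bar>G s t\<bar> \<le> e * ((t - s) + (K t - K s))"
  using assms unfolding negligible_def by meson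

lemma negligible_subset: "negligible a b K G \<Longrightarrow> a \<le> a' \<Longrightarrow> b' \<le> b \<Longrightarrow> negligible a' b' K G"
  unfolding negligible_def by (meson order_trans)

lemma negligible_cong:
  assumes "negligible a b K G" "\<And>s t. a \<le> s \<Longrightarrow> s \<le> t \<Longrightarrow> t \<le> b \<Longrightarrow> G s t = G' s t"
  shows "negligible a b K G'"
  using assms unfolding negligible_def by metis

lemma negligible_congK:
  assumes "negligible a b K G" "\<And>s t. a \<le> s \<Longrightarrow> s \<le> t \<Longrightarrow> t \<le> b \<Longrightarrow> K' t - K' s = K t - K s"
  shows "negligible a b K' G"
  using assms unfolding negligible_def by metis

lemma negligible_add:
  assumes "negligible a b K G" "negligible a b K H"
  shows "negligible a b K (\<lambda>s t. G s t + H s t)"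
proof (rule neglI)
  fix e :: real assume "e > 0"
  then have e: "e / 2 > 0" by simp
  obtain d1 where d1: "d1 > 0" "\<And>s t. a \<le> s \<Longrightarrow> s \<le> t \<Longrightarrow> t \<le> b \<Longrightarrow> t - s < d1 \<Longrightarrow>
     \<bar>G s t\<bar> \<le> e / 2 * ((t - s) + (K t - K s))" using neglD[OF assms(1) e] by metis
  obtain d2 where d2: "d2 > 0" "\<And>s t. a \<le> s \<Longrightarrow> s \<le> t \<Longrightarrow> t \<le> b \<Longrightarrow> t - s < d2 \<Longrightarrow>
     \<bar>H s t\<bar> \<le> e / 2 * ((t - s) + (K t - K s))" using neglD[OF assms(2) e] by metis
  show "\<exists>d>0. \<forall>s t. a \<le> s \<and> s \<le> t \<and> t \<le> b \<and> t - s < d \<longrightarrow>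
     \<bar>G s t + H s t\<bar> \<le> e * ((t - s) + (K t - K s))"
  proof (intro exI[of _ "min d1 d2"] conjI allI impI)
    fix s t assume st: "a \<le> s \<and> s \<le> t \<and> t \<le> b \<and> t - s < min d1 d2"
    have "\<bar>G s t + H s t\<bar> \<le> \<bar>G s t\<bar> + \<bar>H s t\<bar>" by (rule abs_triangle_ineq)
    also have "\<dots> \<le> e / 2 * ((t - s) + (K t - K s)) + e / 2 * ((t - s) + (K t - K s))"
      using d1(2)[of s t] d2(2)[of s t] st by simp
    finally show "\<bar>G s t + H s t\<bar> \<le> e * ((t - s) + (K t - K s))" by simp
  qed (use d1 d2 in auto)
qed

lemma negligible_mult:
  assumes "negligible a b K G" "\<And>s t. a \<le> s \<Longrightarrow> s \<le> t \<Longrightarrow> t \<le> b \<Longrightarrow> \<bar>c s t\<bar> \<le> B"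
  shows "negligible a b K (\<lambda>s t. c s t * G s t)"
proof (rule neglI)
  fix e :: real assume "e > 0"
  then have e: "e / (\<bar>B\<bar> + 1) > 0" by simp
  obtain d where d: "d > 0" "\<And>s t. a \<le> s \<Longrightarrow> s \<le> t \<Longrightarrow> t \<le> b \<Longrightarrow> t - s < d \<Longrightarrow>
     \<bar>G s t\<bar> \<le> e / (\<bar>B\<bar> + 1) * ((t - s) + (K t - K s))" using neglD[OF assms(1) e] by metis
  show "\<exists>d>0. \<forall>s t. a \<le> s \<and> s \<le> t \<and> t \<le> b \<and> t - s < d \<longrightarrow>
     \<bar>c s t * G s t\<bar> \<le> e * ((t - s) + (K t - K s))"
  proof (intro exI[of _ d] conjI allI impI)
    fix s t assume st: "a \<le> s \<and> s \<le> t \<and> t \<le> b \<and> t - s < d"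
    have "\<bar>c s t * G s t\<bar> = \<bar>c s t\<bar> * \<bar>G s t\<bar>" by (rule abs_mult)
    also have "\<dots> \<le> (\<bar>B\<bar> + 1) * (e / (\<bar>B\<bar> + 1) * ((t - s) + (K t - K s)))"
      using d(2)[of s t] assms(2)[of s t] st by (intro mult_mono) auto
    finally show "\<bar>c s t * G s t\<bar> \<le> e * ((t - s) + (K t - K s))" by simp
  qed (use d in auto)
qed

text \<open>The standard source of negligible errors: an oscillation of a continuous function times
  an increment of t + K, small relative to that increment by uniform continuity. The times u and v
  may depend on s and t, which leaves room for points supplied by mean value arguments.\<close>

lemma negligible_modulus:
  assumes mK: "mono_on {a..b} K" and g: "continuous_on {a..b} (g :: real \<Rightarrow> real)"
    and H: "\<And>s t. a \<le> s \<Longrightarrow> s \<le> t \<Longrightarrow> t \<le> b \<Longrightarrow> \<exists>u\<in>{s..t}. \<exists>v\<in>{s..t}.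
        \<bar>H s t\<bar> \<le> \<bar>g u - g v\<bar> * (C * ((t - s) + (K t - K s)))"
    and C: "C \<ge> 0"
  shows "negligible a b K H"
proof (rule neglI)
  fix e :: real assume "e > 0"
  then have e: "e / (C + 1) > 0" using C by simp
  have "uniformly_continuous_on {a..b} g" using g by (simp add: compact_uniformly_continuous)
  then obtain d where d: "d > 0" "\<And>u v. u \<in> {a..b} \<Longrightarrow> v \<in> {a..b} \<Longrightarrow> \<bar>u - v\<bar> < d \<Longrightarrow> \<bar>g u - g v\<bar> < e / (C + 1)"
    using e unfolding uniformly_continuous_on_def dist_real_def by metis
  show "\<exists>d>0. \<forall>s t. a \<le> s \<and> s \<le> t \<and> t \<le> b \<and> t - s < d \<longrightarrow>
     \<bar>H s t\<bar> \<le> e * ((t - s) + (K t - K s))"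
  proof (intro exI[of _ d] conjI allI impI)
    fix s t assume st: "a \<le> s \<and> s \<le> t \<and> t \<le> b \<and> t - s < d"
    obtain u v where uv: "u \<in> {s..t}" "v \<in> {s..t}" "\<bar>H s t\<bar> \<le> \<bar>g u - g v\<bar> * (C * ((t - s) + (K t - K s)))"
      using H st by meson
    have m: "K s \<le> K t" using mK st by (auto simp: mono_on_def)
    have "\<bar>g u - g v\<bar> \<le> e / (C + 1)" using d(2)[of u v] uv st by force
    then have "\<bar>g u - g v\<bar> * (C * ((t - s) + (K t - K s))) \<le> e / (C + 1) * ((C + 1) * ((t - s) + (K t - K s)))"
      using m st C by (intro mult_mono mult_right_mono) auto
    also have "\<dots> = e * ((t - s) + (K t - K s))" using C by simp
    finally show "\<bar>H s t\<bar> \<le> e * ((t - s) + (K t - K s))" using uv by linarith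
  qed (use d in auto)
qed

text \<open>Over a partition of mesh less than d both sides telescope, which leaves the error e (m y
  - m x) with e arbitrary. With m t = t + K t this is the summation of negligible errors.\<close>

lemma local_mono:
  fixes f :: "real \<Rightarrow> real"
  assumes loc: "\<And>e. e > 0 \<Longrightarrow> \<exists>d>0. \<forall>s t. a \<le> s \<and> s \<le> t \<and> t \<le> b \<and> t - s < d \<longrightarrow>
     f t - f s \<ge> - (e * (m t - m s))"
    and xy: "a \<le> x" "x \<le> y" "y \<le> b"
  shows "f x \<le> f y"
proof -
  have key: "f y - f x \<ge> - (e * (m y - m x))" if e: "e > 0" for e
  proof -
    obtain d where d: "d > 0" "\<And>s t. a \<le> s \<Longrightarrow> s \<le> t \<Longrightarrow> t \<le> b \<Longrightarrow> t - s < d \<Longrightarrow> f t - f s \<ge> - (e * (m t - m s))"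
      using loc[OF e] by meson
    obtain N :: nat where N: "(y - x) / d < N" using reals_Archimedean2 by blast
    define h where "h = (y - x) / (N + 1)"
    have h0: "h \<ge> 0" using xy by (simp add: h_def)
    have hd: "h < d"
    proof -
      have "y - x < N * d" using N d by (simp add: field_simps)
      also have "\<dots> \<le> (N + 1) * d" using d by simp
      finally show ?thesis unfolding h_def by (simp add: field_simps)
    qed
    have hN: "(N + 1) * h = y - x" by (simp add: h_def)
    have "f (x + real i * h) - f x \<ge> - (e * (m (x + real i * h) - m x))" if "i \<le> N + 1" for i
      using that
    proof (induction i)
      case (Suc i)
      have "real (Suc i) * h \<le> real (N + 1) * h" using Suc h0 by (intro mult_right_mono) auto
      then have "x + real (Suc i) * h \<le> y" using hN by simp
      moreover have "0 \<le> real i * h" using h0 by simp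
      ultimately have "f (x + real (Suc i) * h) - f (x + real i * h) \<ge> - (e * (m (x + real (Suc i) * h) - m (x + real i * h)))"
        using xy h0 hd by (intro d(2)) (linarith | simp add: algebra_simps)+
      moreover have "f (x + real i * h) - f x \<ge> - (e * (m (x + real i * h) - m x))" using Suc by auto
      ultimately show ?case by (simp add: algebra_simps)
    qed auto
    from this[of "N + 1"] show ?thesis using hN by (simp add: algebra_simps)
  qed
  have "f x \<le> f y + e" if "e > 0" for e
  proof -
    have "e / (\<bar>m y - m x\<bar> + 1) * (m y - m x) \<le> e / (\<bar>m y - m x\<bar> + 1) * (\<bar>m y - m x\<bar> + 1)"
      using that by (intro mult_left_mono) auto
    also have "\<dots> = e" by (simp add: field_simps add_nonneg_eq_0_iff)
    finally have *: "e / (\<bar>m y - m x\<bar> + 1) * (m y - m x) \<le> e" .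
    have "e / (\<bar>m y - m x\<bar> + 1) > 0" using that by (intro divide_pos_pos) auto
    from key[OF this] * show ?thesis by linarith
  qed
  then show ?thesis by (rule field_le_epsilon)
qed

lemma continuous_abs_bound:
  assumes "continuous_on {a..b} (g :: real \<Rightarrow> real)"
  obtains B where "B \<ge> 0" "\<And>s. s \<in> {a..b} \<Longrightarrow> \<bar>g s\<bar> \<le> B"
proof -
  have "bounded (g ` {a..b})" using assms by (simp add: compact_continuous_image compact_imp_bounded)
  then obtain B where "\<forall>x\<in>g ` {a..b}. norm x \<le> B" unfolding bounded_iff by blast
  then have "\<And>s. s \<in> {a..b} \<Longrightarrow> \<bar>g s\<bar> \<le> B" by auto
  then have "\<And>s. s \<in> {a..b} \<Longrightarrow> \<bar>g s\<bar> \<le> \<bar>B\<bar>" by (meson abs_ge_self order_trans)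
  then show thesis by (intro that[of "\<bar>B\<bar>"]) auto
qed

lemma incr_subset: "incr a b K f \<alpha> \<beta> \<Longrightarrow> a \<le> a' \<Longrightarrow> b' \<le> b \<Longrightarrow> incr a' b' K f \<alpha> \<beta>"
  unfolding incr_def by (rule negligible_subset)

lemma incr_cong:
  assumes "incr a b K f \<alpha> \<beta>" "\<And>s. s \<in> {a..b} \<Longrightarrow> f s = f' s" "\<And>s. s \<in> {a..b} \<Longrightarrow> \<alpha> s = \<alpha>' s"
    "\<And>s. s \<in> {a..b} \<Longrightarrow> \<beta> s = \<beta>' s"
  shows "incr a b K f' \<alpha>' \<beta>'"
  using assms(1) unfolding incr_def by (rule negligible_cong) (use assms in auto)

lemma incr_add:
  assumes "incr a b K f \<alpha> \<beta>" "incr a b K g \<alpha>' \<beta>'"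
  shows "incr a b K (\<lambda>t. f t + g t) (\<lambda>t. \<alpha> t + \<alpha>' t) (\<lambda>t. \<beta> t + \<beta>' t)"
  unfolding incr_def by (rule negligible_cong[OF negligible_add[OF assms[unfolded incr_def]]]) (simp add: algebra_simps)

lemma incr_cmult:
  assumes "incr a b K f \<alpha> \<beta>"
  shows "incr a b K (\<lambda>t. c * f t) (\<lambda>t. c * \<alpha> t) (\<lambda>t. c * \<beta> t)"
  unfolding incr_def by (rule negligible_cong[OF negligible_mult[OF assms[unfolded incr_def], of "\<lambda>s t. c" "\<bar>c\<bar>"]]) (simp_all add: algebra_simps)

lemma incr_diff:
  assumes "incr a b K f \<alpha> \<beta>" "incr a b K g \<alpha>' \<beta>'"
  shows "incr a b K (\<lambda>t. f t - g t) (\<lambda>t. \<alpha> t - \<alpha>' t) (\<lambda>t. \<beta> t - \<beta>' t)"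
  using incr_add[OF assms(1) incr_cmult[OF assms(2), of "-1"]] by simp

lemma negligible_0: "mono_on {a..b} K \<Longrightarrow> negligible a b K (\<lambda>s t. 0)"
  by (rule neglI) (auto intro!: exI[of _ 1] mult_nonneg_nonneg add_nonneg_nonneg simp: mono_on_def)

lemma incr_const: "mono_on {a..b} K \<Longrightarrow> incr a b K (\<lambda>t. c) (\<lambda>t. 0) (\<lambda>t. 0)"
  unfolding incr_def by (simp add: negligible_0)

lemma incr_id: "mono_on {a..b} K \<Longrightarrow> incr a b K (\<lambda>t. t) (\<lambda>t. 1) (\<lambda>t. 0)"
  unfolding incr_def by (simp add: negligible_0)

lemma incr_K: "mono_on {a..b} K \<Longrightarrow> incr a b K K (\<lambda>t. 0) (\<lambda>t. 1)"
  unfolding incr_def by (simp add: negligible_0)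

text \<open>Nonnegative rates bound the increment from below by the negligible error alone, so
  \<open>local_mono\<close> applies. Uniqueness and Lipschitz bounds come from applying this to
  suitable combinations of functions.\<close>

lemma incr_mono:
  assumes D: "incr a b K f \<alpha> \<beta>" and mK: "mono_on {a..b} K"
    and nn: "\<And>s. s \<in> {a..b} \<Longrightarrow> \<alpha> s \<ge> 0" "\<And>s. s \<in> {a..b} \<Longrightarrow> \<beta> s \<ge> 0"
  shows "mono_on {a..b} f"
proof -
  have "f x \<le> f y" if xy: "a \<le> x" "x \<le> y" "y \<le> b" for x y
  proof (rule local_mono[where m = "\<lambda>t. t + K t", OF _ xy])
    fix e :: real assume "e > 0"
    then obtain d where d: "d > 0" "\<And>s t. a \<le> s \<Longrightarrow> s \<le> t \<Longrightarrow> t \<le> b \<Longrightarrow> t - s < d \<Longrightarrow>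
     \<bar>f t - f s - \<alpha> s * (t - s) - \<beta> s * (K t - K s)\<bar> \<le> e * ((t - s) + (K t - K s))"
      using neglD[OF D[unfolded incr_def]] by metis
    show "\<exists>d>0. \<forall>s t. a \<le> s \<and> s \<le> t \<and> t \<le> b \<and> t - s < d \<longrightarrow> - (e * (t + K t - (s + K s))) \<le> f t - f s"
    proof (intro exI[of _ d] conjI allI impI)
      fix s t assume st: "a \<le> s \<and> s \<le> t \<and> t \<le> b \<and> t - s < d"
      have m: "K s \<le> K t" using mK st by (auto simp: mono_on_def)
      have "\<alpha> s * (t - s) \<ge> 0" "\<beta> s * (K t - K s) \<ge> 0" using nn[of s] st m by auto
      then show "- (e * (t + K t - (s + K s))) \<le> f t - f s"
        using d(2)[of s t] st by (simp add: algebra_simps abs_le_iff)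
    qed (use d in auto)
  qed
  then show ?thesis by (auto simp: mono_on_def)
qed

lemma incr_0_const:
  assumes D: "incr a b K f (\<lambda>t. 0) (\<lambda>t. 0)" and mK: "mono_on {a..b} K" and st: "s \<in> {a..b}" "t \<in> {a..b}"
  shows "f s = f t"
proof -
  have *: "f s = f t" if st: "a \<le> s" "s \<le> t" "t \<le> b" for s t
  proof -
    have "mono_on {a..b} f" by (rule incr_mono[OF D mK]) auto
    moreover have "mono_on {a..b} (\<lambda>t. (-1) * f t)"
      by (rule incr_mono[OF incr_cmult[OF D, of "-1"] mK]) auto
    ultimately have "f s \<le> f t" "-1 * f s \<le> -1 * f t"
      using mono_onD[of "{a..b}" f s t] mono_onD[of "{a..b}" "\<lambda>t. -1 * f t" s t] st by simp_all
    then show ?thesis by simp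
  qed
  show ?thesis using * st by (metis atLeastAtMost_iff linear)
qed

lemma incr_unique:
  assumes "incr a b K f \<alpha> \<beta>" "incr a b K g \<alpha> \<beta>" and mK: "mono_on {a..b} K" and st: "s \<in> {a..b}" "t \<in> {a..b}"
  shows "f t - f s = g t - g s"
proof -
  have "incr a b K (\<lambda>t. f t - g t) (\<lambda>t. 0) (\<lambda>t. 0)" using incr_diff[OF assms(1,2)] by simp
  from incr_0_const[OF this mK st] show ?thesis by simp
qed

text \<open>If C dominates both rates, then C (t + K) + f and C (t + K) - f are nondecreasing by
  \<open>incr_mono\<close>.\<close>

lemma incr_bound:
  assumes D: "incr a b K f \<alpha> \<beta>" and mK: "mono_on {a..b} K"
    and c: "continuous_on {a..b} \<alpha>" "continuous_on {a..b} \<beta>"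
  obtains C where "C \<ge> 0" "\<And>s t. a \<le> s \<Longrightarrow> s \<le> t \<Longrightarrow> t \<le> b \<Longrightarrow> \<bar>f t - f s\<bar> \<le> C * ((t - s) + (K t - K s))"
proof -
  obtain A where A: "A \<ge> 0" "\<And>s. s \<in> {a..b} \<Longrightarrow> \<bar>\<alpha> s\<bar> \<le> A" using continuous_abs_bound[OF c(1)] by blast
  obtain B where B: "B \<ge> 0" "\<And>s. s \<in> {a..b} \<Longrightarrow> \<bar>\<beta> s\<bar> \<le> B" using continuous_abs_bound[OF c(2)] by blast
  define C where "C = A + B"
  have C: "\<alpha> s + C \<ge> 0" "C - \<alpha> s \<ge> 0" "\<beta> s + C \<ge> 0" "C - \<beta> s \<ge> 0" if "s \<in> {a..b}" for s
    using A(2)[OF that] B(2)[OF that] A(1) B(1) by (auto simp: C_def)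
  have t: "incr a b K (\<lambda>t. C * (t + K t)) (\<lambda>t. C) (\<lambda>t. C)"
    using incr_cmult[OF incr_add[OF incr_id[OF mK] incr_K[OF mK]], of C] by simp
  have 1: "mono_on {a..b} (\<lambda>t. f t + C * (t + K t))"
    by (rule incr_mono[OF incr_add[OF D t] mK]) (use C in auto)
  have 2: "mono_on {a..b} (\<lambda>t. C * (t + K t) - f t)"
    by (rule incr_mono[OF incr_diff[OF t D] mK]) (use C in auto)
  show thesis
  proof (rule that[of C])
    show "C \<ge> 0" using A B by (simp add: C_def)
    fix s t assume st: "a \<le> s" "s \<le> t" "t \<le> b"
    then have "f s + C * (s + K s) \<le> f t + C * (t + K t)" "C * (s + K s) - f s \<le> C * (t + K t) - f t"
      using 1 2 by (auto simp: mono_on_def)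
    then show "\<bar>f t - f s\<bar> \<le> C * ((t - s) + (K t - K s))" by (simp add: abs_le_iff algebra_simps)
  qed
qed

lemma incr_continuous:
  assumes D: "incr a b K f \<alpha> \<beta>" and mK: "mono_on {a..b} K" and cK: "continuous_on {a..b} K"
    and c: "continuous_on {a..b} \<alpha>" "continuous_on {a..b} \<beta>"
  shows "continuous_on {a..b} f"
proof -
  obtain C where C: "C \<ge> 0" "\<And>s t. a \<le> s \<Longrightarrow> s \<le> t \<Longrightarrow> t \<le> b \<Longrightarrow> \<bar>f t - f s\<bar> \<le> C * ((t - s) + (K t - K s))"
    using incr_bound[OF D mK c] by blast
  have C': "\<bar>f t - f s\<bar> \<le> C * (\<bar>t - s\<bar> + \<bar>K t - K s\<bar>)" if "s \<in> {a..b}" "t \<in> {a..b}" for s t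
  proof -
    have *: "\<bar>f t - f s\<bar> \<le> C * (\<bar>t - s\<bar> + \<bar>K t - K s\<bar>)" if "a \<le> s" "s \<le> t" "t \<le> b" for s t
      using C(2)[OF that] by (rule order_trans) (use C(1) in \<open>auto intro!: mult_left_mono\<close>)
    show ?thesis 
      using *[of s t] *[of t s] that by (cases "s \<le> t") (auto simp: abs_minus_commute)
  qed
  show ?thesis unfolding continuous_on_def
  proof
    fix x assume x: "x \<in> {a..b}"
    have "((\<lambda>t. C * (\<bar>t - x\<bar> + \<bar>K t - K x\<bar>)) \<longlongrightarrow> C * (\<bar>x - x\<bar> + \<bar>K x - K x\<bar>)) (at x within {a..b})"
      using cK x by (intro tendsto_intros) (auto simp: continuous_on_def)
    then have "((\<lambda>t. C * (\<bar>t - x\<bar> + \<bar>K t - K x\<bar>)) \<longlongrightarrow> 0) (at x within {a..b})" by simp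
    then have "((\<lambda>t. f t - f x) \<longlongrightarrow> 0) (at x within {a..b})"
      by (rule Lim_null_comparison[rotated]) (use C' x in \<open>auto simp: eventually_at_filter\<close>)
    then show "(f \<longlongrightarrow> f x) (at x within {a..b})" by (simp add: LIM_zero_iff)
  qed
qed

text \<open>No bracket term appears: (g t - g s)(f t - f s) is an oscillation of g times a quantity
  of order t - s + K t - K s. Continuity of K enters here, through the continuity of f and
  g.\<close>

lemma incr_mult:
  assumes D: "incr a b K f \<alpha> \<beta>" "incr a b K g \<alpha>' \<beta>'" and mK: "mono_on {a..b} K" and cK: "continuous_on {a..b} K"
    and c: "continuous_on {a..b} \<alpha>" "continuous_on {a..b} \<beta>" "continuous_on {a..b} \<alpha>'" "continuous_on {a..b} \<beta>'"
  shows "incr a b K (\<lambda>t. f t * g t) (\<lambda>t. f t * \<alpha>' t + g t * \<alpha> t) (\<lambda>t. f t * \<beta>' t + g t * \<beta> t)"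
proof -
  have cf: "continuous_on {a..b} f" by (rule incr_continuous[OF D(1) mK cK c(1,2)])
  have cg: "continuous_on {a..b} g" by (rule incr_continuous[OF D(2) mK cK c(3,4)])
  obtain F where F: "\<And>s. s \<in> {a..b} \<Longrightarrow> \<bar>f s\<bar> \<le> F" using continuous_abs_bound[OF cf] by blast
  obtain G where G: "\<And>s. s \<in> {a..b} \<Longrightarrow> \<bar>g s\<bar> \<le> G" using continuous_abs_bound[OF cg] by blast
  obtain C where C: "C \<ge> 0" "\<And>s t. a \<le> s \<Longrightarrow> s \<le> t \<Longrightarrow> t \<le> b \<Longrightarrow> \<bar>f t - f s\<bar> \<le> C * ((t - s) + (K t - K s))"
    using incr_bound[OF D(1) mK c(1,2)] by blast
  have 3: "negligible a b K (\<lambda>s t. (g t - g s) * (f t - f s))"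
  proof (rule negligible_modulus[OF mK cg _ C(1)])
    fix s t assume st: "a \<le> s" "s \<le> t" "t \<le> b"
    have "\<bar>(g t - g s) * (f t - f s)\<bar> \<le> \<bar>g t - g s\<bar> * (C * (t - s + (K t - K s)))"
      unfolding abs_mult by (intro mult_left_mono C(2) st) auto
    then show "\<exists>u\<in>{s..t}. \<exists>v\<in>{s..t}. \<bar>(g t - g s) * (f t - f s)\<bar> \<le> \<bar>g u - g v\<bar> * (C * (t - s + (K t - K s)))"
      using st by (intro bexI[of _ t] bexI[of _ s]) auto
  qed
  show ?thesis unfolding incr_def
    by (rule negligible_cong[OF negligible_add[OF 3 negligible_add[OF
        negligible_mult[OF D(1)[unfolded incr_def], of "\<lambda>s t. g s" G]
        negligible_mult[OF D(2)[unfolded incr_def], of "\<lambda>s t. f s" F]]]])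
      (use F G in \<open>auto simp: algebra_simps\<close>)
qed

text \<open>The mean value theorem gives F'(f u)(f t - f s) with u between s and t; replacing u by s
  costs an oscillation of F'(f) times a quantity of order t - s + K t - K s.\<close>

lemma incr_chain:
  assumes D: "incr a b K f \<alpha> \<beta>" and mK: "mono_on {a..b} K" and cK: "continuous_on {a..b} K"
    and c: "continuous_on {a..b} \<alpha>" "continuous_on {a..b} \<beta>"
    and F: "\<And>s. s \<in> {a..b} \<Longrightarrow> (F has_real_derivative F' (f s)) (at (f s))"
    and F': "continuous_on {a..b} (\<lambda>s. F' (f s))"
  shows "incr a b K (\<lambda>t. F (f t)) (\<lambda>t. F' (f t) * \<alpha> t) (\<lambda>t. F' (f t) * \<beta> t)"
proof -
  have cf: "continuous_on {a..b} f" by (rule incr_continuous[OF D(1) mK cK c(1,2)])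
  obtain B where B: "\<And>s. s \<in> {a..b} \<Longrightarrow> \<bar>F' (f s)\<bar> \<le> B" using continuous_abs_bound[OF F'] by blast
  obtain C where C: "C \<ge> 0" "\<And>s t. a \<le> s \<Longrightarrow> s \<le> t \<Longrightarrow> t \<le> b \<Longrightarrow> \<bar>f t - f s\<bar> \<le> C * ((t - s) + (K t - K s))"
    using incr_bound[OF D(1) mK c(1,2)] by blast
  have mvt: "\<exists>u\<in>{s..t}. F (f t) - F (f s) = F' (f u) * (f t - f s)" if st: "a \<le> s" "s \<le> t" "t \<le> b" for s t
  proof -
    have cs: "continuous_on {s..t} f" using cf by (rule continuous_on_subset) (use st in auto)
    \<comment> \<open>F is known to be differentiable only at values of f. The intermediate value
      theorem writes every point between f s and f t as some f u, and it also turns the mean value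
      point into a time.\<close>
    have surj: "\<exists>u\<in>{s..t}. z = f u" if "min (f s) (f t) \<le> z" "z \<le> max (f s) (f t)" for z
      using IVT'[of f s z t] IVT2'[of f t z s] that cs st by (force simp: min_def max_def split: if_splits)
    have der: "DERIV F z :> F' z" if z: "min (f s) (f t) \<le> z" "z \<le> max (f s) (f t)" for z
    proof -
      obtain u where "u \<in> {s..t}" "z = f u" using surj[OF z] by blast
      then show ?thesis using F[of u] st by auto
    qed
    consider "f s < f t" | "f t < f s" | "f s = f t" by linarith
    then show ?thesis
    proof cases
      case 1
      then obtain z where "f s < z" "z < f t" "F (f t) - F (f s) = (f t - f s) * F' z"
        using MVT2[of "f s" "f t" F F'] der by auto
      then show ?thesis using surj[of z] by (auto simp: mult.commute)
    next
      case 2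
      then obtain z where "f t < z" "z < f s" "F (f s) - F (f t) = (f s - f t) * F' z"
        using MVT2[of "f t" "f s" F F'] der by auto
      then obtain u where "u \<in> {s..t}" "z = f u" using surj[of z] by auto
      then show ?thesis using \<open>F (f s) - F (f t) = (f s - f t) * F' z\<close>
        by (intro bexI[of _ u]) (auto simp: algebra_simps)
    next
      case 3
      then show ?thesis using st by (intro bexI[of _ s]) auto
    qed
  qed
  have 3: "negligible a b K (\<lambda>s t. F (f t) - F (f s) - F' (f s) * (f t - f s))"
  proof (rule negligible_modulus[OF mK F' _ C(1)])
    fix s t assume st: "a \<le> s" "s \<le> t" "t \<le> b"
    obtain u where u: "u \<in> {s..t}" "F (f t) - F (f s) = F' (f u) * (f t - f s)" using mvt[OF st] by blast
    have "\<bar>(F' (f u) - F' (f s)) * (f t - f s)\<bar> \<le> \<bar>F' (f u) - F' (f s)\<bar> * (C * (t - s + (K t - K s)))"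
      unfolding abs_mult by (intro mult_left_mono C(2) st) auto
    then show "\<exists>u\<in>{s..t}. \<exists>v\<in>{s..t}. \<bar>F (f t) - F (f s) - F' (f s) * (f t - f s)\<bar> \<le> \<bar>F' (f u) - F' (f v)\<bar> * (C * (t - s + (K t - K s)))"
      using st u by (intro bexI[of _ u] bexI[of _ s]) (simp_all add: left_diff_distrib)
  qed
  show ?thesis unfolding incr_def
    by (rule negligible_cong[OF negligible_add[OF 3 
        negligible_mult[OF D(1)[unfolded incr_def], of "\<lambda>s t. F' (f s)" B]]])
      (use B in \<open>auto simp: algebra_simps\<close>)
qed

lemma integral_diff_cont:
  assumes "continuous_on {a..b} (h :: real \<Rightarrow> real)" "a \<le> s" "s \<le> t" "t \<le> b"
  shows "integral {a..t} h - integral {a..s} h = integral {s..t} h"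
proof -
  have "h integrable_on {a..t}" using assms by (intro integrable_continuous_interval continuous_on_subset[OF assms(1)]) auto
  from Henstock_Kurzweil_Integration.integral_combine[OF _ _ this, of s] show ?thesis using assms by simp
qed

lemma incr_integral:
  assumes h: "continuous_on {a..b} h" and mK: "mono_on {a..b} K"
  shows "incr a b K (\<lambda>t. integral {a..t} h) h (\<lambda>t. 0)"
  unfolding incr_def
proof (rule negligible_modulus[OF mK h, where C = 1])
  fix s t assume st: "a \<le> s" "s \<le> t" "t \<le> b"
  have hst: "continuous_on {s..t} h" using h by (rule continuous_on_subset) (use st in auto)
  have m: "K s \<le> K t" using mK st by (auto simp: mono_on_def)
  obtain u where u: "u \<in> {s..t}" "\<And>v. v \<in> {s..t} \<Longrightarrow> \<bar>h v - h s\<bar> \<le> \<bar>h u - h s\<bar>"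
  proof -
    have "continuous_on {s..t} (\<lambda>v. \<bar>h v - h s\<bar>)" using hst by (intro continuous_intros)
    from continuous_attains_sup[OF _ _ this] show thesis using st that by auto
  qed
  have "integral {a..t} h - integral {a..s} h - h s * (t - s) = integral {s..t} (\<lambda>v. h v - h s)"
    using integral_diff_cont[OF h st] integrable_continuous_interval[OF hst] st
    by (subst Henstock_Kurzweil_Integration.integral_diff) auto
  also have "\<bar>\<dots>\<bar> \<le> \<bar>h u - h s\<bar> * (t - s)"
  proof -
    have "continuous_on {s..t} (\<lambda>v. h v - h s)" using hst by (intro continuous_intros)
    from integral_bound[OF _ this, of "\<bar>h u - h s\<bar>"] show ?thesis using st u by auto
  qed
  also have "\<dots> \<le> \<bar>h u - h s\<bar> * (1 * (t - s + (K t - K s)))"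
    using m by (intro mult_left_mono) auto
  finally show "\<exists>u\<in>{s..t}. \<exists>v\<in>{s..t}. \<bar>integral {a..t} h - integral {a..s} h - h s * (t - s) - 0 * (K t - K s)\<bar>
           \<le> \<bar>h u - h v\<bar> * (1 * (t - s + (K t - K s)))" using u st by (intro bexI[of _ u] bexI[of _ s]) auto
qed auto

text \<open>A rate with respect to K is determined only dK-almost everywhere.
  \<open>negligible_flat\<close> supplies the \<gamma> for which \<gamma> dK = 0.\<close>

lemma incr_null:
  assumes "incr a b K f \<alpha> \<beta>" "negligible a b K (\<lambda>s t. \<gamma> s * (K t - K s))"
  shows "incr a b K f \<alpha> (\<lambda>t. \<beta> t + \<gamma> t)"
  unfolding incr_def
  by (rule negligible_cong[OF negligible_add[OF assms(1)[unfolded incr_def] negligible_mult[OF assms(2), of "\<lambda>s t. -1" 1]]])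
    (auto simp: algebra_simps)

text \<open>Only pairs with s < c < t are new; they are cut at c, and H carries the failure of G to
  be additive there.\<close>

lemma negligible_glue:
  assumes 1: "negligible a c K G" and 2: "negligible c b K G" and 3: "negligible a b K H" and mK: "mono_on {a..b} K"
    and ac: "a \<le> c" "c \<le> b"
    and le: "\<And>s t. a \<le> s \<Longrightarrow> s \<le> c \<Longrightarrow> c \<le> t \<Longrightarrow> t \<le> b \<Longrightarrow> \<bar>G s t\<bar> \<le> \<bar>G s c\<bar> + \<bar>G c t\<bar> + \<bar>H s t\<bar>"
  shows "negligible a b K G"
proof (rule neglI)
  fix e :: real assume "e > 0"
  then have e: "e / 2 > 0" by simp
  obtain d1 where d1: "d1 > 0" "\<And>s t. a \<le> s \<Longrightarrow> s \<le> t \<Longrightarrow> t \<le> c \<Longrightarrow> t - s < d1 \<Longrightarrow>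
     \<bar>G s t\<bar> \<le> e / 2 * ((t - s) + (K t - K s))" using neglD[OF 1 e] by metis
  obtain d2 where d2: "d2 > 0" "\<And>s t. c \<le> s \<Longrightarrow> s \<le> t \<Longrightarrow> t \<le> b \<Longrightarrow> t - s < d2 \<Longrightarrow>
     \<bar>G s t\<bar> \<le> e / 2 * ((t - s) + (K t - K s))" using neglD[OF 2 e] by metis
  obtain d3 where d3: "d3 > 0" "\<And>s t. a \<le> s \<Longrightarrow> s \<le> t \<Longrightarrow> t \<le> b \<Longrightarrow> t - s < d3 \<Longrightarrow>
     \<bar>H s t\<bar> \<le> e / 2 * ((t - s) + (K t - K s))" using neglD[OF 3 e] by metis
  show "\<exists>d>0. \<forall>s t. a \<le> s \<and> s \<le> t \<and> t \<le> b \<and> t - s < d \<longrightarrow>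
     \<bar>G s t\<bar> \<le> e * ((t - s) + (K t - K s))"
  proof (intro exI[of _ "min d1 (min d2 d3)"] conjI allI impI)
    fix s t assume st: "a \<le> s \<and> s \<le> t \<and> t \<le> b \<and> t - s < min d1 (min d2 d3)"
    have m: "K s \<le> K t" using mK st by (auto simp: mono_on_def)
    have ee: "e / 2 * ((t - s) + (K t - K s)) \<le> e * ((t - s) + (K t - K s))"
      using m st \<open>e > 0\<close> by (intro mult_right_mono) auto
    consider "t \<le> c" | "c \<le> s" | "s \<le> c" "c \<le> t" by linarith
    then show "\<bar>G s t\<bar> \<le> e * ((t - s) + (K t - K s))"
    proof cases
      case 1
      then show ?thesis using d1(2)[of s t] st ee by force
    next
      case 2
      then show ?thesis using d2(2)[of s t] st ee by force
    next
      case 3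
      have "\<bar>G s t\<bar> \<le> \<bar>G s c\<bar> + \<bar>G c t\<bar> + \<bar>H s t\<bar>" using le 3 st by blast
      also have "\<dots> \<le> e / 2 * ((c - s) + (K c - K s)) + e / 2 * ((t - c) + (K t - K c)) + e / 2 * ((t - s) + (K t - K s))"
        using d1(2)[of s c] d2(2)[of c t] d3(2)[of s t] 3 st by (intro add_mono) auto
      also have "\<dots> = e * ((t - s) + (K t - K s))" by (simp add: algebra_simps)
      finally show ?thesis .
    qed
  qed (use d1 d2 d3 in auto)
qed

lemma incr_glue:
  assumes D: "incr a c K f \<alpha> \<beta>" "incr c b K f \<alpha> \<beta>" and ac: "a \<le> c" "c \<le> b"
    and mK: "mono_on {a..b} K"
    and co: "continuous_on {a..b} \<alpha>" "continuous_on {a..b} \<beta>"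
  shows "incr a b K f \<alpha> \<beta>"
proof -
  have mK': "K s \<le> K t" if "a \<le> s" "s \<le> t" "t \<le> b" for s t using mK that by (auto simp: mono_on_def)
  \<comment> \<open>Cutting [s, t] at c replaces the rates at s by those at c on [c, t].
    \<open>H1\<close> and \<open>H2\<close> are the two resulting defects, each an oscillation of a
    rate times an increment.\<close>
  define H1 where "H1 = (\<lambda>s t. if s \<le> c \<and> c \<le> t then (\<alpha> c - \<alpha> s) * (t - c) else 0)"
  define H2 where "H2 = (\<lambda>s t. if s \<le> c \<and> c \<le> t then (\<beta> c - \<beta> s) * (K t - K c) else 0)"
  have "negligible a b K H1"
  proof (rule negligible_modulus[OF mK co(1), where C = 1])
    fix s t assume st: "a \<le> s" "s \<le> t" "t \<le> b"
    show "\<exists>u\<in>{s..t}. \<exists>v\<in>{s..t}. \<bar>H1 s t\<bar> \<le> \<bar>\<alpha> u - \<alpha> v\<bar> * (1 * (t - s + (K t - K s)))"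
    proof (cases "s \<le> c \<and> c \<le> t")
      case True
      have "\<bar>H1 s t\<bar> \<le> \<bar>\<alpha> c - \<alpha> s\<bar> * (1 * (t - s + (K t - K s)))"
        using True mK'[OF st] by (auto simp: H1_def abs_mult intro!: mult_left_mono)
      then show ?thesis using True st by (intro bexI[of _ c] bexI[of _ s]) auto
    qed (use st mK'[OF st] in \<open>auto simp: H1_def intro!: bexI[of _ s]\<close>)
  qed auto
  moreover have "negligible a b K H2"
  proof (rule negligible_modulus[OF mK co(2), where C = 1])
    fix s t assume st: "a \<le> s" "s \<le> t" "t \<le> b"
    show "\<exists>u\<in>{s..t}. \<exists>v\<in>{s..t}. \<bar>H2 s t\<bar> \<le> \<bar>\<beta> u - \<beta> v\<bar> * (1 * (t - s + (K t - K s)))"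
    proof (cases "s \<le> c \<and> c \<le> t")
      case True
      have "\<bar>H2 s t\<bar> \<le> \<bar>\<beta> c - \<beta> s\<bar> * (1 * (t - s + (K t - K s)))"
        using True mK'[of s c] mK'[of c t] st by (auto simp: H2_def abs_mult intro!: mult_left_mono)
      then show ?thesis using True st by (intro bexI[of _ c] bexI[of _ s]) auto
    qed (use st mK'[OF st] in \<open>auto simp: H2_def intro!: bexI[of _ s]\<close>)
  qed auto
  ultimately have 3: "negligible a b K (\<lambda>s t. H1 s t + H2 s t)" by (rule negligible_add)
  show ?thesis unfolding incr_def
  proof (rule negligible_glue[OF D[unfolded incr_def] 3 mK ac])
    fix s t assume st: "a \<le> s" "s \<le> c" "c \<le> t" "t \<le> b"
    have "f t - f s - \<alpha> s * (t - s) - \<beta> s * (K t - K s) =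
       (f c - f s - \<alpha> s * (c - s) - \<beta> s * (K c - K s)) + (f t - f c - \<alpha> c * (t - c) - \<beta> c * (K t - K c))
       + (H1 s t + H2 s t)"
      using st by (simp add: H1_def H2_def algebra_simps)
    then show "\<bar>f t - f s - \<alpha> s * (t - s) - \<beta> s * (K t - K s)\<bar>
           \<le> \<bar>f c - f s - \<alpha> s * (c - s) - \<beta> s * (K c - K s)\<bar> + \<bar>f t - f c - \<alpha> c * (t - c) - \<beta> c * (K t - K c)\<bar> + \<bar>H1 s t + H2 s t\<bar>"
      by linarith
  qed
qed

section \<open>Solutions in characteristic coordinates\<close>

lemma swapA_square: "swapA ** swapA = mat 1"
  by (simp add: vec_eq_iff matrix_matrix_mult_def swapA_def mat_def sum_2 forall_2)

lemma scaled_swapA_power: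
  "((\<lambda>N. (r *\<^sub>R swapA) ** N) ^^ n) (mat 1) = r ^ n *\<^sub>R (if even n then mat 1 else swapA)"
proof (induction n)
  case (Suc n)
  have "((\<lambda>N. (r *\<^sub>R swapA) ** N) ^^ Suc n) (mat 1) = (r *\<^sub>R swapA) ** (r ^ n *\<^sub>R (if even n then mat 1 else swapA))"
    using Suc by simp
  also have "\<dots> = (r * r ^ n) *\<^sub>R (swapA ** (if even n then mat 1 else swapA))"
    by (simp add: vec_eq_iff matrix_matrix_mult_def sum_distrib_left mult_ac)
  finally show ?case by (simp add: swapA_square)
qed simp

text \<open>Since A squared is the identity, the even terms of the exponential series add up to cosh
  r on the diagonal and the odd ones to sinh r off it; convergence is checked entry by
  entry.\<close>

lemma mexp_swapA:
  "mexp (r *\<^sub>R swapA) = vector [vector [cosh r, sinh r], vector [sinh r, cosh r]]" (is "_ = ?S")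
proof -
  define T where "T n = (1 / fact n) *\<^sub>R (((\<lambda>N. (r *\<^sub>R swapA) ** N) ^^ n) (mat 1))" for n
  have T: "T n $ i $ j = (if (i = j) = even n then r ^ n /\<^sub>R fact n else 0)" for n i j
  proof -
    have "T n = (1 / fact n) *\<^sub>R (r ^ n *\<^sub>R (if even n then mat 1 else swapA))"
      unfolding T_def scaled_swapA_power ..
    then show ?thesis
      using exhaust_2[of i] exhaust_2[of j] by (auto simp: mat_def swapA_def divide_inverse)
  qed
  have c: "(\<lambda>n. T n $ i $ j) sums (?S $ i $ j)" for i j
  proof (cases "i = j")
    case True
    then show ?thesis using exhaust_2[of i] cosh_converges[of r] by (auto simp: T)
  next
    case False
    have "(\<lambda>n. if even n then 0 else r ^ n /\<^sub>R fact n) = (\<lambda>n. if odd n then r ^ n /\<^sub>R fact n else 0)" by auto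
    then show ?thesis using False exhaust_2[of i] exhaust_2[of j] sinh_converges[of r] by (auto simp: T)
  qed
  have "T sums ?S" unfolding sums_def
    by (intro vec_tendstoI) (use c in \<open>simp add: sums_def sum_component\<close>)
  then show ?thesis unfolding mexp_def T_def by (simp add: sums_iff)
qed

section \<open>Integrals against dK\<close>

lemma set_integrable_continuous_Ioc:
  assumes M: "sets M = sets borel" and fin: "emeasure M {s<..t} < \<infinity>"
    and g: "continuous_on {s..t} (g :: real \<Rightarrow> real)"
  shows "set_integrable M {s<..t} g"
proof -
  obtain B where B: "\<And>u. u \<in> {s..t} \<Longrightarrow> \<bar>g u\<bar> \<le> B" using continuous_abs_bound[OF g] by blast
  have "(\<lambda>x. indicator {s<..t} x *\<^sub>R g x) \<in> borel_measurable borel"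
    by (rule borel_measurable_continuous_on_indicator) (auto intro: continuous_on_subset[OF g])
  then have "(\<lambda>x. indicator {s<..t} x *\<^sub>R g x) \<in> borel_measurable M" using M by (simp add: measurable_def sets_eq_imp_space_eq[OF M])
  then show ?thesis unfolding set_integrable_def
    by (rule integrableI_bounded_set[where A = "{s<..t}" and B = B, rotated])
      (use B fin M in \<open>auto intro!: AE_I2\<close>)
qed

text \<open>This is the distribution function inside \<open>stieltjes01\<close>; to compute masses
  from it, monotonicity and right continuity are required on the whole line and not just on
  [0,1].\<close>

definition clamped :: "(real \<Rightarrow> real) \<Rightarrow> real \<Rightarrow> real" where "clamped K t = K (max 0 (min 1 t))"

lemma clamped_mono: "mono_on {0..1} K \<Longrightarrow> x \<le> y \<Longrightarrow> clamped K x \<le> clamped K y"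
  unfolding clamped_def by (rule mono_onD[where A = "{0..1}"]) auto

lemma clamped_right_cont:
  assumes "cadlag01 K" shows "continuous (at_right a) (clamped K)"
proof -
  consider "a < 0" | "a \<ge> 1" | "0 \<le> a" "a < 1" by linarith
  then show ?thesis
  proof cases
    case 1
    have "\<forall>\<^sub>F t in at_right a. K 0 = clamped K t"
      unfolding eventually_at_right[OF 1] using 1 by (intro exI[of _ 0]) (auto simp: clamped_def)
    moreover have "clamped K a = K 0" using 1 by (simp add: clamped_def)
    ultimately show ?thesis unfolding continuous_within by (auto intro: tendsto_eventually simp: eq_commute)
  next
    case 2
    have "\<forall>\<^sub>F t in at_right a. K 1 = clamped K t"
      unfolding eventually_at_right[OF less_add_one[of a]] using 2 by (intro exI[of _ "a + 1"]) (auto simp: clamped_def)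
    moreover have "clamped K a = K 1" using 2 by (simp add: clamped_def)
    ultimately show ?thesis unfolding continuous_within by (auto intro: tendsto_eventually simp: eq_commute)
  next
    case 3
    have "\<forall>\<^sub>F t in at_right a. K t = clamped K t"
      unfolding eventually_at_right[OF 3(2)] using 3 by (intro exI[of _ 1]) (auto simp: clamped_def)
    moreover have "clamped K a = K a" using 3 by (simp add: clamped_def)
    moreover have "(K \<longlongrightarrow> K a) (at_right a)" using assms 3 by (auto simp: cadlag01_def continuous_within)
    ultimately show ?thesis unfolding continuous_within by (metis Lim_transform_eventually)
  qed
qed

lemma sets_stieltjes01 [simp]: "sets (stieltjes01 K) = sets borel"
  by (simp add: stieltjes01_def)

lemma space_stieltjes01 [simp]: "space (stieltjes01 K) = UNIV"
  by (simp add: stieltjes01_def)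

lemma emeasure_stieltjes01:
  assumes "cadlag01 K" "mono_on {0..1} K" "s \<le> t"
  shows "emeasure (stieltjes01 K) {s<..t} = ennreal (clamped K t - clamped K s)"
  unfolding stieltjes01_def clamped_def[symmetric]
  by (rule emeasure_interval_measure_Ioc[OF assms(3)]) (use clamped_mono[OF assms(2)] clamped_right_cont[OF assms(1)] in auto)

text \<open>The integrand lies between c - B and c + B. The measure is kept general because the
  bound is applied both to dK and to Lebesgue measure.\<close>

lemma set_integral_Ioc_le:
  assumes M: "sets M = sets borel" and D: "emeasure M {s<..t} = ennreal D" "D \<ge> 0"
    and g: "continuous_on {s..t} (g :: real \<Rightarrow> real)" and B: "\<And>u. u \<in> {s..t} \<Longrightarrow> \<bar>g u - c\<bar> \<le> B"
  shows "\<bar>(LINT u:{s<..t}|M. g u) - c * D\<bar> \<le> B * D"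
proof -
  have const: "(LINT u:{s<..t}|M. k) = k * D" "set_integrable M {s<..t} (\<lambda>u. k)" for k
  proof -
    show "(LINT u:{s<..t}|M. k) = k * D"
      using D sets_eq_imp_space_eq[OF M] by (simp add: set_lebesgue_integral_def measure_def)
    show "set_integrable M {s<..t} (\<lambda>u. k)"
      by (rule set_integrable_continuous_Ioc[OF M]) (use D in auto)
  qed
  have gi: "set_integrable M {s<..t} g" by (rule set_integrable_continuous_Ioc[OF M _ g]) (use D in auto)
  have "g u \<le> c + B" "c - B \<le> g u" if "u \<in> {s<..t}" for u using B[of u] that by auto
  then have "(LINT u:{s<..t}|M. g u) \<le> (c + B) * D" "(LINT u:{s<..t}|M. g u) \<ge> (c - B) * D"
    using set_integral_mono[OF gi const(2), of "c + B"] set_integral_mono[OF const(2) gi, of "c - B"]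
    unfolding const(1) by auto
  then show ?thesis by (simp add: abs_le_iff algebra_simps)
qed

text \<open>In the coordinates p and q the driving measure dK - du enters only through this
  functional, with g = exp(- \<lambda>) for p and g = exp \<lambda> for q.\<close>

definition drift_int :: "(real \<Rightarrow> real) \<Rightarrow> (real \<Rightarrow> real) \<Rightarrow> real \<Rightarrow> real \<Rightarrow> real" where
  "drift_int K g s t = (LINT u:{s<..t}|stieltjes01 K. g u) - (LINT u:{s<..t}|lborel. g u)"

text \<open>Decomposing \<open>e1\<close> along the eigenvectors (1,1) and (1,-1) of A turns the
  integrand into the scalars exp(- lam u) and exp(lam u) times constant vectors, so only two scalar
  integrals remain.\<close>

lemma set_integral_mexp:
  assumes M: "sets M = sets borel"
    and i: "set_integrable M S (\<lambda>u. exp (- lam u))" "set_integrable M S (\<lambda>u. exp (lam u))"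
  shows "(LINT u:S|M. mexp ((l - lam u) *\<^sub>R swapA) *v e1) = vector
     [(exp l * (LINT u:S|M. exp (- lam u)) + exp (- l) * (LINT u:S|M. exp (lam u))) / 2,
      (exp l * (LINT u:S|M. exp (- lam u)) - exp (- l) * (LINT u:S|M. exp (lam u))) / 2]" (is "?I = ?J")
proof -
  define A where "A = (vector [exp l / 2, exp l / 2] :: real^2)"
  define B where "B = (vector [exp (-l) / 2, - exp (-l) / 2] :: real^2)"
  have f: "mexp ((l - lam u) *\<^sub>R swapA) *v e1 = exp (- lam u) *\<^sub>R A + exp (lam u) *\<^sub>R B" for u
    by (simp add: mexp_swapA vec_eq_iff forall_2 matrix_vector_mult_def sum_2 e1_def axis_def A_def B_def
        cosh_def sinh_def exp_diff exp_minus divide_simps)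
  have iA: "set_integrable M S (\<lambda>u. exp (- lam u) *\<^sub>R A)" "set_integrable M S (\<lambda>u. exp (lam u) *\<^sub>R B)"
    using i by auto
  have sc: "(LINT u:S|M. h u *\<^sub>R C) = (LINT u:S|M. h u) *\<^sub>R C" if "set_integrable M S h" for h and C :: "real^2"
    using that unfolding set_lebesgue_integral_def set_integrable_def
    by (simp flip: integral_scaleR_left)
  have "?I = (LINT u:S|M. exp (- lam u)) *\<^sub>R A + (LINT u:S|M. exp (lam u)) *\<^sub>R B"
    unfolding f using set_integral_add(2)[OF iA] sc[OF i(1)] sc[OF i(2)] by simp
  also have "\<dots> = ?J"
    by (simp add: vec_eq_iff forall_2 A_def B_def field_simps)
  finally show ?thesis .
qed

context
  fixes K :: "real \<Rightarrow> real"
  assumes cad: "cadlag01 K" and mK: "mono_on {0..1} K"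
begin

lemma set_integrable_stieltjes01:
  assumes "continuous_on {0..1} (g :: real \<Rightarrow> real)" "0 \<le> s" "t \<le> 1"
  shows "set_integrable (stieltjes01 K) {s<..t} g" "set_integrable lborel {s<..t} g"
proof -
  have g: "continuous_on {s..t} g" using assms by (auto intro: continuous_on_subset)
  have "emeasure (stieltjes01 K) {s<..t} < \<infinity>"
    by (cases "s \<le> t") (simp_all add: emeasure_stieltjes01[OF cad mK])
  then show "set_integrable (stieltjes01 K) {s<..t} g" 
    by (intro set_integrable_continuous_Ioc[OF _ _ g]) auto
  show "set_integrable lborel {s<..t} g"
    by (intro set_integrable_continuous_Ioc[OF _ _ g]) (cases "s \<le> t"; simp)+
qed

lemma drift_int_combine:
  assumes g: "continuous_on {0..1} g" and st: "0 \<le> s" "s \<le> u" "u \<le> t" "t \<le> 1"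
  shows "drift_int K g s t = drift_int K g s u + drift_int K g u t"
proof -
  have *: "{s<..t} = {s<..u} \<union> {u<..t}" using st by auto
  have "(LINT u:{s<..t}|stieltjes01 K. g u) = (LINT u:{s<..u}|stieltjes01 K. g u) + (LINT u:{u<..t}|stieltjes01 K. g u)"
    unfolding * by (rule set_integral_Un) (use st in \<open>auto intro!: set_integrable_stieltjes01 g\<close>)
  moreover have "(LINT u:{s<..t}|lborel. g u) = (LINT u:{s<..u}|lborel. g u) + (LINT u:{u<..t}|lborel. g u)"
    unfolding * by (rule set_integral_Un) (use st in \<open>auto intro!: set_integrable_stieltjes01 g\<close>)
  ultimately show ?thesis unfolding drift_int_def by simp
qed

text \<open>Freezing g at the left endpoint s changes each of the two integrals by at most the
  largest deviation of g from g s times the mass of (s, t], and that deviation is an oscillation of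
  g.\<close>

lemma incr_drift_int:
  assumes g: "continuous_on {0..1} g"
  shows "incr 0 1 K (\<lambda>t. drift_int K g 0 t) (\<lambda>t. - g t) g"
  unfolding incr_def
proof (rule negligible_modulus[OF mK g, where C = 1])
  fix s t :: real assume st: "0 \<le> s" "s \<le> t" "t \<le> 1"
  have m: "K s \<le> K t" using mK st by (auto simp: mono_on_def)
  have hst: "continuous_on {s..t} g" using g by (rule continuous_on_subset) (use st in auto)
  obtain u where u: "u \<in> {s..t}" "\<And>v. v \<in> {s..t} \<Longrightarrow> \<bar>g v - g s\<bar> \<le> \<bar>g u - g s\<bar>"
  proof -
    have "continuous_on {s..t} (\<lambda>v. \<bar>g v - g s\<bar>)" using hst by (intro continuous_intros)
    from continuous_attains_sup[OF _ _ this] show thesis using st that by auto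
  qed
  have 1: "\<bar>(LINT v:{s<..t}|stieltjes01 K. g v) - g s * (K t - K s)\<bar> \<le> \<bar>g u - g s\<bar> * (K t - K s)"
    using u(2) st m by (intro set_integral_Ioc_le[OF _ _ _ hst]) (auto simp: emeasure_stieltjes01[OF cad mK] clamped_def)
  have 2: "\<bar>(LINT v:{s<..t}|lborel. g v) - g s * (t - s)\<bar> \<le> \<bar>g u - g s\<bar> * (t - s)"
    using u(2) st m by (intro set_integral_Ioc_le[OF _ _ _ hst]) auto
  have "drift_int K g 0 t - drift_int K g 0 s = drift_int K g s t"
    using drift_int_combine[OF g, of 0 s t] st by simp
  then have "\<bar>drift_int K g 0 t - drift_int K g 0 s - - g s * (t - s) - g s * (K t - K s)\<bar> \<le> \<bar>g u - g s\<bar> * (1 * (t - s + (K t - K s)))"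
    using 1 2 unfolding drift_int_def[of K g s t] by (simp only: distrib_left mult_1_left)
  then show "\<exists>u\<in>{s..t}. \<exists>v\<in>{s..t}. \<bar>drift_int K g 0 t - drift_int K g 0 s - - g s * (t - s) - g s * (K t - K s)\<bar>
           \<le> \<bar>g u - g v\<bar> * (1 * (t - s + (K t - K s)))" using u st by (intro bexI[of _ u] bexI[of _ s]) auto
qed auto

text \<open>On the eigenvectors (1,1) and (1,-1) of A the propagator acts by the scalars exp(lam t -
  lam s) and exp(lam s - lam t), which the factors in p and q cancel, so the vector equation
  decouples. One direction serves to analyse solutions, the other to produce them.\<close>

lemma solution_eq_iff:
  fixes Z :: "real \<Rightarrow> real^2"
  assumes lam: "continuous_on {0..1} lam" and st: "0 \<le> s" "s \<le> t" "t \<le> 1"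
  defines "p \<equiv> \<lambda>t. exp (- lam t) * (Z t $ 1 + Z t $ 2)" and "q \<equiv> \<lambda>t. exp (lam t) * (Z t $ 1 - Z t $ 2)"
  shows "Z t = mexp ((lam t - lam s) *\<^sub>R swapA) *v Z s
            + ((LINT u:{s<..t}|stieltjes01 K. mexp ((lam t - lam u) *\<^sub>R swapA) *v e1)
               - (LINT u:{s<..t}|lborel. mexp ((lam t - lam u) *\<^sub>R swapA) *v e1)) \<longleftrightarrow>
     p t - p s = drift_int K (\<lambda>u. exp (- lam u)) s t \<and> q t - q s = drift_int K (\<lambda>u. exp (lam u)) s t"
proof -
  have c: "continuous_on {0..1} (\<lambda>u. exp (- lam u))" "continuous_on {0..1} (\<lambda>u. exp (lam u))"
    using lam by (auto intro!: continuous_intros)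
  define I where "I = drift_int K (\<lambda>u. exp (- lam u)) s t"
  define J where "J = drift_int K (\<lambda>u. exp (lam u)) s t"
  define l where "l = lam t" define k where "k = lam s"
  have V: "((LINT u:{s<..t}|stieltjes01 K. mexp ((lam t - lam u) *\<^sub>R swapA) *v e1)
               - (LINT u:{s<..t}|lborel. mexp ((lam t - lam u) *\<^sub>R swapA) *v e1)) =
      vector [(exp l * I + exp (- l) * J) / 2, (exp l * I - exp (- l) * J) / 2]"
    unfolding set_integral_mexp[OF sets_stieltjes01 set_integrable_stieltjes01(1)[OF c(1) st(1,3)] set_integrable_stieltjes01(1)[OF c(2) st(1,3)]]
      set_integral_mexp[OF sets_lborel set_integrable_stieltjes01(2)[OF c(1) st(1,3)] set_integrable_stieltjes01(2)[OF c(2) st(1,3)]]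
    by (simp add: I_def J_def drift_int_def l_def vec_eq_iff forall_2 field_simps)
  define x where "x = Z t $ 1" define y where "y = Z t $ 2"
  define x' where "x' = Z s $ 1" define y' where "y' = Z s $ 2"
  have e: "exp (-l) = 1 / exp l" "exp (-k) = 1 / exp k" by (simp_all add: exp_minus inverse_eq_divide)
  define E where "E = exp l" define F where "F = exp k"
  have EF: "E > 0" "F > 0" by (auto simp: E_def F_def)
  have el: "cosh (l - k) = (E / F + F / E) / 2" "sinh (l - k) = (E / F - F / E) / 2"
    using EF by (simp_all add: cosh_def sinh_def exp_diff E_def F_def exp_minus field_simps)
  have "(x = cosh (l - k) * x' + sinh (l - k) * y' + (E * I + 1 / E * J) / 2 \<and>
     y = sinh (l - k) * x' + cosh (l - k) * y' + (E * I - 1 / E * J) / 2) \<longleftrightarrow>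
    (x + y = E / F * (x' + y') + E * I \<and> x - y = F / E * (x' - y') + 1 / E * J)"
    unfolding el by (auto simp: algebra_simps add_divide_distrib diff_divide_distrib)
  also have "\<dots> \<longleftrightarrow> (1 / E * (x + y) - 1 / F * (x' + y') = I \<and> E * (x - y) - F * (x' - y') = J)"
    using EF by (auto simp: field_simps)
  finally show ?thesis unfolding V unfolding mexp_swapA vec_eq_iff forall_2 p_def q_def
    using EF
    by (simp add: matrix_vector_mult_def sum_2 I_def[symmetric] J_def[symmetric] l_def[symmetric] k_def[symmetric]
      e E_def[symmetric] F_def[symmetric] x_def[symmetric] y_def[symmetric] x'_def[symmetric] y'_def[symmetric])
qed

end

text \<open>
  Here \<open>p\<close> and \<open>q\<close> stand for $e^{-\lambda}(x+y)$ and $e^{\lambda}(x-y)$, so that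
  $e^{\lambda}p + e^{-\lambda}q = 2x$. The last clause expresses that \<open>dK\<close> is carried by
  $\{x = 0\}$. Continuity of \<open>K\<close> is no restriction: a jump of \<open>K\<close> at \<open>t\<close> would make $x_t$
  positive, where \<open>dK\<close> has no mass.
\<close>

definition refl_sol :: "real \<Rightarrow> real \<Rightarrow> (real \<Rightarrow> real) \<Rightarrow> (real \<Rightarrow> real) \<Rightarrow> (real \<Rightarrow> real) \<Rightarrow> (real \<Rightarrow> real) \<Rightarrow> bool" where
  "refl_sol a b lam p q K \<longleftrightarrow> mono_on {a..b} K \<and> continuous_on {a..b} K \<and>
     incr a b K p (\<lambda>t. - exp (- lam t)) (\<lambda>t. exp (- lam t)) \<and>
     incr a b K q (\<lambda>t. - exp (lam t)) (\<lambda>t. exp (lam t)) \<and>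
     (\<forall>t\<in>{a..b}. exp (lam t) * p t + exp (- lam t) * q t \<ge> 0) \<and>
     (\<forall>s t. a \<le> s \<and> s \<le> t \<and> t \<le> b \<and> (\<forall>u\<in>{s..t}. exp (lam u) * p u + exp (- lam u) * q u > 0) \<longrightarrow> K s = K t)"

text \<open>Here K may jump at t. As s increases to t the increment of K stays bounded, so the error
  term still tends to 0 and only \<beta> t times the jump of K survives.\<close>

lemma incr_left_limit:
  assumes D: "incr a b K f \<alpha> \<beta>" and t: "a < t" "t \<le> b" and l: "(K \<longlongrightarrow> l) (at_left t)"
    and c: "continuous_on {a..b} \<alpha>" "continuous_on {a..b} \<beta>"
  shows "(f \<longlongrightarrow> f t - \<beta> t * (K t - l)) (at_left t)"
proof -
  note lim = continuous_on_at_left[OF _ t]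
  have bd: "((\<lambda>s. (t - s) + (K t - K s)) \<longlongrightarrow> (t - t) + (K t - l)) (at_left t)"
    by (intro tendsto_intros l)
  have z: "((\<lambda>s. f t - f s - \<alpha> s * (t - s) - \<beta> s * (K t - K s)) \<longlongrightarrow> 0) (at_left t)"
    unfolding tendsto_iff
  proof (intro allI impI)
    fix e :: real assume e: "e > 0"
    define e' where "e' = e / (\<bar>K t - l\<bar> + 2)"
    have e': "e' > 0" using e by (simp add: e'_def)
    obtain d where d: "d > 0" "\<And>s u. a \<le> s \<Longrightarrow> s \<le> u \<Longrightarrow> u \<le> b \<Longrightarrow> u - s < d \<Longrightarrow>
     \<bar>f u - f s - \<alpha> s * (u - s) - \<beta> s * (K u - K s)\<bar> \<le> e' * ((u - s) + (K u - K s))"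
      using neglD[OF D[unfolded incr_def] e'] by metis
    have "\<forall>\<^sub>F s in at_left t. max a (t - d) < s"
      using t d by (intro eventually_at_leftI[of "max a (t - d)"]) auto
    moreover have "\<forall>\<^sub>F s in at_left t. s < t" by (simp add: eventually_at_filter)
    moreover have "\<forall>\<^sub>F s in at_left t. (t - s) + (K t - K s) < \<bar>K t - l\<bar> + 1"
      using bd by (rule order_tendstoD) auto
    ultimately show "\<forall>\<^sub>F s in at_left t. dist (f t - f s - \<alpha> s * (t - s) - \<beta> s * (K t - K s)) 0 < e"
    proof eventually_elim
      case (elim s)
      have "\<bar>f t - f s - \<alpha> s * (t - s) - \<beta> s * (K t - K s)\<bar> \<le> e' * ((t - s) + (K t - K s))"
        using elim t by (intro d(2)) auto
      also have "\<dots> \<le> e' * (\<bar>K t - l\<bar> + 1)" using e' elim by (intro mult_left_mono) auto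
      also have "\<dots> < e' * (\<bar>K t - l\<bar> + 2)" using e' by (intro mult_strict_left_mono) auto
      also have "\<dots> = e" by (simp add: e'_def)
      finally show ?case by simp
    qed
  qed
  have "((\<lambda>s. f t - \<alpha> s * (t - s) - \<beta> s * (K t - K s) - (f t - f s - \<alpha> s * (t - s) - \<beta> s * (K t - K s))) \<longlongrightarrow>
     f t - \<alpha> t * (t - t) - \<beta> t * (K t - l) - 0) (at_left t)"
    by (intro tendsto_intros l z lim c)
  then show ?thesis by simp
qed

lemma continuous_on_Icc_one_sided:
  fixes f :: "real \<Rightarrow> real"
  assumes r: "\<And>t. a \<le> t \<Longrightarrow> t < b \<Longrightarrow> (f \<longlongrightarrow> f t) (at_right t)"
    and l: "\<And>t. a < t \<Longrightarrow> t \<le> b \<Longrightarrow> (f \<longlongrightarrow> f t) (at_left t)" and ab: "a < b"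
  shows "continuous_on {a..b} f"
  unfolding continuous_on_def
proof
  fix t assume t: "t \<in> {a..b}"
  consider "t = a" | "t = b" | "a < t" "t < b" using t by force
  then show "(f \<longlongrightarrow> f t) (at t within {a..b})"
  proof cases
    case 1 then show ?thesis using r[of a] ab by (simp add: at_within_Icc_at_right)
  next
    case 2 then show ?thesis using l[of b] ab by (simp add: at_within_Icc_at_left)
  next
    case 3
    then have "(f \<longlongrightarrow> f t) (at t)" using l[of t] r[of t] by (intro filterlim_split_at) auto
    then show ?thesis by (rule tendsto_within_subset) auto
  qed
qed

text \<open>The work lies in the continuity of K from the left; the remaining clauses translate the
  definition through \<open>solution_eq_iff\<close>.\<close>

lemma solution_pair_imp_refl_sol:
  assumes lam: "continuous_on {0..1} lam" and sol: "solution_pair lam Z K"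
  shows "refl_sol 0 1 lam (\<lambda>t. exp (- lam t) * (Z t $ 1 + Z t $ 2)) (\<lambda>t. exp (lam t) * (Z t $ 1 - Z t $ 2)) K"
proof -
  define p where "p = (\<lambda>t. exp (- lam t) * (Z t $ 1 + Z t $ 2))"
  define q where "q = (\<lambda>t. exp (lam t) * (Z t $ 1 - Z t $ 2))"
  have c: "continuous_on {0..1} (\<lambda>u. exp (- lam u))" "continuous_on {0..1} (\<lambda>u. exp (lam u))"
     "continuous_on {0..1} (\<lambda>u. - exp (- lam u))" "continuous_on {0..1} (\<lambda>u. - exp (lam u))"
    using lam by (auto intro!: continuous_intros)
  have e1: "z \<bullet> e1 = z $ 1" for z :: "real^2" by (simp add: e1_def inner_axis)
  have cad: "cadlag01 K" and mK: "mono_on {0..1} K" and x0: "\<And>t. t \<in> {0..1} \<Longrightarrow> Z t $ 1 \<ge> 0"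
    and ae: "AE t in stieltjes01 K. t \<in> {0..1} \<longrightarrow> Z t $ 1 = 0"
    using sol by (auto simp: solution_pair_def e1)
  have eq: "p t - p s = drift_int K (\<lambda>u. exp (- lam u)) s t" "q t - q s = drift_int K (\<lambda>u. exp (lam u)) s t"
    if st: "0 \<le> s" "s \<le> t" "t \<le> 1" for s t
    using sol st solution_eq_iff[OF cad mK lam st, of Z] by (auto simp: solution_pair_def p_def q_def)
  have eq0: "p 0 + drift_int K (\<lambda>u. exp (- lam u)) 0 t = p t" "q 0 + drift_int K (\<lambda>u. exp (lam u)) 0 t = q t"
    if "t \<in> {0..1}" for t
    using eq[of 0 t] that by auto
  have x: "exp (lam t) * p t + exp (- lam t) * q t = 2 * Z t $ 1" for t
    by (simp add: p_def q_def exp_minus field_simps)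
  have "incr 0 1 K (\<lambda>t. p 0 + drift_int K (\<lambda>u. exp (- lam u)) 0 t) (\<lambda>t. - exp (- lam t)) (\<lambda>t. exp (- lam t))"
    using incr_add[OF incr_const[OF mK] incr_drift_int[OF cad mK c(1)]] by simp
  then have Dp: "incr 0 1 K p (\<lambda>t. - exp (- lam t)) (\<lambda>t. exp (- lam t))"
    by (rule incr_cong) (use eq0 in auto)
  have "incr 0 1 K (\<lambda>t. q 0 + drift_int K (\<lambda>u. exp (lam u)) 0 t) (\<lambda>t. - exp (lam t)) (\<lambda>t. exp (lam t))"
    using incr_add[OF incr_const[OF mK] incr_drift_int[OF cad mK c(2)]] by simp
  then have Dq: "incr 0 1 K q (\<lambda>t. - exp (lam t)) (\<lambda>t. exp (lam t))"
    by (rule incr_cong) (use eq0 in auto)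
  obtain N where N: "{t. \<not> (t \<in> {0..1} \<longrightarrow> Z t $ 1 = 0)} \<subseteq> N" "emeasure (stieltjes01 K) N = 0" "N \<in> sets borel"
    using AE_E[OF ae] by auto
  have null: "emeasure (stieltjes01 K) A = 0" if "A \<subseteq> {0..1}" "\<And>t. t \<in> A \<Longrightarrow> Z t $ 1 > 0" for A
  proof -
    have "A \<subseteq> N" using that N(1) by force
    then show ?thesis using emeasure_mono[of A N "stieltjes01 K"] N by simp
  qed
  have left: "(K \<longlongrightarrow> K t) (at_left t)" if t: "0 < t" "t \<le> 1" for t
  proof -
    have "\<exists>l. (K \<longlongrightarrow> l) (at_left t)" using cad t by (simp add: cadlag01_def)
    then obtain l where l: "(K \<longlongrightarrow> l) (at_left t)" by blast
    have ev: "\<forall>\<^sub>F s in at_left t. s \<in> {0<..<t}" using t by (intro eventually_at_leftI[of 0]) auto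
    have Kl: "K s \<le> l" if s: "0 \<le> s" "s < t" for s
    proof (rule tendsto_lowerbound[OF l])
      have "\<forall>\<^sub>F u in at_left t. u \<in> {s<..<t}" using s by (intro eventually_at_leftI[of s]) auto
      then show "\<forall>\<^sub>F u in at_left t. K s \<le> K u"
        by eventually_elim (use mK s t in \<open>auto simp: mono_on_def\<close>)
    qed simp
    have le: "l \<le> K t"
      by (rule tendsto_upperbound[OF l eventually_mono[OF ev]]) (use mK t in \<open>auto simp: mono_on_def\<close>)
    have "l = K t"
    proof (rule ccontr)
      assume "l \<noteq> K t"
      then have J: "K t - l > 0" using le by simp
      \<comment> \<open>The mass of the point t is the limit of the masses of (t - t/(n+1), t], each
        of which is at least K t - l > 0; hence x vanishes at t.\<close>
      define A where "A = (\<lambda>n. {t - t / real (n + 1)<..t})"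
      have dec: "decseq A"
        unfolding A_def decseq_def using t by (auto intro!: divide_left_mono elim!: order.strict_trans1[rotated])
      have At: "(\<Inter>n. A n) = {t}"
      proof
        show "{t} \<subseteq> (\<Inter>n. A n)" using t by (auto simp: A_def)
        show "(\<Inter>n. A n) \<subseteq> {t}"
        proof
          fix s assume s: "s \<in> (\<Inter>n. A n)"
          then have "s \<le> t" by (auto simp: A_def)
          moreover have "\<not> s < t"
          proof
            assume st: "s < t"
            obtain n :: nat where "t / (t - s) < n" using reals_Archimedean2 by blast
            then have "t < (n + 1) * (t - s)" using st by (simp add: field_simps)
            then have "t / (n + 1) < t - s" by (simp add: field_simps)
            then show False using s by (auto simp: A_def dest!: spec[of _ n])
          qed
          ultimately show "s \<in> {t}" by simp
        qed
      qed
      have em: "emeasure (stieltjes01 K) (A n) = ennreal (K t - K (t - t / real (n + 1)))" for n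
      proof -
        have "0 \<le> t / real (n + 1)" "t / real (n + 1) \<le> t" using t by (auto simp: field_simps)
        then have "0 \<le> t - t / real (n + 1)" "t - t / real (n + 1) \<le> 1" using t by linarith+
        then show ?thesis unfolding A_def using t
          by (subst emeasure_stieltjes01[OF cad mK]) (auto simp: clamped_def)
      qed
      have "emeasure (stieltjes01 K) (\<Inter>n. A n) = (INF n. emeasure (stieltjes01 K) (A n))"
        by (rule INF_emeasure_decseq[OF _ dec, symmetric]) (use em in \<open>auto simp: A_def\<close>)
      moreover have "(INF n. emeasure (stieltjes01 K) (A n)) \<ge> ennreal (K t - l)"
      proof (rule INF_greatest)
        fix n
        have "t - t / real (n + 1) \<ge> 0" "t - t / real (n + 1) < t" using t by (auto simp: field_simps)
        then show "ennreal (K t - l) \<le> emeasure (stieltjes01 K) (A n)" unfolding em using Kl by (auto intro!: ennreal_leI)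
      qed
      ultimately have pos: "emeasure (stieltjes01 K) {t} > 0" unfolding At using J
        by (metis ennreal_0 ennreal_less_iff less_le_trans order_refl)
      have "Z t $ 1 = 0"
      proof (rule ccontr)
        assume "Z t $ 1 \<noteq> 0"
        then have "Z t $ 1 > 0" using x0[of t] t by simp
        then show False using null[of "{t}"] pos t by simp
      qed
      note lamt = continuous_on_at_left[OF lam t]
      \<comment> \<open>The jumps of p and q combine so that x jumps by exactly K t - l. As x is 0
        at t, its left limit would be negative.\<close>
      have "((\<lambda>s. exp (lam s) * p s + exp (- lam s) * q s) \<longlongrightarrow>
        exp (lam t) * (p t - exp (- lam t) * (K t - l)) + exp (- lam t) * (q t - exp (lam t) * (K t - l))) (at_left t)"
        by (intro tendsto_intros lamt incr_left_limit[OF Dp t l c(3,1)] incr_left_limit[OF Dq t l c(4,2)])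
      moreover have "\<forall>\<^sub>F s in at_left t. 0 \<le> exp (lam s) * p s + exp (- lam s) * q s"
        using ev by eventually_elim (use x0 t in \<open>auto simp: x\<close>)
      ultimately have "0 \<le> exp (lam t) * (p t - exp (- lam t) * (K t - l)) + exp (- lam t) * (q t - exp (lam t) * (K t - l))"
        by (rule tendsto_lowerbound) simp
      also have "\<dots> = 2 * Z t $ 1 - 2 * (K t - l)" unfolding x[symmetric]
        by (simp add: exp_minus field_simps)
      finally show False using J \<open>Z t $ 1 = 0\<close> by simp
    qed
    then show ?thesis using l by simp
  qed
  have cK: "continuous_on {0..1} K"
    by (rule continuous_on_Icc_one_sided) (use left cad in \<open>auto simp: cadlag01_def continuous_within\<close>)
  have "K s = K t" if st: "0 \<le> s" "s \<le> t" "t \<le> 1" and pos: "\<forall>u\<in>{s..t}. Z u $ 1 > 0" for s t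
  proof -
    have "emeasure (stieltjes01 K) {s<..t} = 0" by (rule null) (use st pos in auto)
    then show ?thesis unfolding emeasure_stieltjes01[OF cad mK st(2)] clamped_def
      using st mK by (auto simp: ennreal_eq_0_iff mono_on_def intro!: antisym)
  qed
  then show ?thesis unfolding refl_sol_def p_def[symmetric] q_def[symmetric] x
    using mK cK Dp Dq x0 by auto
qed

text \<open>The reflected system is assumed on [a,1] with a > 0 only, because the polar description
  of the second solution degenerates at time 0, where R = 0. Continuity of p, q and K carries the
  equation to 0.\<close>

lemma refl_sol_imp_solution:
  assumes lam: "continuous_on {0..1} lam" and mK: "mono_on {0..1} K" and cK: "continuous_on {0..1} K"
    and p: "continuous_on {0..1} p" and q: "continuous_on {0..1} q"
    and sol: "\<And>a. 0 < a \<Longrightarrow> a < 1 \<Longrightarrow> refl_sol a 1 lam p q K"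
    and x0: "exp (lam 0) * p 0 + exp (- lam 0) * q 0 \<ge> 0"
  shows "solution lam (\<lambda>t. vector [(exp (lam t) * p t + exp (- lam t) * q t) / 2, (exp (lam t) * p t - exp (- lam t) * q t) / 2])"
proof -
  define Z :: "real \<Rightarrow> real^2" where "Z = (\<lambda>t. vector [(exp (lam t) * p t + exp (- lam t) * q t) / 2, (exp (lam t) * p t - exp (- lam t) * q t) / 2])"
  have c: "continuous_on {0..1} (\<lambda>u. exp (- lam u))" "continuous_on {0..1} (\<lambda>u. exp (lam u))"
     "continuous_on {0..1} (\<lambda>u. - exp (- lam u))" "continuous_on {0..1} (\<lambda>u. - exp (lam u))"
    using lam by (auto intro!: continuous_intros)
  have e1: "z \<bullet> e1 = z $ 1" for z :: "real^2" by (simp add: e1_def inner_axis)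
  have pq: "exp (- lam t) * (Z t $ 1 + Z t $ 2) = p t" "exp (lam t) * (Z t $ 1 - Z t $ 2) = q t" for t
    by (simp_all add: Z_def exp_minus field_simps)
  have cad: "cadlag01 K" unfolding cadlag01_def
  proof (intro conjI ballI)
    show "continuous (at_right t) K" if "t \<in> {0..<1}" for t
      using continuous_on_at_right[OF cK] that by (simp add: continuous_within)
    show "\<exists>l. (K \<longlongrightarrow> l) (at_left t)" if "t \<in> {0<..1}" for t
      using continuous_on_at_left[OF cK] that by auto
  qed
  \<comment> \<open>On each [t,1] with t > 0 the difference of f and its integral has zero rates, so
    it is constant on (0,1], and by continuity on [0,1].\<close>
  have ext: "f t - f s = drift_int K g s t"
    if f: "continuous_on {0..1} f" and g: "continuous_on {0..1} g" and st: "0 \<le> s" "s \<le> t" "t \<le> 1"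
      and D: "\<And>a. 0 < a \<Longrightarrow> a < 1 \<Longrightarrow> incr a 1 K f (\<lambda>t. - g t) g" for f g s t
  proof -
    have Dd: "incr 0 1 K (\<lambda>t. drift_int K g 0 t) (\<lambda>t. - g t) g" by (rule incr_drift_int[OF cad mK g])
    define h where "h = (\<lambda>t. f t - drift_int K g 0 t)"
    have ch: "continuous_on {0..1} h" unfolding h_def
      by (intro continuous_intros f incr_continuous[OF Dd mK cK] g)
    have h1: "h t = h 1" if t: "0 < t" "t \<le> 1" for t
    proof (cases "t = 1")
      case False
      then have "t < 1" using t by simp
      have "incr t 1 K h (\<lambda>t. 0) (\<lambda>t. 0)"
        using incr_diff[OF D[OF t(1) \<open>t < 1\<close>] incr_subset[OF Dd, of t 1]] t unfolding h_def by simp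
      then show ?thesis by (rule incr_0_const) (use t mK in \<open>auto intro: mono_on_subset\<close>)
    qed simp
    have "h 0 = h 1" by (rule eq_at_left_endpoint[OF ch]) (auto intro: h1)
    then have "h t = h 1" if "0 \<le> t" "t \<le> 1" for t using h1[of t] that by (metis order_le_less)
    then have "h s = h t" using st by (metis order_trans)
    moreover have "drift_int K g 0 t = drift_int K g 0 s + drift_int K g s t" by (rule drift_int_combine[OF cad mK g]) (use st in auto)
    ultimately show ?thesis by (simp add: h_def)
  qed
  have x0': "exp (lam t) * p t + exp (- lam t) * q t \<ge> 0" if "t \<in> {0..1}" for t
  proof (cases "t = 0")
    case False
    have "refl_sol (t / 2) 1 lam p q K" using that False by (intro sol) auto
    then show ?thesis using that by (auto simp: refl_sol_def)
  qed (use x0 in simp)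
  \<comment> \<open>Around each t > 0 with x > 0 there is an interval with rational ends on which x
    > 0, hence K is constant. Countably many such intervals, each of dK-mass 0, cover these t;
    \<open>{..0}\<close> takes care of t = 0.\<close>
  define P where "P = {(r :: rat, r' :: rat). 0 < real_of_rat r \<and> real_of_rat r \<le> real_of_rat r' \<and> real_of_rat r' \<le> 1 \<and> K (of_rat r) = K (of_rat r')}"
  define N where "N = {..0} \<union> (\<Union>(r, r')\<in>P. {real_of_rat r<..of_rat r'})"
  have nul0: "emeasure (stieltjes01 K) {..0} = 0"
  proof -
    have "{..0::real} = (\<Union>n. {- real n<..0})"
      by (auto intro: order.strict_trans2 simp: minus_less_iff) (metis minus_less_iff reals_Archimedean2)
    moreover have "emeasure (stieltjes01 K) (\<Union>n. {- real n<..0}) = 0"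
      by (rule emeasure_UN_eq_0) (auto simp: emeasure_stieltjes01[OF cad mK] clamped_def)
    ultimately show ?thesis by simp
  qed
  have "emeasure (stieltjes01 K) (\<Union>(r, r')\<in>P. {real_of_rat r<..of_rat r'}) = 0"
  proof -
    have "(\<Union>(r, r')\<in>P. {real_of_rat r<..of_rat r'}) \<in> null_sets (stieltjes01 K)"
    proof (rule null_sets_UN')
      fix i assume "i \<in> P"
      then obtain r r' where i: "i = (r, r')" "0 < real_of_rat r" "real_of_rat r \<le> real_of_rat r'"
        "real_of_rat r' \<le> 1" "K (of_rat r) = K (of_rat r')" unfolding P_def by blast
      then have "clamped K (of_rat r) = K (of_rat r)" "clamped K (of_rat r') = K (of_rat r')"
        unfolding clamped_def by (metis max.absorb2 min.absorb2 order_less_imp_le order_trans)+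
      then show "(case i of (r, r') \<Rightarrow> {real_of_rat r<..real_of_rat r'}) \<in> null_sets (stieltjes01 K)"
        using i(3,5) by (auto simp: i(1) null_sets_def emeasure_stieltjes01[OF cad mK])
    qed simp
    then show ?thesis by auto
  qed
  then have N0: "N \<in> null_sets (stieltjes01 K)" unfolding N_def using nul0
    by (intro null_sets.Un) (auto simp: null_sets_def intro!: sets.countable_UN')
  have cx: "continuous_on {0..1} (\<lambda>t. exp (lam t) * p t + exp (- lam t) * q t)" by (intro continuous_intros c p q lam)
  have "AE t in stieltjes01 K. t \<in> {0..1} \<longrightarrow> Z t \<bullet> e1 = 0"
  proof (rule AE_I'[OF N0], rule subsetI)
    fix t assume "t \<in> {t \<in> space (stieltjes01 K). \<not> (t \<in> {0..1} \<longrightarrow> Z t \<bullet> e1 = 0)}"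
    then have t: "t \<in> {0..1}" "Z t \<bullet> e1 \<noteq> 0" by auto
    then have xt: "exp (lam t) * p t + exp (- lam t) * q t > 0" using x0'[of t] by (simp add: e1 Z_def)
    show "t \<in> N"
    proof (cases "t = 0")
      case True then show ?thesis by (simp add: N_def)
    next
      case False
      have "((\<lambda>t. exp (lam t) * p t + exp (- lam t) * q t) \<longlongrightarrow> exp (lam t) * p t + exp (- lam t) * q t) (at t within {0..1})"
        using cx t by (auto simp: continuous_on_def)
      then have "\<forall>\<^sub>F u in at t within {0..1}. exp (lam u) * p u + exp (- lam u) * q u > 0"
        using xt by (rule order_tendstoD)
      then obtain d where d: "d > 0" "\<And>u. u \<in> {0..1} \<Longrightarrow> \<bar>u - t\<bar> < d \<Longrightarrow> exp (lam u) * p u + exp (- lam u) * q u > 0"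
        using xt unfolding eventually_at dist_real_def by metis
      have tp: "0 < t" "t \<le> 1" using t False by auto
      obtain r where r: "max 0 (t - d) < real_of_rat r" "real_of_rat r < t" using of_rat_dense[of "max 0 (t - d)" t] tp d by auto
      obtain r' where r': "t \<le> real_of_rat r'" "real_of_rat r' < t + d" "real_of_rat r' \<le> 1"
      proof (cases "t = 1")
        case True then show thesis using d by (intro that[of 1]) auto
      next
        case False
        then obtain r' where "t < real_of_rat r'" "real_of_rat r' < min 1 (t + d)" using of_rat_dense[of t "min 1 (t + d)"] tp d by auto
        then show thesis by (intro that[of r']) auto
      qed
      have rp: "0 < real_of_rat r" "t - d < real_of_rat r" using r(1) by (metis max_less_iff_conj)+
      have "refl_sol (of_rat r) 1 lam p q K" using rp(1) r(2) tp by (intro sol) linarith+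
      moreover have "\<forall>u\<in>{real_of_rat r..of_rat r'}. exp (lam u) * p u + exp (- lam u) * q u > 0"
      proof
        fix u assume "u \<in> {real_of_rat r..of_rat r'}"
        then have u: "real_of_rat r \<le> u" "u \<le> of_rat r'" by auto
        then have "0 \<le> u" "u \<le> 1" "\<bar>u - t\<bar> < d" using rp r(2) r' by linarith+
        then show "exp (lam u) * p u + exp (- lam u) * q u > 0" by (intro d(2)) auto
      qed
      moreover have rr: "real_of_rat r \<le> real_of_rat r'" using r(2) r'(1) by linarith
      ultimately have "K (of_rat r) = K (of_rat r')" 
        unfolding refl_sol_def using r'(3) by blast
      then have "(r, r') \<in> P" unfolding P_def using rp(1) rr r'(3) by blast
      moreover have "t \<in> {real_of_rat r<..of_rat r'}" using r(2) r'(1) by simp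
      ultimately show ?thesis unfolding N_def by blast
    qed
  qed
  moreover have "Z t = mexp ((lam t - lam s) *\<^sub>R swapA) *v Z s
            + ((LINT u:{s<..t}|stieltjes01 K. mexp ((lam t - lam u) *\<^sub>R swapA) *v e1)
               - (LINT u:{s<..t}|lborel. mexp ((lam t - lam u) *\<^sub>R swapA) *v e1))" if st: "0 \<le> s" "s \<le> t" "t \<le> 1" for s t
    unfolding solution_eq_iff[OF cad mK lam st] pq
    using ext[OF p c(1) st] ext[OF q c(2) st] sol by (auto simp: refl_sol_def)
  ultimately have "solution_pair lam Z K" unfolding solution_pair_def
    using cad mK x0' by (auto simp: e1 Z_def)
  then show ?thesis unfolding solution_def Z_def by blast
qed

section \<open>Hyperbolic polar coordinates\<close>

text \<open>This is the reflection y -> -y combined with \<lambda> -> -\<lambda>, under which x and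
  K are unchanged. It transfers results for y > 0 to y < 0.\<close>

lemma refl_sol_swap: "refl_sol a b lam p q K \<Longrightarrow> refl_sol a b (\<lambda>t. - lam t) q p K"
  unfolding refl_sol_def by (simp add: add.commute)

text \<open>If K increases between s and t, then \<gamma> has a zero there and
  \<open>\<gamma> s\<close> is an oscillation of \<gamma>. In this way the condition that dK is
  carried by {x = 0} enters the calculus.\<close>

lemma negligible_flat:
  assumes mK: "mono_on {a..b} K" and g: "continuous_on {a..b} \<gamma>"
    and fl: "\<And>s t. a \<le> s \<Longrightarrow> s \<le> t \<Longrightarrow> t \<le> b \<Longrightarrow> K s = K t \<or> (\<exists>u\<in>{s..t}. \<gamma> u = 0)"
  shows "negligible a b K (\<lambda>s t. \<gamma> s * (K t - K s))"
proof (rule negligible_modulus[OF mK g, where C = 1])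
  fix s t assume st: "a \<le> s" "s \<le> t" "t \<le> b"
  have m: "K s \<le> K t" using mK st by (auto simp: mono_on_def)
  show "\<exists>u\<in>{s..t}. \<exists>v\<in>{s..t}. \<bar>\<gamma> s * (K t - K s)\<bar> \<le> \<bar>\<gamma> u - \<gamma> v\<bar> * (1 * (t - s + (K t - K s)))"
  proof (cases "K s = K t")
    case True
    then show ?thesis using st by (intro bexI[of _ s]) auto
  next
    case False
    then obtain u where u: "u \<in> {s..t}" "\<gamma> u = 0" using fl[OF st] by blast
    have "\<bar>\<gamma> s\<bar> * \<bar>K t - K s\<bar> \<le> \<bar>\<gamma> s\<bar> * (1 * (t - s + (K t - K s)))"
      using m st by (intro mult_left_mono) auto
    then show ?thesis using u st by (intro bexI[of _ s] bexI[of _ u]) (auto simp: abs_mult)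
  qed
qed auto

lemma incr_congK:
  assumes D: "incr a b K f \<alpha> \<beta>" and K: "\<And>s t. a \<le> s \<Longrightarrow> s \<le> t \<Longrightarrow> t \<le> b \<Longrightarrow> K t = K s"
  shows "incr a b K f \<alpha> \<gamma>"
  unfolding incr_def
proof (rule negligible_cong[OF D[unfolded incr_def]])
  fix s t assume "a \<le> s" "s \<le> t" "t \<le> b"
  from K[OF this] have "K t - K s = 0" by simp
  then show "f t - f s - \<alpha> s * (t - s) - \<beta> s * (K t - K s) = f t - f s - \<alpha> s * (t - s) - \<gamma> s * (K t - K s)"
    by simp
qed

lemma incr_exp:
  assumes "incr a b K f \<alpha> \<beta>" "mono_on {a..b} K" "continuous_on {a..b} K"
    "continuous_on {a..b} \<alpha>" "continuous_on {a..b} \<beta>"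
  shows "incr a b K (\<lambda>t. exp (f t)) (\<lambda>t. exp (f t) * \<alpha> t) (\<lambda>t. exp (f t) * \<beta> t)"
  by (rule incr_chain[OF assms, where F' = exp])
    (use incr_continuous[OF assms] in \<open>auto intro!: DERIV_exp continuous_intros\<close>)

lemma incr_ln:
  assumes "incr a b K f \<alpha> \<beta>" "mono_on {a..b} K" "continuous_on {a..b} K"
    "continuous_on {a..b} \<alpha>" "continuous_on {a..b} \<beta>" and pos: "\<And>t. t \<in> {a..b} \<Longrightarrow> f t > 0"
  shows "incr a b K (\<lambda>t. ln (f t)) (\<lambda>t. \<alpha> t / f t) (\<lambda>t. \<beta> t / f t)"
proof -
  have "incr a b K (\<lambda>t. ln (f t)) (\<lambda>t. 1 / f t * \<alpha> t) (\<lambda>t. 1 / f t * \<beta> t)"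
    by (rule incr_chain[OF assms(1-5), where F' = "\<lambda>x. 1 / x"])
      (use pos incr_continuous[OF assms(1-5)] in \<open>auto intro!: continuous_intros DERIV_ln_divide simp: less_imp_neq[symmetric] dest!: pos\<close>)
  then show ?thesis by simp
qed

text \<open>
  The component \<open>L\<close> is $\int dK/R$; in terms of the previous coordinates
  $p = R e^{\varphi-\lambda}$ and $q = -R e^{\lambda-\varphi}$.
\<close>

definition polar_system :: "real \<Rightarrow> real \<Rightarrow> (real \<Rightarrow> real) \<Rightarrow> (real \<Rightarrow> real) \<Rightarrow> (real \<Rightarrow> real) \<Rightarrow> (real \<Rightarrow> real) \<Rightarrow> bool" where
  "polar_system a b lam R \<phi> L \<longleftrightarrow>
     continuous_on {a..b} \<phi> \<and> continuous_on {a..b} L \<and> mono_on {a..b} L \<and>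
     (\<forall>s t. a \<le> s \<and> s \<le> t \<and> t \<le> b \<and> (\<forall>u\<in>{s..t}. \<phi> u > 0) \<longrightarrow> L s = L t) \<and>
     (\<forall>t\<in>{a..b}. \<phi> t \<ge> 0 \<and> R t > 0 \<and> R t = R a + integral {a..t} (\<lambda>u. sinh (\<phi> u)) \<and>
       lam t - lam a = \<phi> t - \<phi> a + integral {a..t} (\<lambda>u. cosh (\<phi> u) / R u) - (L t - L a))"

text \<open>The last component below is $\int R\,dL$, integrated by parts.\<close>

lemma polar_imp_refl_sol:
  assumes lam: "continuous_on {a..b} lam" and sys: "polar_system a b lam R \<phi> L" and ab: "a \<le> b"
  shows "refl_sol a b lam (\<lambda>t. R t * exp (\<phi> t - lam t)) (\<lambda>t. - (R t * exp (lam t - \<phi> t)))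
     (\<lambda>t. R t * L t - integral {a..t} (\<lambda>u. L u * sinh (\<phi> u)))"
proof -
  define r0 c where "r0 = R a" and "c = lam a - \<phi> a + L a"
  have phi: "continuous_on {a..b} \<phi>" "\<And>t. t \<in> {a..b} \<Longrightarrow> \<phi> t \<ge> 0"
    and L: "continuous_on {a..b} L" "mono_on {a..b} L"
    using sys by (auto simp: polar_system_def)
  have flat: "L s = L t" if "a \<le> s" "s \<le> t" "t \<le> b" "\<And>u. u \<in> {s..t} \<Longrightarrow> \<phi> u > 0" for s t
    using sys that unfolding polar_system_def by blast
  have R: "R t = r0 + integral {a..t} (\<lambda>u. sinh (\<phi> u))" if "t \<in> {a..b}" for t
    using sys that unfolding polar_system_def r0_def by blast
  have "a \<in> {a..b}" using ab by simp
  then have r0: "r0 > 0" using sys unfolding polar_system_def r0_def by blast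
  have eq: "lam t = \<phi> t + integral {a..t} (\<lambda>u. cosh (\<phi> u) / R u) - L t + c" if "t \<in> {a..b}" for t
  proof -
    have "lam t - lam a = \<phi> t - \<phi> a + integral {a..t} (\<lambda>u. cosh (\<phi> u) / R u) - (L t - L a)"
      using sys that unfolding polar_system_def by blast
    then show ?thesis by (simp add: c_def)
  qed
  define K where "K = (\<lambda>t. R t * L t - integral {a..t} (\<lambda>u. L u * sinh (\<phi> u)))"
  have csh: "continuous_on {a..b} (\<lambda>u. sinh (\<phi> u))" and cch: "continuous_on {a..b} (\<lambda>u. cosh (\<phi> u))"
    using phi by (auto intro!: continuous_intros)
  have cLs: "continuous_on {a..b} (\<lambda>u. L u * sinh (\<phi> u))" by (intro continuous_intros L csh)
  have ci: "continuous_on {a..b} (\<lambda>t. integral {a..t} h)" if "continuous_on {a..b} h" for h :: "real \<Rightarrow> real"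
    using that by (intro indefinite_integral_continuous_1 integrable_continuous_interval)
  have "continuous_on {a..b} (\<lambda>t. r0 + integral {a..t} (\<lambda>u. sinh (\<phi> u)))" by (intro continuous_intros ci csh)
  then have cR: "continuous_on {a..b} R" by (rule continuous_on_eq) (simp add: R)
  have Rd: "R t - R s = integral {s..t} (\<lambda>u. sinh (\<phi> u))" if "a \<le> s" "s \<le> t" "t \<le> b" for s t
    using integral_diff_cont[OF csh that] R[of s] R[of t] that by simp
  have Rm: "R s \<le> R t" if "a \<le> s" "s \<le> t" "t \<le> b" for s t
  proof -
    have "0 \<le> integral {s..t} (\<lambda>u. sinh (\<phi> u))"
      using that phi(2) by (intro integral_nonneg integrable_continuous_interval continuous_on_subset[OF csh]) auto
    then show ?thesis using Rd[OF that] by simp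
  qed
  have Rr: "r0 \<le> R t" if "t \<in> {a..b}" for t using Rm[of a t] R[of a] that by auto
  have Rp: "R t > 0" if "t \<in> {a..b}" for t using Rr[OF that] r0 by simp
  have Rn: "R t \<noteq> 0" if "t \<in> {a..b}" for t using Rp[OF that] by simp
  have Lm: "L s \<le> L t" if "a \<le> s" "s \<le> t" "t \<le> b" for s t using L(2) that by (auto simp: mono_on_def)
  \<comment> \<open>As R and L are nondecreasing, the increment of K is enclosed between R s and R t
    times that of L. This enclosure stands in for dK = R dL in all that follows.\<close>
  have Kb: "R s * (L t - L s) \<le> K t - K s" "K t - K s \<le> R t * (L t - L s)" if st: "a \<le> s" "s \<le> t" "t \<le> b" for s t
  proof -
    have Kd: "K t - K s = R t * L t - R s * L s - integral {s..t} (\<lambda>u. L u * sinh (\<phi> u))"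
      using integral_diff_cont[OF cLs st] unfolding K_def by simp
    have cs: "continuous_on {s..t} (\<lambda>u. sinh (\<phi> u))" "continuous_on {s..t} (\<lambda>u. L u * sinh (\<phi> u))"
      using st by (auto intro: continuous_on_subset[OF csh] continuous_on_subset[OF cLs])
    have "integral {s..t} (\<lambda>u. L u * sinh (\<phi> u)) \<le> integral {s..t} (\<lambda>u. L t * sinh (\<phi> u))"
      by (rule integral_le) (use cs phi(2) Lm st in \<open>auto intro!: integrable_continuous_interval continuous_intros mult_right_mono\<close>)
    also have "\<dots> = L t * (R t - R s)" unfolding Rd[OF st] by simp
    finally show "R s * (L t - L s) \<le> K t - K s" unfolding Kd by (simp add: algebra_simps)
    have "L s * (R t - R s) = integral {s..t} (\<lambda>u. L s * sinh (\<phi> u))" unfolding Rd[OF st] by simp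
    also have "\<dots> \<le> integral {s..t} (\<lambda>u. L u * sinh (\<phi> u))"
      by (rule integral_le) (use cs phi(2) Lm st in \<open>auto intro!: integrable_continuous_interval continuous_intros mult_right_mono\<close>)
    finally show "K t - K s \<le> R t * (L t - L s)" unfolding Kd by (simp add: algebra_simps)
  qed
  have Km: "K s \<le> K t" if "a \<le> s" "s \<le> t" "t \<le> b" for s t
  proof -
    have "0 \<le> R s * (L t - L s)" using Rp[of s] Lm[OF that] that by simp
    then show ?thesis using Kb(1)[OF that] by linarith
  qed
  then have mK: "mono_on {a..b} K" by (auto simp: mono_on_def)
  have cK: "continuous_on {a..b} K" unfolding K_def by (intro continuous_intros cR L ci cLs)
  have Kflat: "K s = K t \<or> (\<exists>u\<in>{s..t}. \<phi> u = 0)" if st: "a \<le> s" "s \<le> t" "t \<le> b" for s t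
  proof (cases "\<exists>u\<in>{s..t}. \<phi> u = 0")
    case False
    have "\<phi> u > 0" if "u \<in> {s..t}" for u using False phi(2)[of u] that st by force
    then have "L s = L t" using flat[OF st] by blast
    then show ?thesis using Kb[OF st] by auto
  qed auto
  have DR: "incr a b K R (\<lambda>t. sinh (\<phi> t)) (\<lambda>t. 0)"
  proof -
    have "incr a b K (\<lambda>t. r0 + integral {a..t} (\<lambda>u. sinh (\<phi> u))) (\<lambda>t. sinh (\<phi> t)) (\<lambda>t. 0)"
      using incr_add[OF incr_const[OF mK, of r0] incr_integral[OF csh mK]] by simp
    then show ?thesis by (rule incr_cong) (use R in auto)
  qed
  \<comment> \<open>The enclosure gives an error of at most (R t - R s)(L t - L s) / R s, an
    oscillation of R times an increment of L, which is bounded by that of K divided by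
    \<open>r0\<close>.\<close>
  have DL: "incr a b K L (\<lambda>t. 0) (\<lambda>t. 1 / R t)"
    unfolding incr_def
  proof (rule negligible_modulus[OF mK cR, where C = "1 / r0 * (1 / r0)"])
    fix s t assume st: "a \<le> s" "s \<le> t" "t \<le> b"
    have Rs: "R s > 0" "r0 \<le> R s" using Rp[of s] Rr[of s] st by auto
    have A: "0 \<le> K t - K s - R s * (L t - L s)" "K t - K s - R s * (L t - L s) \<le> (R t - R s) * (L t - L s)"
      using Kb[OF st] by (auto simp: algebra_simps)
    have "L t - L s \<le> (K t - K s) / R s" using Kb(1)[OF st] Rs by (simp add: field_simps)
    also have "\<dots> \<le> (K t - K s) / r0" using Rs r0 Km[OF st] by (intro divide_left_mono) auto
    also have "\<dots> \<le> (t - s + (K t - K s)) / r0" using st r0 by (intro divide_right_mono) auto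
    finally have B: "L t - L s \<le> (t - s + (K t - K s)) / r0" .
    have "\<bar>L t - L s - 0 * (t - s) - 1 / R s * (K t - K s)\<bar> = (K t - K s - R s * (L t - L s)) / R s"
      using A(1) Rs by (simp add: abs_if field_simps)
    also have "\<dots> \<le> ((R t - R s) * ((t - s + (K t - K s)) / r0)) / r0"
    proof (rule frac_le)
      show "K t - K s - R s * (L t - L s) \<le> (R t - R s) * ((t - s + (K t - K s)) / r0)"
        using A(2) mult_left_mono[OF B, of "R t - R s"] Rm[OF st] by linarith
      then show "0 \<le> (R t - R s) * ((t - s + (K t - K s)) / r0)" using A(1) by linarith
    qed (use Rs r0 in auto)
    also have "\<dots> = \<bar>R t - R s\<bar> * (1 / r0 * (1 / r0) * (t - s + (K t - K s)))"
      using Rm[OF st] by (simp add: field_simps)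
    finally show "\<exists>u\<in>{s..t}. \<exists>v\<in>{s..t}. \<bar>L t - L s - 0 * (t - s) - 1 / R s * (K t - K s)\<bar> \<le>
       \<bar>R u - R v\<bar> * (1 / r0 * (1 / r0) * (t - s + (K t - K s)))"
      using st by (intro bexI[of _ t] bexI[of _ s]) auto
  qed (use r0 in auto)
  have cg: "continuous_on {a..b} (\<lambda>u. cosh (\<phi> u) / R u)" "continuous_on {a..b} (\<lambda>u. 1 / R u)"
    using Rp by (auto intro!: continuous_intros cch cR simp: less_imp_neq[symmetric] dest!: Rp)
  have Dw: "incr a b K (\<lambda>t. \<phi> t - lam t) (\<lambda>t. - (cosh (\<phi> t) / R t)) (\<lambda>t. 1 / R t)"
  proof -
    have "incr a b K (\<lambda>t. L t - integral {a..t} (\<lambda>u. cosh (\<phi> u) / R u) - c) (\<lambda>t. 0 - cosh (\<phi> t) / R t - 0) (\<lambda>t. 1 / R t - 0 - 0)"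
      by (intro incr_diff DL incr_integral cg mK incr_const)
    then show ?thesis by (rule incr_cong) (use eq in auto)
  qed
  have Dw': "incr a b K (\<lambda>t. lam t - \<phi> t) (\<lambda>t. cosh (\<phi> t) / R t) (\<lambda>t. - (1 / R t))"
    using incr_cmult[OF Dw, of "-1"] by simp
  have cs1: "continuous_on {a..b} (\<lambda>u. - (cosh (\<phi> u) / R u))" "continuous_on {a..b} (\<lambda>u. - (1 / R u))"
    by (intro continuous_intros cg)+
  have cw: "continuous_on {a..b} (\<lambda>t. exp (\<phi> t - lam t))" "continuous_on {a..b} (\<lambda>t. exp (lam t - \<phi> t))"
    by (intro continuous_intros lam phi)+
  have cosh_sinh: "cosh x - sinh x = exp (- x)" "cosh x + sinh x = exp x" for x :: real by (simp_all add: cosh_def sinh_def field_simps)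
  have Dp: "incr a b K (\<lambda>t. R t * exp (\<phi> t - lam t)) (\<lambda>t. - exp (- lam t)) (\<lambda>t. exp (- lam t))"
  proof -
    have 1: "incr a b K (\<lambda>t. R t * exp (\<phi> t - lam t)) 
       (\<lambda>t. R t * (exp (\<phi> t - lam t) * - (cosh (\<phi> t) / R t)) + exp (\<phi> t - lam t) * sinh (\<phi> t))
       (\<lambda>t. R t * (exp (\<phi> t - lam t) * (1 / R t)) + exp (\<phi> t - lam t) * 0)"
      by (rule incr_mult[OF DR incr_exp[OF Dw mK cK cs1(1) cg(2)] mK cK csh]) (intro continuous_intros cw cs1 cg)+
    have al: "R t * (exp (\<phi> t - lam t) * - (cosh (\<phi> t) / R t)) + exp (\<phi> t - lam t) * sinh (\<phi> t) = - exp (- lam t)"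
      if "t \<in> {a..b}" for t
    proof -
      have "R t * (exp (\<phi> t - lam t) * - (cosh (\<phi> t) / R t)) + exp (\<phi> t - lam t) * sinh (\<phi> t) =
        - (exp (\<phi> t - lam t) * (cosh (\<phi> t) - sinh (\<phi> t)))" using Rp[OF that] by (simp add: algebra_simps)
      also have "\<dots> = - exp (- lam t)" unfolding cosh_sinh by (simp flip: exp_add)
      finally show ?thesis .
    qed
    have 2: "incr a b K (\<lambda>t. R t * exp (\<phi> t - lam t)) (\<lambda>t. - exp (- lam t)) (\<lambda>t. exp (\<phi> t - lam t))"
      by (rule incr_cong[OF 1 _ al]) (simp_all add: Rn)
    \<comment> \<open>The coefficients exp(- lam) and exp(\<phi> - lam) agree where \<phi> = 0, and
      K is constant elsewhere; so one may be exchanged for the other.\<close>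
    have "negligible a b K (\<lambda>s t. (exp (- lam s) - exp (\<phi> s - lam s)) * (K t - K s))"
      by (rule negligible_flat[OF mK]) (use Kflat in \<open>force intro!: continuous_intros cw lam\<close>)+
    from incr_null[OF 2 this] show ?thesis by simp
  qed
  have Dq: "incr a b K (\<lambda>t. - (R t * exp (lam t - \<phi> t))) (\<lambda>t. - exp (lam t)) (\<lambda>t. exp (lam t))"
  proof -
    have 1: "incr a b K (\<lambda>t. R t * exp (lam t - \<phi> t)) 
       (\<lambda>t. R t * (exp (lam t - \<phi> t) * (cosh (\<phi> t) / R t)) + exp (lam t - \<phi> t) * sinh (\<phi> t))
       (\<lambda>t. R t * (exp (lam t - \<phi> t) * - (1 / R t)) + exp (lam t - \<phi> t) * 0)"
      by (rule incr_mult[OF DR incr_exp[OF Dw' mK cK cg(1) cs1(2)] mK cK csh]) (intro continuous_intros cw cs1 cg)+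
    have al: "R t * (exp (lam t - \<phi> t) * (cosh (\<phi> t) / R t)) + exp (lam t - \<phi> t) * sinh (\<phi> t) = exp (lam t)"
      if "t \<in> {a..b}" for t
    proof -
      have "R t * (exp (lam t - \<phi> t) * (cosh (\<phi> t) / R t)) + exp (lam t - \<phi> t) * sinh (\<phi> t) =
        exp (lam t - \<phi> t) * (cosh (\<phi> t) + sinh (\<phi> t))" using Rp[OF that] by (simp add: algebra_simps)
      also have "\<dots> = exp (lam t)" unfolding cosh_sinh by (simp flip: exp_add)
      finally show ?thesis .
    qed
    have 2: "incr a b K (\<lambda>t. R t * exp (lam t - \<phi> t)) (\<lambda>t. exp (lam t)) (\<lambda>t. - exp (lam t - \<phi> t))"
      by (rule incr_cong[OF 1 _ al]) (simp_all add: Rn)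
    have 3: "incr a b K (\<lambda>t. - (R t * exp (lam t - \<phi> t))) (\<lambda>t. - exp (lam t)) (\<lambda>t. exp (lam t - \<phi> t))"
      using incr_cmult[OF 2, of "-1"] by simp
    have "negligible a b K (\<lambda>s t. (exp (lam s) - exp (lam s - \<phi> s)) * (K t - K s))"
      by (rule negligible_flat[OF mK]) (use Kflat in \<open>force intro!: continuous_intros cw lam\<close>)+
    from incr_null[OF 3 this] show ?thesis by simp
  qed
  have x: "exp (lam t) * (R t * exp (\<phi> t - lam t)) + exp (- lam t) * - (R t * exp (lam t - \<phi> t)) = 2 * R t * sinh (\<phi> t)" for t
    by (simp add: sinh_def exp_diff exp_minus field_simps)
  have "K s = K t" if st: "a \<le> s" "s \<le> t" "t \<le> b" and pos: "\<forall>u\<in>{s..t}. 0 < 2 * R u * sinh (\<phi> u)" for s t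
    using Kflat[OF st] pos by fastforce
  moreover have "0 \<le> 2 * R t * sinh (\<phi> t)" if "t \<in> {a..b}" for t using Rp[OF that] phi(2)[OF that] by simp
  ultimately show ?thesis unfolding refl_sol_def K_def[symmetric] x using mK cK Dp Dq by blast
qed

lemma refl_sol_continuous:
  assumes lam: "continuous_on {a..b} lam" and sol: "refl_sol a b lam p q K"
  shows "continuous_on {a..b} p" "continuous_on {a..b} q"
    "continuous_on {a..b} (\<lambda>t. exp (lam t) * p t + exp (- lam t) * q t)"
proof -
  show p: "continuous_on {a..b} p" 
    by (rule incr_continuous[of _ _ K p "\<lambda>t. - exp (- lam t)" "\<lambda>t. exp (- lam t)"])
      (use sol in \<open>auto simp: refl_sol_def intro!: continuous_intros lam\<close>)
  show q: "continuous_on {a..b} q" 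
    by (rule incr_continuous[of _ _ K q "\<lambda>t. - exp (lam t)" "\<lambda>t. exp (lam t)"])
      (use sol in \<open>auto simp: refl_sol_def intro!: continuous_intros lam\<close>)
  show "continuous_on {a..b} (\<lambda>t. exp (lam t) * p t + exp (- lam t) * q t)"
    by (intro continuous_intros lam p q)
qed

lemma refl_sol_flat:
  assumes sol: "refl_sol a b lam p q K" and st: "a \<le> s" "s \<le> t" "t \<le> b"
  shows "K s = K t \<or> (\<exists>u\<in>{s..t}. exp (lam u) * p u + exp (- lam u) * q u = 0)"
proof (cases "\<exists>u\<in>{s..t}. exp (lam u) * p u + exp (- lam u) * q u = 0")
  case False
  have "exp (lam u) * p u + exp (- lam u) * q u > 0" if u: "u \<in> {s..t}" for u
  proof -
    have "exp (lam u) * p u + exp (- lam u) * q u \<ge> 0" using sol u st by (auto simp: refl_sol_def)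
    then show ?thesis using False u by (auto simp: less_le)
  qed
  then show ?thesis using sol st by (auto simp: refl_sol_def)
qed auto

text \<open>Half the sum and half the difference of ln p and ln (- q) are ln R and \<phi> - lam. The
  rate of ln R with respect to K is - sinh \<phi> / R, which vanishes where dK lives, so the radius
  feels no local time.\<close>

lemma refl_sol_imp_polar:
  assumes lam: "continuous_on {a..b} lam" and sol: "refl_sol a b lam p q K"
    and pq: "\<And>t. t \<in> {a..b} \<Longrightarrow> p t > 0" "\<And>t. t \<in> {a..b} \<Longrightarrow> q t < 0"
    and R_def: "R = (\<lambda>t. sqrt (- (p t * q t)))" and \<phi>_def: "\<phi> = (\<lambda>t. lam t + (ln (p t) - ln (- q t)) / 2)"
  obtains L where "polar_system a b lam R \<phi> L"
    "\<And>t. t \<in> {a..b} \<Longrightarrow> p t = R t * exp (\<phi> t - lam t)"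
    "\<And>t. t \<in> {a..b} \<Longrightarrow> q t = - (R t * exp (lam t - \<phi> t))"
proof -
  have mK: "mono_on {a..b} K" and cK: "continuous_on {a..b} K"
    and Dp: "incr a b K p (\<lambda>t. - exp (- lam t)) (\<lambda>t. exp (- lam t))"
    and Dq: "incr a b K q (\<lambda>t. - exp (lam t)) (\<lambda>t. exp (lam t))"
    and x0: "\<And>t. t \<in> {a..b} \<Longrightarrow> exp (lam t) * p t + exp (- lam t) * q t \<ge> 0"
    using sol by (auto simp: refl_sol_def)
  define w where "w = (\<lambda>t. (ln (p t) - ln (- q t)) / 2)"
  define r where "r = (\<lambda>t. (ln (p t) + ln (- q t)) / 2)"
  have phi_w: "\<phi> t = lam t + w t" for t by (simp add: \<phi>_def w_def)
  have Re: "R t = exp (r t)" if "t \<in> {a..b}" for t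
  proof -
    have "exp (r t) ^ 2 = exp (ln (p t) + ln (- q t))" by (simp add: r_def flip: exp_double)
    also have "\<dots> = - (p t * q t)" using pq[OF that] by (simp add: exp_add)
    finally show ?thesis unfolding R_def by (metis real_sqrt_unique exp_ge_zero)
  qed
  have Rp: "R t > 0" if "t \<in> {a..b}" for t using Re[OF that] by simp
  have pw: "p t = R t * exp (w t)" "q t = - (R t * exp (- w t))" if "t \<in> {a..b}" for t
  proof -
    have "R t * exp (w t) = exp (ln (p t))" unfolding Re[OF that] w_def r_def by (simp add: field_simps flip: exp_add)
    then show "p t = R t * exp (w t)" using pq[OF that] by simp
    have "R t * exp (- w t) = exp (ln (- q t))" unfolding Re[OF that] w_def r_def by (simp add: field_simps flip: exp_add)
    then show "q t = - (R t * exp (- w t))" using pq[OF that] by simp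
  qed
  have cc: "continuous_on {a..b} (\<lambda>t. exp (lam t))" "continuous_on {a..b} (\<lambda>t. exp (- lam t))"
    "continuous_on {a..b} (\<lambda>t. - exp (lam t))" "continuous_on {a..b} (\<lambda>t. - exp (- lam t))"
    by (intro continuous_intros lam)+
  note cp = refl_sol_continuous[OF lam sol]
  have cw: "continuous_on {a..b} w" unfolding w_def using pq
    by (intro continuous_intros cp) (auto simp: less_imp_neq less_imp_neq[symmetric] dest!: pq)
  have cr: "continuous_on {a..b} r" unfolding r_def using pq
    by (intro continuous_intros cp) (auto simp: less_imp_neq less_imp_neq[symmetric] dest!: pq)
  have cphi: "continuous_on {a..b} \<phi>" unfolding phi_w by (intro continuous_intros lam cw)
  have cR: "continuous_on {a..b} R" by (rule continuous_on_eq[OF continuous_on_exp[OF cr]]) (simp add: Re)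
  have cg: "continuous_on {a..b} (\<lambda>u. cosh (\<phi> u) / R u)" 
    using Rp by (auto intro!: continuous_intros cphi cR simp: less_imp_neq[symmetric] dest!: Rp)
  have x: "exp (lam t) * p t + exp (- lam t) * q t = 2 * R t * sinh (\<phi> t)" if "t \<in> {a..b}" for t
    unfolding pw[OF that] phi_w by (simp add: sinh_def exp_diff exp_minus exp_add field_simps)
  have phi0: "\<phi> t \<ge> 0" if "t \<in> {a..b}" for t
    using x0[OF that] Rp[OF that] unfolding x[OF that] by (simp add: zero_le_mult_iff)
  have Kflat: "K s = K t \<or> (\<exists>u\<in>{s..t}. \<phi> u = 0)" if st: "a \<le> s" "s \<le> t" "t \<le> b" for s t
  proof -
    have "\<phi> u = 0" if "u \<in> {s..t}" "exp (lam u) * p u + exp (- lam u) * q u = 0" for u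
      using x[of u] Rp[of u] that st by auto
    then show ?thesis using refl_sol_flat[OF sol st] by blast
  qed
  have Dlp: "incr a b K (\<lambda>t. ln (p t)) (\<lambda>t. - exp (- lam t) / p t) (\<lambda>t. exp (- lam t) / p t)"
    by (rule incr_ln[OF Dp mK cK cc(4,2) pq(1)])
  have Dq': "incr a b K (\<lambda>t. - q t) (\<lambda>t. exp (lam t)) (\<lambda>t. - exp (lam t))"
    using incr_cmult[OF Dq, of "-1"] by simp
  have Dlq: "incr a b K (\<lambda>t. ln (- q t)) (\<lambda>t. exp (lam t) / - q t) (\<lambda>t. - exp (lam t) / - q t)"
    by (rule incr_ln[OF Dq' mK cK cc(1,3)]) (use pq in auto)
  have ep: "exp (- lam t) / p t = exp (- \<phi> t) / R t" "exp (lam t) / - q t = exp (\<phi> t) / R t" if "t \<in> {a..b}" for t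
    using Rp[OF that] unfolding pw[OF that] phi_w by (simp_all add: exp_add exp_minus exp_diff divide_simps)
  have Dr: "incr a b K r (\<lambda>t. sinh (\<phi> t) / R t) (\<lambda>t. 0)"
  proof -
    have "incr a b K r (\<lambda>t. sinh (\<phi> t) / R t) (\<lambda>t. - sinh (\<phi> t) / R t)"
    proof (rule incr_cong[OF incr_cmult[OF incr_add[OF Dlp Dlq], of "1/2"]])
      fix t assume t: "t \<in> {a..b}"
      show "1 / 2 * (- exp (- lam t) / p t + exp (lam t) / - q t) = sinh (\<phi> t) / R t"
        using ep[OF t] by (simp add: sinh_def diff_divide_distrib)
      show "1 / 2 * (exp (- lam t) / p t + - exp (lam t) / - q t) = - sinh (\<phi> t) / R t"
        using ep[OF t] by (simp add: sinh_def diff_divide_distrib)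
    qed (simp add: r_def)
    moreover have "negligible a b K (\<lambda>s t. sinh (\<phi> s) / R s * (K t - K s))"
    proof (rule negligible_flat[OF mK])
      show "continuous_on {a..b} (\<lambda>s. sinh (\<phi> s) / R s)"
        using Rp by (auto intro!: continuous_intros cphi cR simp: less_imp_neq[symmetric] dest!: Rp)
    qed (use Kflat in force)
    ultimately show ?thesis by (rule incr_cong[OF incr_null]) auto
  qed
  have DR: "incr a b K R (\<lambda>t. sinh (\<phi> t)) (\<lambda>t. 0)"
  proof (rule incr_cong[OF incr_exp[OF Dr mK cK]])
    show "continuous_on {a..b} (\<lambda>s. sinh (\<phi> s) / R s)"
      using Rp by (auto intro!: continuous_intros cphi cR simp: less_imp_neq[symmetric] dest!: Rp)
    fix t assume t: "t \<in> {a..b}"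
    show "exp (r t) = R t" using Re[OF t] by simp
    show "exp (r t) * (sinh (\<phi> t) / R t) = sinh (\<phi> t)" using Re[OF t] by simp
  qed auto
  have csh: "continuous_on {a..b} (\<lambda>u. sinh (\<phi> u))" by (intro continuous_intros cphi)
  have Req: "R t = R a + integral {a..t} (\<lambda>u. sinh (\<phi> u))" if t: "t \<in> {a..b}" for t
  proof -
    have "R t - R a = integral {a..t} (\<lambda>u. sinh (\<phi> u)) - integral {a..a} (\<lambda>u. sinh (\<phi> u))"
      by (rule incr_unique[OF DR incr_integral[OF csh mK] mK]) (use t in auto)
    then show ?thesis by simp
  qed
  have Dw: "incr a b K w (\<lambda>t. - (cosh (\<phi> t) / R t)) (\<lambda>t. cosh (\<phi> t) / R t)"
  proof (rule incr_cong[OF incr_cmult[OF incr_diff[OF Dlp Dlq], of "1/2"]])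
    fix t assume t: "t \<in> {a..b}"
    show "1 / 2 * (- exp (- lam t) / p t - exp (lam t) / - q t) = - (cosh (\<phi> t) / R t)"
      using ep[OF t] by (simp add: cosh_def add_divide_distrib)
    show "1 / 2 * (exp (- lam t) / p t - - exp (lam t) / - q t) = cosh (\<phi> t) / R t"
      using ep[OF t] by (simp add: cosh_def add_divide_distrib)
  qed (simp add: w_def)
  \<comment> \<open>What is left of \<phi> - lam after removing its drift is declared to be L. The
    equation for lam then holds by definition, and monotonicity and flatness are what has to be
    shown.\<close>
  define L where "L = (\<lambda>t. w t + integral {a..t} (\<lambda>u. cosh (\<phi> u) / R u))"
  have DL: "incr a b K L (\<lambda>t. 0) (\<lambda>t. cosh (\<phi> t) / R t)"
    using incr_add[OF Dw incr_integral[OF cg mK]] unfolding L_def by simp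
  have mL: "mono_on {a..b} L" by (rule incr_mono[OF DL mK]) (use Rp in \<open>auto simp: less_imp_le\<close>)
  have cL: "continuous_on {a..b} L" unfolding L_def
    by (intro continuous_intros cw indefinite_integral_continuous_1 integrable_continuous_interval cg)
  have Lflat: "L s = L t" if st: "a \<le> s" "s \<le> t" "t \<le> b" and pos: "\<And>u. u \<in> {s..t} \<Longrightarrow> \<phi> u > 0" for s t
  proof -
    have KK: "K u = K v" if vu: "s \<le> v" "v \<le> u" "u \<le> t" for u v
    proof -
      have nz: "\<phi> w \<noteq> 0" if "w \<in> {v..u}" for w using pos[of w] that vu by auto
      have "K v = K u \<or> (\<exists>w\<in>{v..u}. \<phi> w = 0)" by (rule Kflat) (use vu st in linarith)+
      then have "K v = K u" using nz by blast
      then show ?thesis by (rule sym)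
    qed
    have "incr s t K L (\<lambda>t. 0) (\<lambda>t. 0)" by (rule incr_congK[OF incr_subset[OF DL st(1,3)] KK])
    then show ?thesis by (rule incr_0_const) (use st mK in \<open>auto intro: mono_on_subset\<close>)
  qed
  have "polar_system a b lam R \<phi> L" unfolding polar_system_def
  proof (intro conjI ballI allI impI cphi cL mL phi0 Rp Req)
    show "L s = L t" if "a \<le> s \<and> s \<le> t \<and> t \<le> b \<and> (\<forall>u\<in>{s..t}. 0 < \<phi> u)" for s t
      using Lflat[of s t] that by blast
  qed (auto simp: L_def phi_w)
  then show thesis by (rule that) (use pw phi_w in auto)
qed

section \<open>The Skorokhod map and Picard iteration\<close>

text \<open>The smallest nondecreasing function above g on [a, t]. The path
  \<open>runmax a g t - g t\<close> is the Skorokhod reflection at 0 of g a - g t.\<close>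

definition runmax :: "real \<Rightarrow> (real \<Rightarrow> real) \<Rightarrow> real \<Rightarrow> real" where
  "runmax a g t = Sup (g ` {a..t})"

lemma runmax_attained:
  assumes g: "continuous_on {a..b} (g :: real \<Rightarrow> real)" and t: "a \<le> t" "t \<le> b"
  obtains u where "u \<in> {a..t}" "runmax a g t = g u" "\<And>v. v \<in> {a..t} \<Longrightarrow> g v \<le> g u"
proof -
  have "continuous_on {a..t} g" using g by (rule continuous_on_subset) (use t in auto)
  then obtain u where u: "u \<in> {a..t}" "\<And>v. v \<in> {a..t} \<Longrightarrow> g v \<le> g u"
    using continuous_attains_sup[of "{a..t}" g] t by auto
  moreover have "runmax a g t = g u" unfolding runmax_def
    by (rule cSup_eq_maximum) (use u in auto)
  ultimately show thesis using that by blast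
qed

lemma runmax_ge: "continuous_on {a..b} (g :: real \<Rightarrow> real) \<Longrightarrow> a \<le> s \<Longrightarrow> s \<le> t \<Longrightarrow> t \<le> b \<Longrightarrow> g s \<le> runmax a g t"
  by (rule runmax_attained[of a b g t]) auto

lemma runmax_mono:
  assumes g: "continuous_on {a..b} g" and st: "a \<le> s" "s \<le> t" "t \<le> b"
  shows "runmax a g s \<le> runmax a g t"
proof -
  have "s \<le> b" using st by simp
  obtain u where "u \<in> {a..s}" "runmax a g s = g u" by (rule runmax_attained[OF g st(1) \<open>s \<le> b\<close>])
  then show ?thesis using runmax_ge[OF g, of u t] st by auto
qed

text \<open>A maximum that has increased after time s is attained at some u between s and t, and u
  is then itself a record time. At record times the reflected path is 0, which gives the flatness of
  the local time away from zeros.\<close>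

lemma runmax_incr:
  assumes g: "continuous_on {a..b} g" and st: "a \<le> s" "s \<le> t" "t \<le> b"
    and ne: "runmax a g s \<noteq> runmax a g t"
  obtains u where "u \<in> {s..t}" "runmax a g t = g u" "runmax a g u = g u"
proof -
  have "a \<le> t" using st by simp
  obtain u where u: "u \<in> {a..t}" "runmax a g t = g u" by (rule runmax_attained[OF g \<open>a \<le> t\<close> st(3)])
  have "s \<le> u"
  proof (rule ccontr)
    assume "\<not> s \<le> u"
    then have "g u \<le> runmax a g s" using runmax_ge[OF g, of u s] u st by auto
    then show False using ne u runmax_mono[OF g st] by auto
  qed
  moreover have "runmax a g u = g u"
    using runmax_mono[OF g, of u t] runmax_ge[OF g, of u u] u st by auto
  ultimately show thesis using that u by auto
qed

lemma runmax_continuous: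
  assumes g: "continuous_on {a..b} g"
  shows "continuous_on {a..b} (runmax a g)"
proof -
  have "uniformly_continuous_on {a..b} g" using g by (simp add: compact_uniformly_continuous)
  then have "uniformly_continuous_on {a..b} (runmax a g)"
    unfolding uniformly_continuous_on_def
  proof (intro allI impI)
    fix e :: real assume e: "e > 0" and "\<forall>e>0. \<exists>d>0. \<forall>x\<in>{a..b}. \<forall>x'\<in>{a..b}. dist x' x < d \<longrightarrow> dist (g x') (g x) < e"
    then obtain d where d: "d > 0" "\<And>x x'. x \<in> {a..b} \<Longrightarrow> x' \<in> {a..b} \<Longrightarrow> dist x' x < d \<Longrightarrow> dist (g x') (g x) < e" by metis
    have *: "\<bar>runmax a g t - runmax a g s\<bar> < e" if st: "a \<le> s" "s \<le> t" "t \<le> b" "t - s < d" for s t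
    proof (cases "runmax a g s = runmax a g t")
      case False
      obtain u where u: "u \<in> {s..t}" "runmax a g t = g u" by (rule runmax_incr[OF g st(1-3) False])
      have "g s \<le> runmax a g s" using runmax_ge[OF g, of s s] st by auto
      moreover have "dist (g u) (g s) < e" using u st by (intro d(2)) (auto simp: dist_real_def)
      ultimately show ?thesis using u runmax_mono[OF g st(1-3)] by (auto simp: dist_real_def)
    qed (use e in auto)
    show "\<exists>d>0. \<forall>x\<in>{a..b}. \<forall>x'\<in>{a..b}. dist x' x < d \<longrightarrow> dist (runmax a g x') (runmax a g x) < e"
    proof (intro exI[of _ d] conjI ballI impI d(1))
      fix x x' assume "x \<in> {a..b}" "x' \<in> {a..b}" "dist x' x < d"
      then show "dist (runmax a g x') (runmax a g x) < e"
        using *[of x x'] *[of x' x] by (cases "x \<le> x'") (auto simp: dist_real_def abs_minus_commute)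
    qed
  qed
  then show ?thesis by (rule uniformly_continuous_imp_continuous)
qed

lemma runmax_lipschitz:
  assumes g: "continuous_on {a..b} g" and g': "continuous_on {a..b} g'" and t: "a \<le> t" "t \<le> b"
    and D: "\<And>s. s \<in> {a..t} \<Longrightarrow> \<bar>g s - g' s\<bar> \<le> D"
  shows "\<bar>runmax a g t - runmax a g' t\<bar> \<le> D"
proof -
  obtain u where u: "u \<in> {a..t}" "runmax a g t = g u" by (rule runmax_attained[OF g t])
  obtain v where v: "v \<in> {a..t}" "runmax a g' t = g' v" by (rule runmax_attained[OF g' t])
  show ?thesis
    using D[OF u(1)] D[OF v(1)] runmax_ge[OF g, of v t] runmax_ge[OF g', of u t] u v t by (auto simp: abs_le_iff)
qed

text \<open>Between the last zero s of \<phi> and t the angle is positive, so L is constant on (s,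
  t], and by continuity on [s, t].\<close>

lemma last_zero:
  assumes phi: "continuous_on {a..b} \<phi>" "\<And>t. t \<in> {a..b} \<Longrightarrow> (\<phi> t :: real) \<ge> 0"
    and L: "continuous_on {a..b} (L :: real \<Rightarrow> real)"
    and flat: "\<And>s t. a \<le> s \<Longrightarrow> s \<le> t \<Longrightarrow> t \<le> b \<Longrightarrow> (\<And>u. u \<in> {s..t} \<Longrightarrow> \<phi> u > 0) \<Longrightarrow> L s = L t"
    and a0: "\<phi> a = 0" and t: "a \<le> t" "t \<le> b"
  obtains s where "a \<le> s" "s \<le> t" "\<phi> s = 0" "L s = L t"
proof -
  have "continuous_on {a..t} \<phi>" using phi(1) by (rule continuous_on_subset) (use t in auto)
  then obtain s0 where s0: "a \<le> s0" "s0 \<le> t" "\<phi> s0 = 0" and nz: "\<And>u. s0 < u \<Longrightarrow> u \<le> t \<Longrightarrow> \<phi> u \<noteq> 0"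
    by (rule last_root) (use a0 t in blast)+
  have pos: "\<phi> u > 0" if "s0 < u" "u \<le> t" for u using nz[OF that] phi(2)[of u] that s0 t by force
  have "L s0 = L t"
  proof (cases "s0 = t")
    case False
    then have st: "s0 < t" using s0 by simp
    have "continuous_on {s0..t} L" using L by (rule continuous_on_subset) (use s0 t in auto)
    then show ?thesis by (rule eq_at_left_endpoint[OF _ st]) (rule flat; use pos s0 t in auto)
  qed auto
  then show thesis using that s0 by blast
qed

text \<open>From \<phi> \<ge> 0 follows L \<ge> g, hence L is at least the running maximum. At the
  last zero s before t one has L t = L s = g s, which gives the other bound.\<close>

lemma skorokhod_unique:
  assumes g: "continuous_on {a..b} g" and phi: "continuous_on {a..b} \<phi>" "\<And>t. t \<in> {a..b} \<Longrightarrow> \<phi> t \<ge> 0"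
    and L: "continuous_on {a..b} L" "mono_on {a..b} L"
    and flat: "\<And>s t. a \<le> s \<Longrightarrow> s \<le> t \<Longrightarrow> t \<le> b \<Longrightarrow> (\<And>u. u \<in> {s..t} \<Longrightarrow> \<phi> u > 0) \<Longrightarrow> L s = L t"
    and eq: "\<And>t. t \<in> {a..b} \<Longrightarrow> \<phi> t = L t - g t" and a0: "\<phi> a = 0" and t: "a \<le> t" "t \<le> b"
  shows "L t = runmax a g t"
proof (rule antisym)
  have Lm: "L s \<le> L t" if "a \<le> s" "s \<le> t" "t \<le> b" for s t using L(2) that by (auto simp: mono_on_def)
  obtain v where v: "v \<in> {a..t}" "runmax a g t = g v" by (rule runmax_attained[OF g t])
  show "runmax a g t \<le> L t" using Lm[of v t] eq[of v] phi(2)[of v] v t by auto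
  obtain s0 where s0: "a \<le> s0" "s0 \<le> t" "\<phi> s0 = 0" "L s0 = L t"
  proof (rule last_zero[OF phi L(1) _ a0 t])
    show "L s = L t" if "a \<le> s" "s \<le> t" "t \<le> b" "\<And>u. u \<in> {s..t} \<Longrightarrow> 0 < \<phi> u" for s t
      by (rule flat[OF that])
  qed blast+
  then show "L t \<le> runmax a g t" using eq[of s0] s0 t runmax_ge[OF g s0(1,2) t(2)] by auto
qed

lemma sinh_cosh_lip:
  fixes x y M :: real
  assumes "0 \<le> x" "x \<le> M" "0 \<le> y" "y \<le> M"
  shows "\<bar>sinh x - sinh y\<bar> \<le> cosh M * \<bar>x - y\<bar>" "\<bar>cosh x - cosh y\<bar> \<le> cosh M * \<bar>x - y\<bar>"
proof -
  have *: "cosh z \<le> cosh M" "\<bar>sinh z\<bar> \<le> cosh M" if "0 \<le> z" "z \<le> M" for z :: real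
  proof -
    show 1: "cosh z \<le> cosh M" using that by (simp add: cosh_real_nonneg_le_iff)
    have "sinh z \<le> cosh z" by (simp add: sinh_def cosh_def)
    then show "\<bar>sinh z\<bar> \<le> cosh M" using 1 that by simp
  qed
  have d: "(sinh has_field_derivative cosh z) (at z within S)" "(cosh has_field_derivative sinh z) (at z within S)"
    for z :: real and S by (auto intro!: derivative_eq_intros)
  show "\<bar>sinh x - sinh y\<bar> \<le> cosh M * \<bar>x - y\<bar>"
    using field_differentiable_bound[of "{0..M}" sinh cosh "cosh M" x y] assms * d by auto
  show "\<bar>cosh x - cosh y\<bar> \<le> cosh M * \<bar>x - y\<bar>"
    using field_differentiable_bound[of "{0..M}" cosh sinh "cosh M" x y] assms * d by auto
qed

text \<open>
  The unknown is the angle alone: \<open>Rf\<close> recovers the radius from it and \<open>pf\<close> is minus the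
  input of the Skorokhod map. Truncation to $[0,M]$ makes the drift globally Lipschitz; it is
  invisible on the solutions, whose angle is at most $2\sup|\lambda|$.
\<close>

locale picard =
  fixes a b r0 M :: real and lam :: "real \<Rightarrow> real"
  assumes ab: "a \<le> b" and r0: "r0 > 0" and M0: "M \<ge> 0" and lam: "continuous_on {a..b} lam"
begin

definition cl :: "real \<Rightarrow> real" where "cl x = max 0 (min M x)"
definition Rf :: "(real \<Rightarrow> real) \<Rightarrow> real \<Rightarrow> real" where
  "Rf \<phi> t = r0 + integral {a..t} (\<lambda>u. sinh (cl (\<phi> u)))"
definition gf :: "(real \<Rightarrow> real) \<Rightarrow> real \<Rightarrow> real" where "gf \<phi> u = cosh (cl (\<phi> u)) / Rf \<phi> u"
definition pf :: "(real \<Rightarrow> real) \<Rightarrow> real \<Rightarrow> real" where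
  "pf \<phi> t = lam a - lam t + integral {a..t} (gf \<phi>)"
definition F :: "(real \<Rightarrow> real) \<Rightarrow> real \<Rightarrow> real" where "F \<phi> t = runmax a (pf \<phi>) t - pf \<phi> t"

lemma cl_bounds: "0 \<le> cl x" "cl x \<le> M" using M0 by (auto simp: cl_def)

lemma cl_lip: "\<bar>cl x - cl y\<bar> \<le> \<bar>x - y\<bar>" by (auto simp: cl_def max_def min_def)

lemma cl_id: "0 \<le> x \<Longrightarrow> x \<le> M \<Longrightarrow> cl x = x" by (simp add: cl_def)

lemma cont_cl: "continuous_on {a..b} \<phi> \<Longrightarrow> continuous_on {a..b} (\<lambda>u. cl (\<phi> u))"
  unfolding cl_def by (intro continuous_intros)

lemma cont_Rf: "continuous_on {a..b} \<phi> \<Longrightarrow> continuous_on {a..b} (Rf \<phi>)"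
  unfolding Rf_def 
  by (intro continuous_intros indefinite_integral_continuous_1 integrable_continuous_interval cont_cl)

lemma Rf_ge: assumes "continuous_on {a..b} \<phi>" "t \<in> {a..b}" shows "r0 \<le> Rf \<phi> t"
proof -
  have "continuous_on {a..b} (\<lambda>u. sinh (cl (\<phi> u)))" by (intro continuous_intros cont_cl assms)
  then have "0 \<le> integral {a..t} (\<lambda>u. sinh (cl (\<phi> u)))"
    using assms(2) cl_bounds by (intro integral_nonneg integrable_continuous_interval) (auto intro: continuous_on_subset)
  then show ?thesis by (simp add: Rf_def)
qed

lemma cont_gf: "continuous_on {a..b} \<phi> \<Longrightarrow> continuous_on {a..b} (gf \<phi>)"
  unfolding gf_def using Rf_ge r0 by (intro continuous_intros cont_Rf cont_cl) force+

lemma gf_nonneg: "continuous_on {a..b} \<phi> \<Longrightarrow> t \<in> {a..b} \<Longrightarrow> 0 \<le> gf \<phi> t"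
  using Rf_ge[of \<phi> t] r0 by (auto simp: gf_def)

lemma cont_pf: "continuous_on {a..b} \<phi> \<Longrightarrow> continuous_on {a..b} (pf \<phi>)"
  unfolding pf_def by (intro continuous_intros lam indefinite_integral_continuous_1 integrable_continuous_interval cont_gf)

lemma cont_F: "continuous_on {a..b} \<phi> \<Longrightarrow> continuous_on {a..b} (F \<phi>)"
  unfolding F_def by (intro continuous_intros runmax_continuous cont_pf)

text \<open>A Lipschitz constant of \<open>gf\<close>: the first term comes from the numerator, the
  second from the denominator, as \<open>Rf\<close> has Lipschitz constant cosh M * (b - a) and is
  at least \<open>r0\<close>.\<close>

definition C :: real where "C = cosh M / r0 + cosh M * cosh M * (b - a) / (r0 * r0) + 1"

lemma C_pos: "C > 0" using r0 ab by (auto simp: C_def intro!: add_nonneg_pos add_nonneg_nonneg divide_nonneg_nonneg mult_nonneg_nonneg)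

text \<open>The distance is measured by a nondecreasing majorant h instead of a supremum. The radius
  at u depends only on the angle up to u, where h is at most h u; this causality allows exponential
  weights later.\<close>

lemma gf_lip:
  assumes c: "continuous_on {a..b} \<phi>" "continuous_on {a..b} \<phi>'" and h: "mono_on {a..b} h" "continuous_on {a..b} h"
    and d: "\<And>u. u \<in> {a..b} \<Longrightarrow> \<bar>\<phi> u - \<phi>' u\<bar> \<le> h u" and u: "u \<in> {a..b}"
  shows "\<bar>gf \<phi> u - gf \<phi>' u\<bar> \<le> C * h u"
proof -
  have h0: "h v \<ge> 0" if "v \<in> {a..b}" for v using d[OF that] by linarith
  have dc: "\<bar>cl (\<phi> v) - cl (\<phi>' v)\<bar> \<le> h v" if "v \<in> {a..b}" for v using d[OF that] cl_lip order_trans by blast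
  define R where "R = Rf \<phi> u" define R' where "R' = Rf \<phi>' u"
  define k where "k = cosh (cl (\<phi> u))" define k' where "k' = cosh (cl (\<phi>' u))"
  have RR: "r0 \<le> R" "r0 \<le> R'" using Rf_ge[OF c(1) u] Rf_ge[OF c(2) u] by (auto simp: R_def R'_def)
  have k: "\<bar>k - k'\<bar> \<le> cosh M * h u"
    unfolding k_def k'_def using sinh_cosh_lip(2)[OF cl_bounds cl_bounds, of "\<phi> u" "\<phi>' u"] dc[OF u]
    by (meson cosh_real_nonneg mult_left_mono order_trans)
  have k'b: "0 \<le> k'" "k' \<le> cosh M" using cl_bounds[of "\<phi>' u"] M0 by (simp_all add: k'_def cosh_real_nonneg_le_iff)
  have R: "\<bar>R - R'\<bar> \<le> cosh M * (b - a) * h u"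
  proof -
    have cs: "continuous_on {a..u} (\<lambda>u. sinh (cl (\<phi> u)))" "continuous_on {a..u} (\<lambda>u. sinh (cl (\<phi>' u)))"
      using u by (auto intro!: continuous_intros continuous_on_subset[OF cont_cl] c)
    have "R - R' = integral {a..u} (\<lambda>v. sinh (cl (\<phi> v)) - sinh (cl (\<phi>' v)))"
      unfolding R_def R'_def Rf_def using cs by (simp add: Henstock_Kurzweil_Integration.integral_diff integrable_continuous_interval)
    also have "\<bar>\<dots>\<bar> \<le> cosh M * h u * (u - a)"
    proof -
      have "norm (integral {a..u} (\<lambda>v. sinh (cl (\<phi> v)) - sinh (cl (\<phi>' v)))) \<le> cosh M * h u * (u - a)"
      proof (rule integral_bound)
        fix v assume v: "v \<in> {a..u}"
        have "\<bar>sinh (cl (\<phi> v)) - sinh (cl (\<phi>' v))\<bar> \<le> cosh M * \<bar>cl (\<phi> v) - cl (\<phi>' v)\<bar>"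
          by (intro sinh_cosh_lip cl_bounds)
        also have "\<dots> \<le> cosh M * h u"
          using dc[of v] v u mono_onD[OF h(1), of v u] by (intro mult_left_mono) auto
        finally show "norm (sinh (cl (\<phi> v)) - sinh (cl (\<phi>' v))) \<le> cosh M * h u" by simp
      qed (use u cs in \<open>auto intro!: continuous_intros\<close>)
      then show ?thesis by simp
    qed
    also have "\<dots> \<le> cosh M * h u * (b - a)" using u h0[OF u] by (intro mult_left_mono) auto
    finally show ?thesis by (simp add: mult_ac)
  qed
  have "gf \<phi> u - gf \<phi>' u = (k - k') / R + k' * (R' - R) / (R * R')"
    unfolding gf_def R_def[symmetric] R'_def[symmetric] k_def[symmetric] k'_def[symmetric] using RR r0
    by (simp add: field_simps)
  also have "\<bar>\<dots>\<bar> \<le> \<bar>k - k'\<bar> / R + k' * \<bar>R - R'\<bar> / (R * R')"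
    using RR r0 k'b by (auto intro!: order_trans[OF abs_triangle_ineq] simp: abs_mult abs_minus_commute)
  also have "\<dots> \<le> cosh M * h u / r0 + cosh M * (cosh M * (b - a) * h u) / (r0 * r0)"
    using RR r0 k k'b R h0[OF u] ab by (intro add_mono frac_le mult_mono) auto
  also have "\<dots> \<le> C * h u" using h0[OF u] by (simp add: C_def algebra_simps add_divide_distrib)
  finally show ?thesis .
qed

lemma F_lip:
  assumes c: "continuous_on {a..b} \<phi>" "continuous_on {a..b} \<phi>'" and h: "mono_on {a..b} h" "continuous_on {a..b} h"
    and d: "\<And>u. u \<in> {a..b} \<Longrightarrow> \<bar>\<phi> u - \<phi>' u\<bar> \<le> h u" and t: "t \<in> {a..b}"
  shows "\<bar>F \<phi> t - F \<phi>' t\<bar> \<le> 2 * C * integral {a..t} h"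
proof -
  have ih: "h integrable_on {a..s}" if "s \<in> {a..b}" for s
    using that h by (intro integrable_continuous_interval) (auto intro: continuous_on_subset)
  have ig: "gf \<psi> integrable_on {a..s}" if "continuous_on {a..b} \<psi>" "s \<in> {a..b}" for s \<psi>
    using that by (intro integrable_continuous_interval continuous_on_subset[OF cont_gf]) auto
  have p: "\<bar>pf \<phi> s - pf \<phi>' s\<bar> \<le> C * integral {a..t} h" if s: "s \<in> {a..t}" for s
  proof -
    have sb: "s \<in> {a..b}" using s t by auto
    have "pf \<phi> s - pf \<phi>' s = integral {a..s} (\<lambda>u. gf \<phi> u - gf \<phi>' u)"
      unfolding pf_def using ig[OF c(1) sb] ig[OF c(2) sb] by (simp add: Henstock_Kurzweil_Integration.integral_diff)
    also have "\<bar>\<dots>\<bar> \<le> integral {a..s} (\<lambda>u. C * h u)"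
    proof -
      have "norm (integral {a..s} (\<lambda>u. gf \<phi> u - gf \<phi>' u)) \<le> integral {a..s} (\<lambda>u. C * h u)"
      proof (rule integral_norm_bound_integral)
        show "(\<lambda>u. gf \<phi> u - gf \<phi>' u) integrable_on {a..s}" by (intro integrable_diff ig c sb)
        show "(\<lambda>u. C * h u) integrable_on {a..s}" using integrable_cmul[OF ih[OF sb], of C] by simp
      qed (use gf_lip[OF c h d] sb in auto)
      then show ?thesis by simp
    qed
    also have "\<dots> = C * integral {a..s} h" by simp
    also have "\<dots> \<le> C * integral {a..t} h"
    proof -
      have "0 \<le> h u" if "u \<in> {a..t}" for u using d[of u] t that by auto
      then show ?thesis using s t C_pos by (intro mult_left_mono integral_subset_le ih) auto
    qed
    finally show ?thesis .
  qed
  have "\<bar>runmax a (pf \<phi>) t - runmax a (pf \<phi>') t\<bar> \<le> C * integral {a..t} h"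
    by (rule runmax_lipschitz[OF cont_pf[OF c(1)] cont_pf[OF c(2)]]) (use p t in auto)
  then show ?thesis using p[of t] t unfolding F_def by (auto simp: abs_le_iff)
qed

text \<open>By \<open>F_lip\<close> the map F has Lipschitz constant 2 C in an integrated sense, C
  each for the running maximum and for its argument. Integrating exp(\<kappa> t) gains 1 / \<kappa>,
  so \<kappa> = 4 C yields the contraction factor 1/2.\<close>

definition \<kappa> :: real where "\<kappa> = 4 * C"

lemma F_contract:
  assumes c: "continuous_on {a..b} \<phi>" "continuous_on {a..b} \<phi>'" and B: "B \<ge> 0"
    and d: "\<And>u. u \<in> {a..b} \<Longrightarrow> \<bar>\<phi> u - \<phi>' u\<bar> \<le> B * exp (\<kappa> * (u - a))" and t: "t \<in> {a..b}"
  shows "\<bar>F \<phi> t - F \<phi>' t\<bar> \<le> B / 2 * exp (\<kappa> * (t - a))"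
proof -
  have k: "\<kappa> > 0" using C_pos by (simp add: \<kappa>_def)
  have "\<bar>F \<phi> t - F \<phi>' t\<bar> \<le> 2 * C * integral {a..t} (\<lambda>u. B * exp (\<kappa> * (u - a)))"
  proof (rule F_lip[OF c _ _ d t])
    show "mono_on {a..b} (\<lambda>u. B * exp (\<kappa> * (u - a)))" using B k by (auto simp: mono_on_def intro!: mult_left_mono)
  qed (auto intro!: continuous_intros)
  also have "integral {a..t} (\<lambda>u. B * exp (\<kappa> * (u - a))) = B / \<kappa> * exp (\<kappa> * (t - a)) - B / \<kappa> * exp (\<kappa> * (a - a))"
    by (intro integral_unique fundamental_theorem_of_calculus)
      (use t k in \<open>auto intro!: derivative_eq_intros simp: has_real_derivative_iff_has_vector_derivative[symmetric]\<close>)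
  also have "\<dots> \<le> B / \<kappa> * exp (\<kappa> * (t - a))" using B k by simp
  also have "2 * C * (B / \<kappa> * exp (\<kappa> * (t - a))) = B / 2 * exp (\<kappa> * (t - a))" using C_pos by (simp add: \<kappa>_def)
  finally show ?thesis using C_pos by simp
qed

lemma fixpoint_unique:
  assumes c: "continuous_on {a..b} \<phi>" "continuous_on {a..b} \<phi>'"
    and fp: "\<And>t. t \<in> {a..b} \<Longrightarrow> F \<phi> t = \<phi> t" "\<And>t. t \<in> {a..b} \<Longrightarrow> F \<phi>' t = \<phi>' t" and t: "t \<in> {a..b}"
  shows "\<phi> t = \<phi>' t"
proof -
  have k: "\<kappa> > 0" using C_pos by (simp add: \<kappa>_def)
  obtain B where B: "B \<ge> 0" "\<And>u. u \<in> {a..b} \<Longrightarrow> \<bar>\<phi> u - \<phi>' u\<bar> \<le> B"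
    using continuous_abs_bound[of a b "\<lambda>u. \<phi> u - \<phi>' u"] c continuous_on_diff by metis
  have "\<forall>u\<in>{a..b}. \<bar>\<phi> u - \<phi>' u\<bar> \<le> B / 2 ^ n * exp (\<kappa> * (u - a))" for n
  proof (induction n)
    case 0
    have "B * 1 \<le> B * exp (\<kappa> * (u - a))" if "u \<in> {a..b}" for u using B k that by (intro mult_left_mono) auto
    then show ?case using B by force
  next
    case (Suc n)
    show ?case
    proof
      fix u assume u: "u \<in> {a..b}"
      have "\<bar>F \<phi> u - F \<phi>' u\<bar> \<le> B / 2 ^ n / 2 * exp (\<kappa> * (u - a))"
        by (rule F_contract[OF c _ _ u]) (use B Suc in auto)
      then show "\<bar>\<phi> u - \<phi>' u\<bar> \<le> B / 2 ^ Suc n * exp (\<kappa> * (u - a))" using fp u by (simp add: mult.commute)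
    qed
  qed
  then have le: "\<bar>\<phi> t - \<phi>' t\<bar> \<le> B / 2 ^ n * exp (\<kappa> * (t - a))" for n using t by blast
  have "(\<lambda>n. B * exp (\<kappa> * (t - a)) * (1 / 2) ^ n) \<longlonglongrightarrow> B * exp (\<kappa> * (t - a)) * 0"
    by (intro tendsto_intros LIMSEQ_power_zero) auto
  then have "(\<lambda>n. B / 2 ^ n * exp (\<kappa> * (t - a))) \<longlonglongrightarrow> 0" by (simp add: power_one_over field_simps)
  then have "\<bar>\<phi> t - \<phi>' t\<bar> \<le> 0" by (rule LIMSEQ_le_const) (use le in auto)
  then show ?thesis by simp
qed

text \<open>The iterates started from 0 converge uniformly, as their differences halve in the
  weighted distance; \<open>F_lip\<close> with a constant majorant allows passage to the limit
  inside F.\<close>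

lemma fixpoint_exists:
  obtains \<phi> where "continuous_on {a..b} \<phi>" "\<And>t. t \<in> {a..b} \<Longrightarrow> F \<phi> t = \<phi> t"
proof -
  have k: "\<kappa> > 0" using C_pos by (simp add: \<kappa>_def)
  define f where "f = (\<lambda>n. (F ^^ n) (\<lambda>t. 0))"
  have f0: "f 0 = (\<lambda>t. 0)" and fS: "f (Suc n) = F (f n)" for n by (auto simp: f_def)
  have cf: "continuous_on {a..b} (f n)" for n by (induction n) (auto simp: f0 fS intro: cont_F)
  obtain B where B: "B \<ge> 0" "\<And>u. u \<in> {a..b} \<Longrightarrow> \<bar>f (Suc 0) u\<bar> \<le> B" using continuous_abs_bound[OF cf] by blast
  have st: "\<forall>u\<in>{a..b}. \<bar>f (Suc n) u - f n u\<bar> \<le> B / 2 ^ n * exp (\<kappa> * (u - a))" for n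
  proof (induction n)
    case 0
    have "B * 1 \<le> B * exp (\<kappa> * (u - a))" if "u \<in> {a..b}" for u using B k that by (intro mult_left_mono) auto
    then show ?case using B by (force simp: f0)
  next
    case (Suc n)
    show ?case
    proof
      fix u assume u: "u \<in> {a..b}"
      have "\<bar>F (f (Suc n)) u - F (f n) u\<bar> \<le> B / 2 ^ n / 2 * exp (\<kappa> * (u - a))"
        by (rule F_contract[OF cf cf _ _ u]) (use B Suc in auto)
      then show "\<bar>f (Suc (Suc n)) u - f (Suc n) u\<bar> \<le> B / 2 ^ Suc n * exp (\<kappa> * (u - a))" by (simp add: mult.commute fS)
    qed
  qed
  define E where "E = B * exp (\<kappa> * (b - a))"
  have "uniform_limit {a..b} (\<lambda>n x. \<Sum>i<n. f (Suc i) x - f i x) (\<lambda>x. \<Sum>i. f (Suc i) x - f i x) sequentially"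
  proof (rule Weierstrass_m_test)
    fix n x assume x: "x \<in> {a..b}"
    have "B / 2 ^ n * exp (\<kappa> * (x - a)) \<le> B / 2 ^ n * exp (\<kappa> * (b - a))" using B k x by (intro mult_left_mono) auto
    then show "norm (f (Suc n) x - f n x) \<le> E * (1 / 2) ^ n" using st[of n] x by (force simp: E_def power_one_over field_simps)
  next
    show "summable (\<lambda>n. E * (1 / 2) ^ n)" by (intro summable_mult summable_geometric) simp
  qed
  moreover define \<phi> where "\<phi> = (\<lambda>x. \<Sum>i. f (Suc i) x - f i x)"
  ultimately have ul: "uniform_limit {a..b} f \<phi> sequentially"
  proof -
    have "(\<lambda>n x. \<Sum>i<n. f (Suc i) x - f i x) = f"
      by (intro ext) (subst sum_lessThan_telescope, simp add: f0)
    then show "uniform_limit {a..b} (\<lambda>n x. \<Sum>i<n. f (Suc i) x - f i x) (\<lambda>x. \<Sum>i. f (Suc i) x - f i x) sequentially \<Longrightarrow>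
      \<phi> = (\<lambda>x. \<Sum>i. f (Suc i) x - f i x) \<Longrightarrow> uniform_limit {a..b} f \<phi> sequentially" by simp
  qed
  have cphi: "continuous_on {a..b} \<phi>" by (rule uniform_limit_theorem[OF _ ul]) (auto simp: cf)
  show thesis
  proof (rule that[OF cphi])
    fix t assume t: "t \<in> {a..b}"
    have "\<bar>F \<phi> t - \<phi> t\<bar> \<le> 0 + e" if e: "e > 0" for e
    proof -
      define e' where "e' = e / (2 * C * (b - a) + 2)"
      have den: "2 * C * (b - a) \<ge> 0" using C_pos ab by simp
      have e': "e' > 0" unfolding e'_def using e den by (intro divide_pos_pos) linarith+
      have ev: "\<forall>\<^sub>F n in sequentially. \<forall>x\<in>{a..b}. dist (f n x) (\<phi> x) < e'" using uniform_limitD[OF ul e'] .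
      then obtain N where N: "\<And>n x. n \<ge> N \<Longrightarrow> x \<in> {a..b} \<Longrightarrow> \<bar>f n x - \<phi> x\<bar> < e'"
        unfolding eventually_sequentially dist_real_def by metis
      have "\<bar>F (f N) t - F \<phi> t\<bar> \<le> 2 * C * integral {a..t} (\<lambda>u. e')"
        by (rule F_lip[OF cf cphi _ _ _ t]) (use N in \<open>auto simp: less_imp_le mono_on_def\<close>)
      also have "\<dots> \<le> 2 * C * (b - a) * e'" using t C_pos e' by auto
      finally have 1: "\<bar>F (f N) t - F \<phi> t\<bar> \<le> 2 * C * (b - a) * e'" .
      have "\<bar>F (f N) t - \<phi> t\<bar> < e'" using N[of "Suc N" t] t by (simp add: fS)
      then have "\<bar>F \<phi> t - \<phi> t\<bar> \<le> (2 * C * (b - a) + 2) * e'" using 1 e' by (simp add: algebra_simps)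
      also have "\<dots> = e" using den by (simp add: e'_def add_nonneg_eq_0_iff)
      finally show ?thesis by simp
    qed
    then have "\<bar>F \<phi> t - \<phi> t\<bar> \<le> 0" by (rule field_le_epsilon)
    then show "F \<phi> t = \<phi> t" by simp
  qed
qed

end

lemma refl_sol_exists_pos:
  assumes lam: "continuous_on {a..b} lam" and y: "y > 0" and ab: "a \<le> b"
  obtains p q K where "refl_sol a b lam p q K" "p a = exp (- lam a) * y" "q a = - (exp (lam a) * y)"
proof -
  obtain B where B: "B \<ge> 0" "\<And>u. u \<in> {a..b} \<Longrightarrow> \<bar>lam u\<bar> \<le> B" using continuous_abs_bound[OF lam] by blast
  interpret picard a b y "2 * B" lam by unfold_locales (use assms B in auto)
  obtain \<phi> where phi: "continuous_on {a..b} \<phi>" "\<And>t. t \<in> {a..b} \<Longrightarrow> F \<phi> t = \<phi> t" using fixpoint_exists by blast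
  have cp: "continuous_on {a..b} (pf \<phi>)" by (rule cont_pf[OF phi(1)])
  have cg: "continuous_on {a..b} (gf \<phi>)" by (rule cont_gf[OF phi(1)])
  have phi0: "0 \<le> \<phi> t" if "t \<in> {a..b}" for t
    using phi(2)[OF that] runmax_ge[OF cp, of t t] that by (auto simp: F_def)
  \<comment> \<open>If s is the time up to t at which the running maximum is attained, then \<phi> t
    is lam t - lam s minus a nonnegative drift integral. So the truncation at 2 B is never
    active.\<close>
  have phiB: "\<phi> t \<le> 2 * B" if t: "t \<in> {a..b}" for t
  proof -
    have "a \<le> t" "t \<le> b" using t by auto
    then obtain s where s: "s \<in> {a..t}" "runmax a (pf \<phi>) t = pf \<phi> s" by (rule runmax_attained[OF cp])
    have "0 \<le> integral {s..t} (gf \<phi>)"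
      using s t gf_nonneg[OF phi(1)] by (intro integral_nonneg integrable_continuous_interval continuous_on_subset[OF cg]) auto
    then have "integral {a..s} (gf \<phi>) \<le> integral {a..t} (gf \<phi>)" using integral_diff_cont[OF cg, of s t] s t by auto
    then have "\<phi> t \<le> lam t - lam s" using phi(2)[OF t] s by (simp add: F_def pf_def)
    then show ?thesis using B(2)[of t] B(2)[of s] s t by auto
  qed
  have clphi: "cl (\<phi> t) = \<phi> t" if "t \<in> {a..b}" for t using cl_id phi0 phiB that by blast
  define L where "L = runmax a (pf \<phi>)"
  have Ra: "Rf \<phi> a = y" by (simp add: Rf_def)
  have phia: "\<phi> a = 0"
  proof -
    obtain s where s: "s \<in> {a..a}" "runmax a (pf \<phi>) a = pf \<phi> s" by (rule runmax_attained[OF cp order_refl ab])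
    then show ?thesis using phi(2)[of a] ab by (auto simp: F_def)
  qed
  have La: "L a = 0" using phi(2)[of a] ab by (simp add: F_def pf_def L_def phia)
  have "polar_system a b lam (Rf \<phi>) \<phi> L" unfolding polar_system_def
  proof (intro conjI ballI allI impI phi phi0)
    show "continuous_on {a..b} L" unfolding L_def by (rule runmax_continuous[OF cp])
    show "mono_on {a..b} L" unfolding L_def by (auto simp: mono_on_def intro: runmax_mono[OF cp])
    fix t assume t: "t \<in> {a..b}"
    show "Rf \<phi> t > 0" using Rf_ge[OF phi(1) t] y by simp
    have "integral {a..t} (\<lambda>u. sinh (cl (\<phi> u))) = integral {a..t} (\<lambda>u. sinh (\<phi> u))"
      by (rule integral_cong) (use clphi t in auto)
    then show "Rf \<phi> t = Rf \<phi> a + integral {a..t} (\<lambda>u. sinh (\<phi> u))" unfolding Ra by (simp add: Rf_def)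
    have "integral {a..t} (gf \<phi>) = integral {a..t} (\<lambda>u. cosh (\<phi> u) / Rf \<phi> u)"
      by (rule integral_cong) (use clphi t in \<open>auto simp: gf_def\<close>)
    then show "lam t - lam a = \<phi> t - \<phi> a + integral {a..t} (\<lambda>u. cosh (\<phi> u) / Rf \<phi> u) - (L t - L a)"
      using phi(2)[OF t] by (simp add: F_def pf_def L_def[symmetric] phia La)
  next
    fix s t assume st: "a \<le> s \<and> s \<le> t \<and> t \<le> b \<and> (\<forall>u\<in>{s..t}. 0 < \<phi> u)"
    show "L s = L t"
    proof (rule ccontr)
      assume "L s \<noteq> L t"
      then obtain u where u: "u \<in> {s..t}" "runmax a (pf \<phi>) u = pf \<phi> u"
        using runmax_incr[OF cp, of s t] st unfolding L_def by metis
      then have "\<phi> u = 0" using phi(2)[of u] st by (simp add: F_def)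
      then show False using st u(1) by force
    qed
  qed
  from polar_imp_refl_sol[OF lam this ab] show thesis by (rule that) (simp_all only: Ra phia, simp_all)
qed

text \<open>Both solutions are put in polar form, and the truncation level is chosen above both
  angles. By \<open>skorokhod_unique\<close> both angles are then fixed points of one and the same
  map F.\<close>

lemma refl_sol_unique_pos:
  assumes lam: "continuous_on {a..b} lam" and y: "y > 0" and ab: "a \<le> b"
    and sol: "refl_sol a b lam p q K" "refl_sol a b lam p' q' K'"
    and ini: "p a = exp (- lam a) * y" "q a = - (exp (lam a) * y)" "p' a = p a" "q' a = q a"
    and pos: "\<And>t. t \<in> {a..b} \<Longrightarrow> p t > 0" "\<And>t. t \<in> {a..b} \<Longrightarrow> q t < 0"
       "\<And>t. t \<in> {a..b} \<Longrightarrow> p' t > 0" "\<And>t. t \<in> {a..b} \<Longrightarrow> q' t < 0"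
    and t: "t \<in> {a..b}"
  shows "p' t = p t" "q' t = q t"
proof -
  define R \<phi> where "R = (\<lambda>t. sqrt (- (p t * q t)))" and "\<phi> = (\<lambda>t. lam t + (ln (p t) - ln (- q t)) / 2)"
  define R' \<phi>' where "R' = (\<lambda>t. sqrt (- (p' t * q' t)))" and "\<phi>' = (\<lambda>t. lam t + (ln (p' t) - ln (- q' t)) / 2)"
  have Ra: "R a = y" unfolding R_def ini using y by (simp add: exp_minus power2_eq_square[symmetric] field_simps)
  have phia: "\<phi> a = 0" unfolding \<phi>_def ini using y by (simp add: ln_mult)
  have Ra': "R' a = y" "\<phi>' a = 0" using Ra phia ini by (simp_all add: R_def R'_def \<phi>_def \<phi>'_def)
  obtain L where L: "polar_system a b lam R \<phi> L"
    "\<And>t. t \<in> {a..b} \<Longrightarrow> p t = R t * exp (\<phi> t - lam t)"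
    "\<And>t. t \<in> {a..b} \<Longrightarrow> q t = - (R t * exp (lam t - \<phi> t))"
    using refl_sol_imp_polar[OF lam sol(1) pos(1,2) R_def \<phi>_def] by metis
  obtain L' where L': "polar_system a b lam R' \<phi>' L'"
    "\<And>t. t \<in> {a..b} \<Longrightarrow> p' t = R' t * exp (\<phi>' t - lam t)"
    "\<And>t. t \<in> {a..b} \<Longrightarrow> q' t = - (R' t * exp (lam t - \<phi>' t))"
    using refl_sol_imp_polar[OF lam sol(2) pos(3,4) R'_def \<phi>'_def] by metis
  have cphi: "continuous_on {a..b} \<phi>" "continuous_on {a..b} \<phi>'" using L(1) L'(1) by (auto simp: polar_system_def)
  obtain B where B: "B \<ge> 0" "\<And>u. u \<in> {a..b} \<Longrightarrow> \<bar>\<phi> u\<bar> \<le> B" using continuous_abs_bound[OF cphi(1)] by blast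
  obtain B' where B': "B' \<ge> 0" "\<And>u. u \<in> {a..b} \<Longrightarrow> \<bar>\<phi>' u\<bar> \<le> B'" using continuous_abs_bound[OF cphi(2)] by blast
  interpret picard a b y "max B B'" lam by unfold_locales (use assms B in auto)
  have main: "Rf \<psi> t = r t \<and> F \<psi> t = \<psi> t"
    if sys: "polar_system a b lam r \<psi> l" and bd: "\<And>t. t \<in> {a..b} \<Longrightarrow> \<psi> t \<le> max B B'"
      and ini: "\<psi> a = 0" and ra: "r a = y" and t: "t \<in> {a..b}"
    for \<psi> r l t
  proof -
    have c: "continuous_on {a..b} \<psi>" "\<And>t. t \<in> {a..b} \<Longrightarrow> \<psi> t \<ge> 0"
      and l: "continuous_on {a..b} l" "mono_on {a..b} l"
      and r: "\<And>t. t \<in> {a..b} \<Longrightarrow> r t = r a + integral {a..t} (\<lambda>u. sinh (\<psi> u))"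
      and eq: "\<And>t. t \<in> {a..b} \<Longrightarrow> lam t - lam a = \<psi> t - \<psi> a + integral {a..t} (\<lambda>u. cosh (\<psi> u) / r u) - (l t - l a)"
      using sys unfolding polar_system_def by blast+
    have flat: "l s = l t" if "a \<le> s" "s \<le> t" "t \<le> b" "\<And>u. u \<in> {s..t} \<Longrightarrow> \<psi> u > 0" for s t
      using sys that unfolding polar_system_def by blast
    have clphi: "cl (\<psi> t) = \<psi> t" if "t \<in> {a..b}" for t using cl_id c bd that by blast
    have Rr: "Rf \<psi> t = r t" if t: "t \<in> {a..b}" for t
    proof -
      have "integral {a..t} (\<lambda>u. sinh (cl (\<psi> u))) = integral {a..t} (\<lambda>u. sinh (\<psi> u))"
        by (rule integral_cong) (use clphi t in auto)
      then show ?thesis unfolding Rf_def using r[OF t] ra by simp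
    qed
    have g: "integral {a..t} (gf \<psi>) = integral {a..t} (\<lambda>u. cosh (\<psi> u) / r u)" if t: "t \<in> {a..b}" for t
      by (rule integral_cong) (use clphi Rr t in \<open>auto simp: gf_def\<close>)
    have e: "\<psi> t = (l t - l a) - pf \<psi> t" if "t \<in> {a..b}" for t
      using eq[OF that] g[OF that] ini by (simp add: pf_def)
    have "l t - l a = runmax a (pf \<psi>) t"
    proof (rule skorokhod_unique[where L = "\<lambda>t. l t - l a", OF cont_pf[OF c(1)] c(1,2)])
      show "continuous_on {a..b} (\<lambda>t. l t - l a)" by (intro continuous_intros l)
      show "mono_on {a..b} (\<lambda>t. l t - l a)" using l(2) by (auto simp: mono_on_def)
      show "l s - l a = l t - l a" if "a \<le> s" "s \<le> t" "t \<le> b" "\<And>u. u \<in> {s..t} \<Longrightarrow> 0 < \<psi> u" for s t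
        using flat[OF that] by simp
      show "\<psi> t = l t - l a - pf \<psi> t" if "t \<in> {a..b}" for t by (rule e[OF that])
    qed (use ini t in auto)
    then have "F \<psi> t = \<psi> t" using e[OF t] by (simp add: F_def)
    then show ?thesis using Rr[OF t] by simp
  qed
  have bd: "\<phi> t \<le> max B B'" "\<phi>' t \<le> max B B'" if "t \<in> {a..b}" for t using B(2)[OF that] B'(2)[OF that] by auto
  have 1: "Rf \<phi> t = R t \<and> F \<phi> t = \<phi> t" if "t \<in> {a..b}" for t by (rule main[OF L(1) bd(1) phia Ra that])
  have 2: "Rf \<phi>' t = R' t \<and> F \<phi>' t = \<phi>' t" if "t \<in> {a..b}" for t by (rule main[OF L'(1) bd(2) Ra'(2,1) that])
  have eq: "\<phi> t = \<phi>' t" if "t \<in> {a..b}" for t by (rule fixpoint_unique[OF cphi _ _ that]) (use 1 2 in auto)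
  have "Rf \<phi> t = Rf \<phi>' t" unfolding Rf_def
    by (intro arg_cong2[where f = "(+)"] refl integral_cong) (use eq t in auto)
  then have "R t = R' t" using 1[OF t] 2[OF t] by simp
  then show "p' t = p t" "q' t = q t" using eq[OF t] L(2,3)[OF t] L'(2,3)[OF t] by auto
qed

section \<open>The origin under the Osgood condition\<close>

lemma refl_sol_subset: "refl_sol a b lam p q K \<Longrightarrow> a \<le> a' \<Longrightarrow> b' \<le> b \<Longrightarrow> refl_sol a' b' lam p q K"
  unfolding refl_sol_def
  by (intro conjI; (elim conjE)?)
    (auto intro: mono_on_subset continuous_on_subset incr_subset)

lemma refl_sol_energy:
  assumes lam: "continuous_on {a..b} lam" and sol: "refl_sol a b lam p q K" and st: "a \<le> s" "s \<le> t" "t \<le> b"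
  shows "p s * q s - p t * q t = integral {s..t} (\<lambda>u. exp (lam u) * p u + exp (- lam u) * q u)"
proof -
  \<comment> \<open>Here \<open>x\<close> is twice the first component of the solution, so it is the
    full rate of - p q.\<close>
  define x where "x = (\<lambda>u. exp (lam u) * p u + exp (- lam u) * q u)"
  have mK: "mono_on {a..b} K" and cK: "continuous_on {a..b} K"
    and Dp: "incr a b K p (\<lambda>t. - exp (- lam t)) (\<lambda>t. exp (- lam t))"
    and Dq: "incr a b K q (\<lambda>t. - exp (lam t)) (\<lambda>t. exp (lam t))"
    using sol by (auto simp: refl_sol_def)
  have cx: "continuous_on {a..b} x" unfolding x_def by (rule refl_sol_continuous[OF lam sol])
  have "incr a b K (\<lambda>t. p t * q t) (\<lambda>t. p t * - exp (lam t) + q t * - exp (- lam t)) (\<lambda>t. p t * exp (lam t) + q t * exp (- lam t))"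
    by (rule incr_mult[OF Dp Dq mK cK]) (intro continuous_intros lam)+
  then have 1: "incr a b K (\<lambda>t. p t * q t) (\<lambda>t. - x t) x"
    by (rule incr_cong) (auto simp: x_def algebra_simps)
  have "negligible a b K (\<lambda>s t. - x s * (K t - K s))"
  proof (rule negligible_flat[OF mK])
    show "continuous_on {a..b} (\<lambda>s. - x s)" using cx by (rule continuous_on_minus)
    show "K s = K t \<or> (\<exists>u\<in>{s..t}. - x u = 0)" if "a \<le> s" "s \<le> t" "t \<le> b" for s t
      using refl_sol_flat[OF sol that] unfolding x_def neg_equal_0_iff_equal .
  qed
  from incr_null[OF 1 this] have "incr a b K (\<lambda>t. p t * q t) (\<lambda>t. - x t) (\<lambda>t. 0)" by simp
  from incr_cmult[OF this, of "-1"] have "incr a b K (\<lambda>t. - (p t * q t)) x (\<lambda>t. 0)" by simp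
  from incr_unique[OF this incr_integral[OF cx mK] mK, of s t]
  have "p s * q s - p t * q t = integral {a..t} x - integral {a..s} x" using st by simp
  then show ?thesis using integral_diff_cont[OF cx st] unfolding x_def by simp
qed

lemma refl_sol_energy_mono:
  assumes lam: "continuous_on {a..b} lam" and sol: "refl_sol a b lam p q K" and st: "a \<le> s" "s \<le> t" "t \<le> b"
  shows "p t * q t \<le> p s * q s"
proof -
  have "0 \<le> integral {s..t} (\<lambda>u. exp (lam u) * p u + exp (- lam u) * q u)"
    using sol st refl_sol_continuous(3)[OF lam sol]
    by (intro integral_nonneg integrable_continuous_interval) (auto simp: refl_sol_def intro: continuous_on_subset)
  then show ?thesis using refl_sol_energy[OF assms] by linarith
qed

text \<open>The product p q is nonincreasing, so it stays negative, and p cannot change sign without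
  passing through 0.\<close>

lemma refl_sol_sign:
  assumes lam: "continuous_on {a..b} lam" and sol: "refl_sol a b lam p q K" and neg: "p a * q a < 0" and pa: "p c > 0"
    and c: "c \<in> {a..b}" and t: "t \<in> {a..b}"
  shows "p t > 0 \<and> q t < 0"
proof -
  have pq: "p u * q u < 0" if "u \<in> {a..b}" for u using refl_sol_energy_mono[OF lam sol, of a u] that neg by auto
  have "p t > 0"
  proof (rule ccontr)
    assume "\<not> p t > 0"
    then have pt: "p t \<le> 0" by simp
    have cp: "continuous_on {min c t..max c t} p" using refl_sol_continuous(1)[OF lam sol] by (rule continuous_on_subset) (use c t in auto)
    have "\<exists>u. min c t \<le> u \<and> u \<le> max c t \<and> p u = 0"
      using IVT'[of p t 0 c] IVT2'[of p t 0 c] cp pt pa by (cases "c \<le> t") (auto simp: min_def max_def)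
    then obtain u where u: "min c t \<le> u" "u \<le> max c t" "p u = 0" by blast
    then have "u \<in> {a..b}" using c t by (auto simp: min_def max_def split: if_splits)
    then show False using pq[of u] u by simp
  qed
  then show ?thesis using pq[OF t] by (simp add: mult_less_0_iff)
qed

text \<open>If the energy has not grown since the origin, the nonnegative x has integral 0 and
  vanishes up to t. Then x t = 0 and p t * q t = 0 together leave only the origin.\<close>

lemma refl_sol_zero_energy:
  assumes lam: "continuous_on {a..b} lam" and sol: "refl_sol a b lam p q K" and z: "p a = 0" "q a = 0"
    and t: "a \<le> t" "t \<le> b" and pq: "p t * q t = 0"
  shows "p t = 0 \<and> q t = 0"
proof (cases "a = t")
  case False
  then have at: "a < t" using t by simp
  define x where "x = (\<lambda>u. exp (lam u) * p u + exp (- lam u) * q u)"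
  have cx: "continuous_on {a..t} x" unfolding x_def using refl_sol_continuous(3)[OF lam sol] by (rule continuous_on_subset) (use t in auto)
  have x0: "0 \<le> x u" if "u \<in> {a..t}" for u using sol that t by (auto simp: refl_sol_def x_def)
  have "integral {a..t} x = 0" using refl_sol_energy[OF lam sol _ t] t z pq by (simp add: x_def)
  then have "(x has_integral 0) {a..t}" using integrable_integral[OF integrable_continuous_interval[OF cx]] by simp
  then have "x t = 0" using has_integral_0_cbox_imp_0[of a t x t] cx x0 at by auto
  moreover have "p t = 0 \<or> q t = 0" using pq by simp
  ultimately show ?thesis by (auto simp: x_def)
qed (use z in auto)

text \<open>The supremum runs over uncountably many r, but each competitor is continuous on the
  positive half-line, so the superlevel sets are open there.\<close>

lemma theta_measurable:
  "(\<lambda>x. if 0 < x then theta \<omega> x else 0) \<in> borel_measurable borel"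
proof (rule borel_measurableI_greater)
  fix y :: ereal
  define U where "U = (\<Union>r\<in>{0..}. {x \<in> {0<..}. y < ereal (\<omega> r - r / x)})"
  have "open {x \<in> {0<..}. y < ereal (\<omega> r - r / x)}" for r
  proof -
    have "continuous_on {0<..} (\<lambda>x. ereal (\<omega> r - r / x))" by (auto intro!: continuous_intros)
    from continuous_open_preimage[OF this, of "{y<..}"] show ?thesis
      by (simp add: vimage_def Int_def)
  qed
  then have "open U" unfolding U_def by blast
  moreover have "{x \<in> space borel. y < (if 0 < x then theta \<omega> x else 0)} = U \<union> (if y < 0 then {..0} else {})"
    by (auto simp: U_def theta_def less_SUP_iff split: if_splits)
  ultimately show "{x \<in> space borel. y < (if 0 < x then theta \<omega> x else 0)} \<in> sets borel" by auto
qed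

text \<open>
  Substitution $x = R(t)$. The hypothesis on \<open>z\<close> also covers the times where $\theta_\omega(R_t) = 0$,
  since then $R'_t = 0$ and $\infty \cdot 0 = 0$.
\<close>

lemma recip_integral_finite:
  assumes \<sigma>: "\<sigma> < T" and C: "C \<ge> 0"
    and R: "continuous_on {\<sigma>..T} R" "R \<sigma> = 0" "\<And>t. \<sigma> < t \<Longrightarrow> t \<le> T \<Longrightarrow> R t > 0"
    and dR: "\<And>t. \<sigma> < t \<Longrightarrow> t < T \<Longrightarrow> (R has_real_derivative R' t) (at t)"
    and cR': "\<And>c d. \<sigma> < c \<Longrightarrow> d < T \<Longrightarrow> continuous_on {c..d} R'"
    and R'0: "\<And>t. \<sigma> < t \<Longrightarrow> t < T \<Longrightarrow> R' t \<ge> 0"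
    and le: "\<And>t. \<sigma> < t \<Longrightarrow> t < T \<Longrightarrow> \<exists>z\<ge>0. R' t \<le> C * z \<and> ereal z \<le> theta \<omega> (R t)"
    and d: "\<sigma> < d" "d < T"
  shows "recip_integral (theta \<omega>) (R d) < \<infinity>"
proof -
  define th where "th = (\<lambda>x. if 0 < x then theta \<omega> x else 0)"
  have [measurable]: "th \<in> borel_measurable borel" unfolding th_def by (rule theta_measurable)
  define f where "f = (\<lambda>x. e2ennreal (1 / th x))"
  have fm [measurable]: "f \<in> borel_measurable borel" unfolding f_def by measurable
  \<comment> \<open>The substitution is made on [c, d] with c > \<sigma>, because R is known to be
    differentiable only after \<sigma>; the bound is uniform in c.\<close>
  have bound: "(\<integral>\<^sup>+x. f x * indicator {R c..R d} x \<partial>lborel) \<le> ennreal (C * (d - \<sigma>))" if c: "\<sigma> < c" "c < d" for c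
  proof -
    have "(\<integral>\<^sup>+x. f x * indicator {R c..R d} x \<partial>lborel) = (\<integral>\<^sup>+x. f (R x) * R' x * indicator {c..d} x \<partial>lborel)"
      by (rule nn_integral_substitution_aux[OF fm _ dR cR' R'0]) (use c d in auto)
    also have "\<dots> \<le> (\<integral>\<^sup>+x. ennreal C * indicator {c..d} x \<partial>lborel)"
    proof (rule nn_integral_mono)
      fix t :: real
      show "f (R t) * ennreal (R' t) * indicator {c..d} t \<le> ennreal C * indicator {c..d} t"
      proof (cases "t \<in> {c..d}")
        case True
        then have t: "\<sigma> < t" "t < T" using c d by auto
        obtain z where z: "z \<ge> 0" "R' t \<le> C * z" "ereal z \<le> theta \<omega> (R t)" using le[OF t] by blast
        have tht: "th (R t) = theta \<omega> (R t)" using R(3)[of t] t by (simp add: th_def)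
        have "f (R t) * ennreal (R' t) \<le> f (R t) * (ennreal C * ennreal z)"
          using z C by (intro mult_left_mono) (auto simp flip: ennreal_mult intro!: ennreal_leI)
        also have "\<dots> = ennreal C * (f (R t) * ennreal z)" by (simp add: mult_ac)
        also have "f (R t) * ennreal z \<le> 1"
        proof (cases "z = 0")
          case False
          then have z0: "z > 0" using z by simp
          have "f (R t) \<le> ennreal (1 / z)"
          proof -
            have "1 / theta \<omega> (R t) \<le> 1 / ereal z"
              using z z0 by (intro ereal_divide_left_mono) (auto simp: ereal_zero_less_0_iff intro: order.strict_trans2[OF _ z(3)])
            also have "1 / ereal z = ereal (1 / z)" using z0 by (simp add: one_ereal_def)
            finally show ?thesis unfolding f_def tht using e2ennreal_mono by (metis e2ennreal_ereal)
          qed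
          then have "f (R t) * ennreal z \<le> ennreal (1 / z) * ennreal z" by (rule mult_right_mono) simp
          also have "\<dots> = 1" using z0 by (simp flip: ennreal_mult)
          finally show ?thesis .
        qed simp
        finally show ?thesis using True by (simp add: mult_left_mono)
      qed simp
    qed
    also have "\<dots> = ennreal C * ennreal (d - c)" using c by (simp add: nn_integral_cmult_indicator)
    also have "\<dots> \<le> ennreal (C * (d - \<sigma>))" using c C by (simp flip: ennreal_mult add: ennreal_leI mult_left_mono)
    finally show ?thesis .
  qed
  define c where "c = (\<lambda>n. \<sigma> + (d - \<sigma>) / real (n + 2))"
  have c1: "\<sigma> < c n" "c n < d" for n
  proof -
    have "(d - \<sigma>) * 1 < (d - \<sigma>) * real (n + 2)" using d by (intro mult_strict_left_mono) auto
    then have "(d - \<sigma>) / real (n + 2) < d - \<sigma>" by (simp add: pos_divide_less_eq)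
    then show "\<sigma> < c n" "c n < d" using d by (auto simp: c_def)
  qed
  have cdec: "c n \<le> c m" if "m \<le> n" for m n
    using that d unfolding c_def by (intro add_left_mono divide_left_mono) auto
  have clim: "c \<longlonglongrightarrow> \<sigma>"
  proof -
    have "(\<lambda>n. (d - \<sigma>) / real (n + 2)) \<longlonglongrightarrow> 0"
      by (intro LIMSEQ_ignore_initial_segment lim_const_over_n)
    then have "(\<lambda>n. \<sigma> + (d - \<sigma>) / real (n + 2)) \<longlonglongrightarrow> \<sigma> + 0" by (intro tendsto_intros)
    then show ?thesis by (simp add: c_def)
  qed
  have Rlim: "(\<lambda>n. R (c n)) \<longlonglongrightarrow> 0"
  proof -
    have "(R \<longlongrightarrow> R \<sigma>) (at \<sigma> within {\<sigma>..T})" using R(1) \<sigma> by (auto simp: continuous_on_def)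
    moreover have "filterlim c (at \<sigma> within {\<sigma>..T}) sequentially"
      unfolding filterlim_at
    proof (intro conjI clim eventuallyI)
      show "c n \<in> {\<sigma>..T}" "c n \<noteq> \<sigma>" for n using c1[of n] d by auto
    qed
    ultimately show ?thesis using R(2) filterlim_compose[of R _ _ c] by auto
  qed
  have Rmono: "R s \<le> R t" if st: "\<sigma> < s" "s \<le> t" "t < T" for s t
    by (rule DERIV_nonneg_imp_nondecreasing[OF st(2)]) (use dR R'0 st in \<open>meson less_le_trans le_less_trans\<close>)
  define D where "D = density lborel f"
  define A where "A = (\<lambda>n. {R (c n)..R d})"
  \<comment> \<open>Letting c decrease to \<sigma>, continuity from below of the measure with
    density 1 / \<theta> gives the bound on all of (0, R d).\<close>
  have "emeasure D (\<Union>n. A n) = (SUP n. emeasure D (A n))"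
  proof (rule SUP_emeasure_incseq[symmetric])
    show "incseq A" unfolding A_def incseq_def using Rmono cdec c1 d by (meson atLeastatMost_subset_iff order_less_trans order_refl)
  qed (auto simp: A_def D_def)
  also have "\<dots> \<le> ennreal (C * (d - \<sigma>))"
    by (rule SUP_least) (use bound c1 in \<open>simp add: D_def A_def emeasure_density\<close>)
  finally have fin: "emeasure D (\<Union>n. A n) \<le> ennreal (C * (d - \<sigma>))" .
  have "{0<..<R d} \<subseteq> (\<Union>n. A n)"
  proof
    fix x assume x: "x \<in> {0<..<R d}"
    then have "\<forall>\<^sub>F n in sequentially. R (c n) < x" using order_tendstoD(2)[OF Rlim, of x] by auto
    then obtain n where "R (c n) < x" unfolding eventually_sequentially by auto
    then show "x \<in> (\<Union>n. A n)" using x by (auto simp: A_def intro: less_imp_le)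
  qed
  then have "emeasure D {0<..<R d} \<le> emeasure D (\<Union>n. A n)" by (intro emeasure_mono) (auto simp: D_def A_def)
  moreover have "emeasure D {0<..<R d} = recip_integral (theta \<omega>) (R d)"
    unfolding D_def recip_integral_def f_def
    by (simp add: emeasure_density) (rule nn_integral_cong, auto simp: th_def split: split_indicator)
  ultimately show ?thesis using fin by (metis ennreal_less_top infinity_ennreal_def order_le_less_trans)
qed

lemma modulus_simps:
  assumes "modulus \<omega>"
  shows "\<omega> 0 = 0" "0 \<le> r \<Longrightarrow> 0 \<le> \<omega> r" "0 \<le> r \<Longrightarrow> r \<le> s \<Longrightarrow> \<omega> r \<le> \<omega> s"
    "0 \<le> r \<Longrightarrow> 0 \<le> s \<Longrightarrow> \<omega> (r + s) \<le> \<omega> r + \<omega> s" "continuous_on {0..} \<omega>"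
  using assms unfolding modulus_def mono_on_def by auto

lemma C_class_continuous:
  assumes "modulus \<omega>" "lam \<in> C_class \<omega>"
  shows "continuous_on {0..1} lam"
proof -
  note m = modulus_simps[OF assms(1)]
  have le: "\<bar>lam t - lam s\<bar> \<le> \<omega> \<bar>t - s\<bar>" if "s \<in> {0..1}" "t \<in> {0..1}" for s t
  proof -
    consider "s < t" | "t < s" | "s = t" by linarith
    then show ?thesis
    proof cases
      case 1
      then show ?thesis using assms(2) that by (auto simp: C_class_def)
    next
      case 2
      then have "\<bar>lam s - lam t\<bar> \<le> \<omega> \<bar>s - t\<bar>" using assms(2) that by (auto simp: C_class_def)
      then show ?thesis by (simp add: abs_minus_commute)
    qed (use m in auto)
  qed
  show ?thesis unfolding continuous_on_def
  proof
    fix s :: real assume s: "s \<in> {0..1}"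
    have "((\<lambda>t. \<omega> \<bar>t - s\<bar>) \<longlongrightarrow> \<omega> \<bar>s - s\<bar>) (at s within {0..1})"
    proof -
      have "continuous_on {0..1} (\<lambda>t. \<omega> \<bar>t - s\<bar>)"
        by (rule continuous_on_compose2[OF m(5)]) (auto intro!: continuous_intros)
      then show ?thesis using s unfolding continuous_on_def by blast
    qed
    then have "((\<lambda>t. \<omega> \<bar>t - s\<bar>) \<longlongrightarrow> 0) (at s within {0..1})" using m by simp
    then have "((\<lambda>t. lam t - lam s) \<longlongrightarrow> 0) (at s within {0..1})"
      by (rule Lim_null_comparison[rotated]) (use le s in \<open>auto simp: eventually_at_filter\<close>)
    then show "(lam \<longlongrightarrow> lam s) (at s within {0..1})" by (simp add: LIM_zero_iff)
  qed
qed

text \<open>Let \<sigma> be the last time before t1 with p q = 0; the solution is at the origin at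
  \<sigma> and in the region p > 0 > q afterwards. Polar coordinates are thus available on [c, t1]
  for every c > \<sigma>, though not at \<sigma>.\<close>

lemma refl_sol_zero_pos:
  assumes m: "modulus \<omega>" and osg: "\<forall>\<^sub>F a in at_right 0. recip_integral (theta \<omega>) a = \<infinity>"
    and lam: "continuous_on {a..b} lam" "\<And>s t. a \<le> s \<Longrightarrow> s \<le> t \<Longrightarrow> t \<le> b \<Longrightarrow> \<bar>lam t - lam s\<bar> \<le> \<omega> (t - s)"
    and sol: "refl_sol a b lam p q K" and z: "p a = 0" "q a = 0" and t1: "a \<le> t1" "t1 \<le> b"
  shows "p t1 \<le> 0"
proof (rule ccontr)
  assume "\<not> p t1 \<le> 0"
  then have p1: "p t1 > 0" by simp
  note cpq = refl_sol_continuous[OF lam(1) sol]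
  have em: "p t * q t \<le> p s * q s" if "a \<le> s" "s \<le> t" "t \<le> b" for s t by (rule refl_sol_energy_mono[OF lam(1) sol that])
  have "p t1 * q t1 \<noteq> 0" using refl_sol_zero_energy[OF lam(1) sol z t1] p1 by auto
  moreover have "p t1 * q t1 \<le> 0" using em[of a t1] z t1 by simp
  ultimately have pq1: "p t1 * q t1 < 0" by linarith
  have "continuous_on {a..t1} (\<lambda>t. p t * q t)"
    by (intro continuous_intros continuous_on_subset[OF cpq(1)] continuous_on_subset[OF cpq(2)]) (use t1 in auto)
  then obtain \<sigma> where \<sigma>: "a \<le> \<sigma>" "\<sigma> \<le> t1" "p \<sigma> * q \<sigma> = 0"
    and nz: "\<And>u. \<sigma> < u \<Longrightarrow> u \<le> t1 \<Longrightarrow> p u * q u \<noteq> 0"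
    by (rule last_root) (simp add: z, rule t1, blast)
  have \<sigma>1: "\<sigma> < t1" using \<sigma> pq1 by (cases "\<sigma> = t1") auto
  have neg: "p u * q u < 0" if u: "\<sigma> < u" "u \<le> t1" for u
    using nz[OF u] em[of a u] u \<sigma> t1 z by (simp add: less_le)
  have z\<sigma>: "p \<sigma> = 0" "q \<sigma> = 0" using refl_sol_zero_energy[OF lam(1) sol z \<sigma>(1) _ \<sigma>(3)] \<sigma> t1 by auto
  have lams: "continuous_on {c..t1} lam" "refl_sol c t1 lam p q K" if "\<sigma> \<le> c" for c
    using that \<sigma> t1 refl_sol_subset[OF sol] by (auto intro: continuous_on_subset[OF lam(1)])
  have sgn: "p t > 0 \<and> q t < 0" if "\<sigma> < t" "t \<le> t1" for t
    by (rule refl_sol_sign[OF lams[of t], of t1]) (use that neg p1 in auto)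
  define R where "R = (\<lambda>t. sqrt (- (p t * q t)))"
  define \<phi> where "\<phi> = (\<lambda>t. lam t + (ln (p t) - ln (- q t)) / 2)"
  have polar: "\<exists>L. polar_system c t1 lam R \<phi> L" if c: "\<sigma> < c" for c
    by (rule refl_sol_imp_polar[OF lams[of c] _ _ R_def \<phi>_def]) (use c sgn in auto)
  have cphi: "continuous_on {c..t1} \<phi>" if "\<sigma> < c" for c using polar[OF that] by (auto simp: polar_system_def)
  have phi0: "\<phi> t \<ge> 0" if "\<sigma> < t" "t \<le> t1" for t using polar[OF that(1)] that by (auto simp: polar_system_def)
  have Rp: "R t > 0" if "\<sigma> < t" "t \<le> t1" for t using neg[OF that] by (simp add: R_def)
  have R0: "R \<sigma> = 0" using \<sigma>(3) by (simp add: R_def)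
  have cR: "continuous_on {\<sigma>..t1} R" unfolding R_def
    by (intro continuous_intros continuous_on_subset[OF cpq(1)] continuous_on_subset[OF cpq(2)]) (use \<sigma> t1 in auto)
  have Rm: "R s \<le> R t" if "\<sigma> \<le> s" "s \<le> t" "t \<le> t1" for s t
    unfolding R_def using em[of s t] that \<sigma> t1 by simp
  have x: "exp (lam t) * p t + exp (- lam t) * q t > 0" if t: "\<sigma> < t" "t \<le> t1" "\<phi> t \<noteq> 0" for t
  proof -
    obtain L where L: "p t = R t * exp (\<phi> t - lam t)" "q t = - (R t * exp (lam t - \<phi> t))"
      by (rule refl_sol_imp_polar[OF lams[of t] _ _ R_def \<phi>_def]) (use t sgn in auto)
    have "exp (lam t) * p t + exp (- lam t) * q t = R t * (exp (\<phi> t) - exp (- \<phi> t))"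
      unfolding L by (simp add: exp_diff exp_minus field_simps)
    also have "\<dots> > 0" using Rp[OF t(1,2)] phi0[OF t(1,2)] t(3) by simp
    finally show ?thesis .
  qed
  \<comment> \<open>The angle vanishes at times arbitrarily close to \<sigma>. Otherwise K would be
    constant from \<sigma> to some t, p would be nonincreasing there, and it could not become
    positive.\<close>
  have zero: "\<exists>c. \<sigma> < c \<and> c \<le> t \<and> \<phi> c = 0" if t: "\<sigma> < t" "t \<le> t1" for t
  proof (rule ccontr)
    assume neg: "\<not> ?thesis"
    have solt: "refl_sol \<sigma> t lam p q K" by (rule refl_sol_subset[OF sol]) (use \<sigma> t t1 in auto)
    have K1: "K u = K t" if u: "\<sigma> < u" "u \<le> t" for u
    proof -
      have "0 < exp (lam v) * p v + exp (- lam v) * q v" if "v \<in> {u..t}" for v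
        using x[of v] neg that u t by auto
      then show ?thesis using solt u unfolding refl_sol_def by (meson less_imp_le order_refl)
    qed
    have "continuous_on {\<sigma>..t} K" using solt by (simp add: refl_sol_def)
    then have "K \<sigma> = K t" using K1 by (rule eq_at_left_endpoint[OF _ t(1)])
    then have KK: "K u = K t" if "\<sigma> \<le> u" "u \<le> t" for u using K1[of u] that by (cases "u = \<sigma>") auto
    have KK': "K v = K u" if "\<sigma> \<le> u" "u \<le> v" "v \<le> t" for u v
      using KK[of u] KK[of v] that by (metis order_trans)
    have mK: "mono_on {\<sigma>..t} K" using solt by (simp add: refl_sol_def)
    have "incr \<sigma> t K p (\<lambda>t. - exp (- lam t)) (\<lambda>t. exp (- lam t))" using solt by (simp add: refl_sol_def)
    then have D: "incr \<sigma> t K p (\<lambda>t. - exp (- lam t)) (\<lambda>t. 0)" by (rule incr_congK) (rule KK')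
    have "mono_on {\<sigma>..t} (\<lambda>u. (-1) * p u)" by (rule incr_mono[OF incr_cmult[OF D] mK]) auto
    then have "(-1) * p \<sigma> \<le> (-1) * p t" by (rule mono_onD) (use t in auto)
    then show False using sgn[OF t] z\<sigma> by simp
  qed
  \<comment> \<open>Let s be the last zero of the angle before t. From s to t no local time acts,
    and cosh \<phi> \<ge> 1 with R \<le> R t makes the drift integral at least (t - s) / R
    t.\<close>
  have key: "\<exists>s. \<sigma> < s \<and> s \<le> t \<and> \<phi> t \<le> \<omega> (t - s) - (t - s) / R t" if t: "\<sigma> < t" "t \<le> t1" for t
  proof -
    obtain c where c: "\<sigma> < c" "c \<le> t" "\<phi> c = 0" using zero[OF t] by blast
    obtain L where L: "polar_system c t1 lam R \<phi> L" using polar[OF c(1)] by blast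
    obtain s where s: "c \<le> s" "s \<le> t" "\<phi> s = 0" "L s = L t"
    proof (rule last_zero[of c t1 \<phi> L t])
      show "L s = L t" if "c \<le> s" "s \<le> t" "t \<le> t1" "\<And>u. u \<in> {s..t} \<Longrightarrow> 0 < \<phi> u" for s t
        using L that unfolding polar_system_def by blast
    qed (use L c t in \<open>auto simp: polar_system_def\<close>)
    define g where "g = (\<lambda>u. cosh (\<phi> u) / R u)"
    have cg: "continuous_on {c..t1} g" unfolding g_def
      by (intro continuous_intros cphi c continuous_on_subset[OF cR]) (use c Rp in \<open>auto simp: order.strict_implies_not_eq[symmetric] less_le_trans dest!: Rp[OF less_le_trans[OF c(1)]]\<close>)
    have eq: "lam u - lam c = \<phi> u - \<phi> c + integral {c..u} g - (L u - L c)" if "u \<in> {c..t1}" for u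
      using L that unfolding polar_system_def g_def by blast
    have "\<phi> t = lam t - lam s - integral {s..t} g"
      using eq[of t] eq[of s] s c t integral_diff_cont[OF cg s(1,2) t(2)] by auto
    moreover have "integral {s..t} (\<lambda>u. 1 / R t) \<le> integral {s..t} g"
    proof (rule integral_le)
      show "g integrable_on {s..t}" using s t by (intro integrable_continuous_interval continuous_on_subset[OF cg]) auto
      fix u assume u: "u \<in> {s..t}"
      have "1 \<le> cosh (\<phi> u)" by (rule cosh_real_ge_1)
      then show "1 / R t \<le> g u" unfolding g_def using Rp[of u] Rm[of u t] u s c t by (intro frac_le) auto
    qed auto
    then have "(t - s) / R t \<le> integral {s..t} g" using s by simp
    moreover have "lam t - lam s \<le> \<omega> (t - s)" using lam(2)[of s t] s c t \<sigma> t1 by auto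
    ultimately show ?thesis using s c by (intro exI[of _ s]) auto
  qed
  \<comment> \<open>A uniform bound for the angle; it allows R' = sinh \<phi> to be bounded by cosh
    W times \<phi>.\<close>
  define W where "W = \<omega> (b - a)"
  have phiW: "\<phi> t \<le> W" if t: "\<sigma> < t" "t \<le> t1" for t
  proof -
    obtain s where s: "\<sigma> < s" "s \<le> t" "\<phi> t \<le> \<omega> (t - s) - (t - s) / R t" using key[OF t] by blast
    have "(t - s) / R t \<ge> 0" using s Rp[OF t] by simp
    moreover have "\<omega> (t - s) \<le> W" unfolding W_def by (rule modulus_simps(3)[OF m]) (use s t t1 \<sigma> in auto)
    ultimately show ?thesis using s by linarith
  qed
  have dR: "(R has_real_derivative sinh (\<phi> t)) (at t)" if t: "\<sigma> < t" "t < t1" for t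
  proof -
    define c where "c = (\<sigma> + t) / 2"
    have c: "\<sigma> < c" "c < t" using t by (auto simp: c_def)
    obtain L where L: "polar_system c t1 lam R \<phi> L" using polar[OF c(1)] by blast
    have "continuous_on {c..t1} (\<lambda>u. sinh (\<phi> u))" by (intro continuous_intros cphi c)
    then have "((\<lambda>u. integral {c..u} (\<lambda>u. sinh (\<phi> u))) has_real_derivative sinh (\<phi> t)) (at t within {c..t1})"
      using integral_has_real_derivative[of c t1 "\<lambda>u. sinh (\<phi> u)" t] c t by auto
    then have "((\<lambda>u. R c + integral {c..u} (\<lambda>u. sinh (\<phi> u))) has_real_derivative sinh (\<phi> t)) (at t)"
      using c t by (auto intro!: derivative_eq_intros simp: at_within_Icc_at)
    then show ?thesis
    proof (rule has_field_derivative_transform_within_open[where S = "{c<..<t1}"])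
      show "R c + integral {c..u} (\<lambda>u. sinh (\<phi> u)) = R u" if "u \<in> {c<..<t1}" for u
      proof -
        have "u \<in> {c..t1}" using that by auto
        then have "R u = R c + integral {c..u} (\<lambda>u. sinh (\<phi> u))" using L unfolding polar_system_def by blast
        then show ?thesis by simp
      qed
    qed (use c t in auto)
  qed
  define d where "d = (\<sigma> + t1) / 2"
  have d: "\<sigma> < d" "d < t1" using \<sigma>1 by (auto simp: d_def)
  have "recip_integral (theta \<omega>) (R d) < \<infinity>"
  proof (rule recip_integral_finite[OF \<sigma>1 _ cR R0 Rp dR _ _ _ d, where C = "cosh W"])
    show "continuous_on {c..d} (\<lambda>t. sinh (\<phi> t))" if "\<sigma> < c" "d < t1" for c d
      by (intro continuous_intros continuous_on_subset[OF cphi[OF that(1)]]) (use that in auto)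
    show "sinh (\<phi> t) \<ge> 0" if "\<sigma> < t" "t < t1" for t using phi0[of t] that by simp
    show "\<exists>z\<ge>0. sinh (\<phi> t) \<le> cosh W * z \<and> ereal z \<le> theta \<omega> (R t)" if t: "\<sigma> < t" "t < t1" for t
    proof (intro exI[of _ "\<phi> t"] conjI)
      have p: "0 \<le> \<phi> t" "\<phi> t \<le> W" using phi0 phiW t by auto
      show "0 \<le> \<phi> t" by fact
      show "sinh (\<phi> t) \<le> cosh W * \<phi> t" using sinh_cosh_lip(1)[of "\<phi> t" W 0] p by auto
      obtain s where s: "\<sigma> < s" "s \<le> t" "\<phi> t \<le> \<omega> (t - s) - (t - s) / R t" using key[of t] t by auto
      have "ereal (\<phi> t) \<le> ereal (\<omega> (t - s) - (t - s) / R t)" using s by simp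
      also have "\<dots> \<le> theta \<omega> (R t)" unfolding theta_def by (rule SUP_upper) (use s in auto)
      finally show "ereal (\<phi> t) \<le> theta \<omega> (R t)" .
    qed
  qed auto
  moreover have "\<exists>a. 0 < a \<and> a < R d \<and> recip_integral (theta \<omega>) a = \<infinity>"
  proof -
    have Rd: "0 < R d" using Rp d by auto
    obtain e where e: "e > 0" "\<And>a. 0 < a \<Longrightarrow> a < e \<Longrightarrow> recip_integral (theta \<omega>) a = \<infinity>"
      using osg unfolding eventually_at_right[OF zero_less_one] by blast
    then show ?thesis using Rd by (intro exI[of _ "min e (R d) / 2"]) auto
  qed
  then obtain a where "a < R d" "recip_integral (theta \<omega>) a = \<infinity>" by blast
  moreover have "recip_integral (theta \<omega>) a \<le> recip_integral (theta \<omega>) (R d)" if "a < R d" for a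
    unfolding recip_integral_def using that by (intro nn_integral_mono) (auto split: split_indicator)
  ultimately show False by (metis infinity_ennreal_def less_le_not_le top_greatest)
qed

text \<open>The one-sided result for the solution and for its reflection gives p \<le> 0 and q \<le>
  0, while x \<ge> 0 forces both to vanish.\<close>

lemma refl_sol_zero:
  assumes m: "modulus \<omega>" and osg: "\<forall>\<^sub>F a in at_right 0. recip_integral (theta \<omega>) a = \<infinity>"
    and lam: "continuous_on {a..b} lam" "\<And>s t. a \<le> s \<Longrightarrow> s \<le> t \<Longrightarrow> t \<le> b \<Longrightarrow> \<bar>lam t - lam s\<bar> \<le> \<omega> (t - s)"
    and sol: "refl_sol a b lam p q K" and z: "p a = 0" "q a = 0" and t: "a \<le> t" "t \<le> b"
  shows "p t = 0 \<and> q t = 0"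
proof -
  have "p t \<le> 0" by (rule refl_sol_zero_pos[OF m osg lam sol z t])
  moreover have "q t \<le> 0"
  proof (rule refl_sol_zero_pos[OF m osg _ _ refl_sol_swap[OF sol] z(2,1) t])
    show "continuous_on {a..b} (\<lambda>t. - lam t)" by (intro continuous_intros lam)
    show "\<bar>- lam t - - lam s\<bar> \<le> \<omega> (t - s)" if "a \<le> s" "s \<le> t" "t \<le> b" for s t
      using lam(2)[OF that] by (simp add: abs_minus_commute)
  qed
  moreover have "exp (lam t) * p t + exp (- lam t) * q t \<ge> 0" using sol t by (auto simp: refl_sol_def)
  moreover have "exp (lam t) * p t \<le> 0" "exp (- lam t) * q t \<le> 0"
    using calculation by (auto simp: mult_le_0_iff)
  ultimately have "exp (lam t) * p t = 0" "exp (- lam t) * q t = 0" by linarith+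
  then show ?thesis by simp
qed

section \<open>Existence and uniqueness\<close>

lemma refl_sol_free:
  assumes lam: "continuous_on {a..b} lam"
    and p: "\<And>t. t \<in> {a..b} \<Longrightarrow> p t = p0 - integral {a..t} (\<lambda>u. exp (- lam u))"
    and q: "\<And>t. t \<in> {a..b} \<Longrightarrow> q t = q0 - integral {a..t} (\<lambda>u. exp (lam u))"
    and x0: "\<And>t. t \<in> {a..b} \<Longrightarrow> exp (lam t) * p t + exp (- lam t) * q t \<ge> 0"
  shows "refl_sol a b lam p q (\<lambda>t. 0)"
proof -
  have mK: "mono_on {a..b} (\<lambda>t. 0 :: real)" by (simp add: mono_on_def)
  have c: "continuous_on {a..b} (\<lambda>u. exp (- lam u))" "continuous_on {a..b} (\<lambda>u. exp (lam u))" by (intro continuous_intros lam)+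
  have "incr a b (\<lambda>t. 0) (\<lambda>t. p0 - integral {a..t} (\<lambda>u. exp (- lam u))) (\<lambda>t. 0 - exp (- lam t)) (\<lambda>t. 0 - 0)"
    by (intro incr_diff incr_const incr_integral mK c)
  then have "incr a b (\<lambda>t. 0) (\<lambda>t. p0 - integral {a..t} (\<lambda>u. exp (- lam u))) (\<lambda>t. 0 - exp (- lam t)) (\<lambda>t. exp (- lam t))"
    by (rule incr_congK) simp
  then have "incr a b (\<lambda>t. 0) p (\<lambda>t. - exp (- lam t)) (\<lambda>t. exp (- lam t))" by (rule incr_cong) (simp_all add: p)
  moreover have "incr a b (\<lambda>t. 0) (\<lambda>t. q0 - integral {a..t} (\<lambda>u. exp (lam u))) (\<lambda>t. 0 - exp (lam t)) (\<lambda>t. 0 - 0)"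
    by (intro incr_diff incr_const incr_integral mK c)
  then have "incr a b (\<lambda>t. 0) (\<lambda>t. q0 - integral {a..t} (\<lambda>u. exp (lam u))) (\<lambda>t. 0 - exp (lam t)) (\<lambda>t. exp (lam t))"
    by (rule incr_congK) simp
  then have "incr a b (\<lambda>t. 0) q (\<lambda>t. - exp (lam t)) (\<lambda>t. exp (lam t))" by (rule incr_cong) (simp_all add: q)
  ultimately show ?thesis unfolding refl_sol_def using mK x0 by simp
qed

text \<open>Rest at the origin: the local time K t = t cancels the drift exactly.\<close>

lemma refl_sol_null: "refl_sol a b lam (\<lambda>t. 0) (\<lambda>t. 0) (\<lambda>t. t)"
proof -
  have "mono_on {a..b} (\<lambda>t. t :: real)" by (simp add: mono_on_def)
  then show ?thesis unfolding refl_sol_def incr_def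
    by (auto intro!: negligible_cong[OF negligible_0] continuous_intros)
qed

text \<open>Both local times are normalised to vanish at c, which makes the glued one continuous.
  Where x stays positive across c, each part is constant on its own side.\<close>

lemma refl_sol_glue:
  assumes lam: "continuous_on {a..b} lam"
    and sol: "refl_sol a c lam p q K" "refl_sol c b lam p' q' K'" and ac: "a \<le> c" "c \<le> b" and eq: "p c = p' c" "q c = q' c"
  shows "refl_sol a b lam (\<lambda>t. if t \<le> c then p t else p' t) (\<lambda>t. if t \<le> c then q t else q' t)
    (\<lambda>t. if t \<le> c then K t - K c else K' t - K' c)" (is "refl_sol a b lam ?p ?q ?K")
proof -
  have m: "K s \<le> K t" if "a \<le> s" "s \<le> t" "t \<le> c" for s t using sol that by (auto simp: refl_sol_def mono_on_def)
  have m': "K' s \<le> K' t" if "c \<le> s" "s \<le> t" "t \<le> b" for s t using sol that by (auto simp: refl_sol_def mono_on_def)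
  have mK: "mono_on {a..b} ?K"
  proof (rule mono_onI)
    fix s t assume "s \<in> {a..b}" "t \<in> {a..b}" "s \<le> t"
    then show "?K s \<le> ?K t" using m[of s t] m'[of s t] m[of s c] m'[of c t] ac by auto
  qed
  have ab: "{a..b} = {a..c} \<union> {c..b}" using ac by auto
  have cK: "continuous_on {a..b} ?K" unfolding ab
    by (rule continuous_on_If) (use sol in \<open>auto simp: refl_sol_def intro!: continuous_intros\<close>)
  have cl: "continuous_on {a..b} (\<lambda>t. exp (- lam t))" "continuous_on {a..b} (\<lambda>t. - exp (- lam t))"
    "continuous_on {a..b} (\<lambda>t. exp (lam t))" "continuous_on {a..b} (\<lambda>t. - exp (lam t))"
    by (intro continuous_intros lam)+
  have gl: "incr a b ?K (\<lambda>t. if t \<le> c then f t else f' t) \<alpha> \<beta>"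
    if "incr a c K f \<alpha> \<beta>" "incr c b K' f' \<alpha> \<beta>" "f c = f' c" "continuous_on {a..b} \<alpha>" "continuous_on {a..b} \<beta>" for f f' \<alpha> \<beta>
  proof (rule incr_glue[OF _ _ ac mK that(4,5)])
    have "incr a c K (\<lambda>t. if t \<le> c then f t else f' t) \<alpha> \<beta>" by (rule incr_cong[OF that(1)]) auto
    then show "incr a c ?K (\<lambda>t. if t \<le> c then f t else f' t) \<alpha> \<beta>"
      unfolding incr_def by (rule negligible_cong[OF negligible_congK]) auto
    have "incr c b K' (\<lambda>t. if t \<le> c then f t else f' t) \<alpha> \<beta>" by (rule incr_cong[OF that(2)]) (use that(3) in auto)
    moreover have "?K t - ?K s = K' t - K' s" if "c \<le> s" "s \<le> t" for s t
      using that by (cases "t = c"; cases "s = c") auto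
    ultimately show "incr c b ?K (\<lambda>t. if t \<le> c then f t else f' t) \<alpha> \<beta>"
      unfolding incr_def by (elim negligible_cong[OF negligible_congK]) simp_all
  qed
  define x where "x = (\<lambda>t. exp (lam t) * ?p t + exp (- lam t) * ?q t)"
  have x1: "x t = exp (lam t) * p t + exp (- lam t) * q t" if "t \<le> c" for t using that by (simp add: x_def)
  have x2: "x t = exp (lam t) * p' t + exp (- lam t) * q' t" if "t \<ge> c" for t using that eq by (auto simp: x_def)
  have fl: "?K s = ?K t" if st: "a \<le> s" "s \<le> t" "t \<le> b" and pos: "\<forall>u\<in>{s..t}. x u > 0" for s t
  proof -
    have 1: "K u = K v" if "s \<le> u" "u \<le> v" "v \<le> t" "v \<le> c" for u v
    proof -
      have "exp (lam w) * p w + exp (- lam w) * q w > 0" if w: "w \<in> {u..v}" for w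
      proof -
        have "w \<in> {s..t}" "w \<le> c" using w \<open>s \<le> u\<close> \<open>v \<le> t\<close> \<open>v \<le> c\<close> by auto
        then show ?thesis using bspec[OF pos, of w] x1[of w] by simp
      qed
      then have "\<forall>w\<in>{u..v}. exp (lam w) * p w + exp (- lam w) * q w > 0" by blast
      then show ?thesis using sol(1) that st unfolding refl_sol_def by (meson order_trans)
    qed
    have 2: "K' u = K' v" if "s \<le> u" "u \<le> v" "v \<le> t" "c \<le> u" for u v
    proof -
      have "exp (lam w) * p' w + exp (- lam w) * q' w > 0" if w: "w \<in> {u..v}" for w
      proof -
        have "w \<in> {s..t}" "c \<le> w" using w \<open>s \<le> u\<close> \<open>v \<le> t\<close> \<open>c \<le> u\<close> by auto
        then show ?thesis using bspec[OF pos, of w] x2[of w] by simp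
      qed
      then have "\<forall>w\<in>{u..v}. exp (lam w) * p' w + exp (- lam w) * q' w > 0" by blast
      then show ?thesis using sol(2) that st unfolding refl_sol_def by (meson order_trans)
    qed
    consider "t \<le> c" | "c < s" | "s \<le> c" "c < t" by linarith
    then show ?thesis
    proof cases
      case 1
      then show ?thesis using \<open>\<And>u v. s \<le> u \<Longrightarrow> u \<le> v \<Longrightarrow> v \<le> t \<Longrightarrow> v \<le> c \<Longrightarrow> K u = K v\<close>[of s t] st by simp
    next
      case 2
      then show ?thesis using \<open>\<And>u v. s \<le> u \<Longrightarrow> u \<le> v \<Longrightarrow> v \<le> t \<Longrightarrow> c \<le> u \<Longrightarrow> K' u = K' v\<close>[of s t] st by simp
    next
      case 3
      then show ?thesis using 1[of s c] 2[of c t] by simp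
    qed
  qed
  have "x t \<ge> 0" if "t \<in> {a..b}" for t
    using x1[of t] x2[of t] sol that by (cases "t \<le> c") (auto simp: refl_sol_def)
  moreover have "incr a b ?K ?p (\<lambda>t. - exp (- lam t)) (\<lambda>t. exp (- lam t))"
    by (rule gl) (use sol eq cl in \<open>simp_all add: refl_sol_def\<close>)
  moreover have "incr a b ?K ?q (\<lambda>t. - exp (lam t)) (\<lambda>t. exp (lam t))"
    by (rule gl) (use sol eq cl in \<open>simp_all add: refl_sol_def\<close>)
  ultimately show ?thesis unfolding refl_sol_def x_def using mK cK fl unfolding x_def by blast
qed

text \<open>On the boundary the solution is (0, y) with y = exp l * p. This expresses p and q by y,
  in the form of the initial conditions of \<open>refl_sol_exists_pos\<close> and
  \<open>refl_sol_unique_pos\<close>.\<close>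

lemma boundary_form:
  fixes l p q :: real
  assumes "exp l * p + exp (- l) * q = 0"
  shows "p = exp (- l) * (exp l * p)" "q = - (exp l * (exp l * p))"
proof -
  show "p = exp (- l) * (exp l * p)" by (simp add: exp_minus)
  have "exp l * p = - (exp (- l) * q)" using assms by linarith
  then have "exp l * (exp l * p) = - (exp l * (exp (- l) * q))" by simp
  also have "exp l * (exp (- l) * q) = q" by (simp add: exp_minus)
  finally show "q = - (exp l * (exp l * p))" by simp
qed

lemma refl_sol_exists_boundary:
  assumes lam: "continuous_on {a..b} lam" and ab: "a \<le> b" and x0: "exp (lam a) * p0 + exp (- lam a) * q0 = 0"
  obtains p q K where "refl_sol a b lam p q K" "p a = p0" "q a = q0"
proof -
  define y where "y = exp (lam a) * p0"
  note bf = boundary_form[OF x0, folded y_def]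
  consider "y > 0" | "y = 0" | "y < 0" by linarith
  then show thesis
  proof cases
    case 1
    then show thesis using refl_sol_exists_pos[OF lam 1 ab] that bf by metis
  next
    case 2
    then show thesis using refl_sol_null[of a b lam] that[of "\<lambda>t. 0" "\<lambda>t. 0"] bf by auto
  next
    case 3
    then have y: "- y > 0" by simp
    have "continuous_on {a..b} (\<lambda>t. - lam t)" by (intro continuous_intros lam)
    from refl_sol_exists_pos[OF this y ab] obtain p q K
      where s: "refl_sol a b (\<lambda>t. - lam t) p q K" "p a = exp (- (- lam a)) * (- y)" "q a = - (exp (- lam a) * (- y))" by metis
    from refl_sol_swap[OF s(1)] have "refl_sol a b lam q p K" by simp
    then show thesis using that s bf by auto
  qed
qed

text \<open>Without local time the equation is solved by integration up to the first time at which x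
  reaches 0; from there on a solution started on the boundary is attached.\<close>

lemma refl_sol_exists:
  assumes lam: "continuous_on {a..b} lam" and ab: "a \<le> b" and x0: "exp (lam a) * p0 + exp (- lam a) * q0 \<ge> 0"
  obtains p q K where "refl_sol a b lam p q K" "p a = p0" "q a = q0"
proof -
  define p where "p = (\<lambda>t. p0 - integral {a..t} (\<lambda>u. exp (- lam u)))"
  define q where "q = (\<lambda>t. q0 - integral {a..t} (\<lambda>u. exp (lam u)))"
  define x where "x = (\<lambda>t. exp (lam t) * p t + exp (- lam t) * q t)"
  have cx: "continuous_on {a..b} x" unfolding x_def p_def q_def
    by (intro continuous_intros lam indefinite_integral_continuous_1 integrable_continuous_interval)
  have pa: "p a = p0" "q a = q0" by (simp_all add: p_def q_def)
  show thesis
  proof (cases "\<forall>t\<in>{a..b}. x t > 0")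
    case True
    have "refl_sol a b lam p q (\<lambda>t. 0)"
      by (rule refl_sol_free[OF lam, of p p0 q q0]) (use True in \<open>auto simp: p_def q_def x_def less_imp_le\<close>)
    then show thesis using that pa by blast
  next
    case False
    define S where "S = {t \<in> {a..b}. x t \<le> 0}"
    have "closed S" unfolding S_def using continuous_closed_preimage[OF cx closed_atLeastAtMost, of "{..0}"]
      by (simp add: vimage_def Collect_conj_eq[symmetric] Int_def)
    moreover have "bounded S" by (rule bounded_subset[of "{a..b}"]) (auto simp: S_def)
    moreover have "S \<noteq> {}" using False by (force simp: S_def)
    moreover from \<open>bounded S\<close> have bd: "bdd_below S" by (rule bounded_imp_bdd_below)
    ultimately have SS: "Inf S \<in> S" using closed_contains_Inf by blast
    define c where "c = Inf S"
    have c: "a \<le> c" "c \<le> b" "x c \<le> 0" using SS by (auto simp: S_def c_def)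
    have pos: "x t > 0" if "a \<le> t" "t < c" for t
    proof -
      have "t \<notin> S" using that cInf_lower[OF _ bd, of t] by (auto simp: c_def)
      then show ?thesis using that c by (auto simp: S_def)
    qed
    have xc: "x c = 0"
    proof (cases "c = a")
      case True
      then show ?thesis using x0 c pa by (simp add: x_def)
    next
      case False
      then have ac: "a < c" using c by simp
      have "(x \<longlongrightarrow> x c) (at_left c)" by (rule continuous_on_at_left[OF cx ac c(2)])
      then have "0 \<le> x c"
        by (rule tendsto_lowerbound[OF _ eventually_at_leftI[OF _ ac]]) (use pos in \<open>auto simp: less_imp_le\<close>)
      then show ?thesis using c by simp
    qed
    have "refl_sol a c lam p q (\<lambda>t. 0)"
    proof (rule refl_sol_free[of a c lam p p0 q q0])
      show "continuous_on {a..c} lam" using lam by (rule continuous_on_subset) (use c in auto)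
      show "0 \<le> exp (lam t) * p t + exp (- lam t) * q t" if "t \<in> {a..c}" for t
        using pos[of t] xc that by (cases "t = c") (auto simp: x_def less_imp_le)
    qed (auto simp: p_def q_def)
    moreover have "continuous_on {c..b} lam" using lam by (rule continuous_on_subset) (use c in auto)
    then obtain p' q' K' where "refl_sol c b lam p' q' K'" "p' c = p c" "q' c = q c"
      using refl_sol_exists_boundary[OF _ c(2), of lam "p c" "q c"] xc unfolding x_def by metis
    ultimately have "refl_sol a b lam (\<lambda>t. if t \<le> c then p t else p' t) (\<lambda>t. if t \<le> c then q t else q' t)
      (\<lambda>t. if t \<le> c then 0 - 0 else K' t - K' c)"
      using refl_sol_glue[OF lam, of c p q "\<lambda>t. 0" p' q' K'] c by simp
    then show thesis by (rule that) (use pa c in auto)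
  qed
qed

text \<open>Where x > 0, neither local time grows and both solutions follow the same free motion for
  a while. On the boundary three cases arise by the sign of y, and it is y = 0 that draws on the
  Osgood condition.\<close>

lemma refl_sol_unique_local:
  assumes m: "modulus \<omega>" and osg: "\<forall>\<^sub>F a in at_right 0. recip_integral (theta \<omega>) a = \<infinity>"
    and lam: "continuous_on {a..b} lam" "\<And>s t. a \<le> s \<Longrightarrow> s \<le> t \<Longrightarrow> t \<le> b \<Longrightarrow> \<bar>lam t - lam s\<bar> \<le> \<omega> (t - s)"
    and sol: "refl_sol a b lam p q K" "refl_sol a b lam p' q' K'" and eq: "p' a = p a" "q' a = q a" and ab: "a < b"
  shows "\<exists>c>a. c \<le> b \<and> (\<forall>t\<in>{a..c}. p' t = p t \<and> q' t = q t)"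
proof -
  define x where "x = (\<lambda>t. exp (lam t) * p t + exp (- lam t) * q t)"
  define x' where "x' = (\<lambda>t. exp (lam t) * p' t + exp (- lam t) * q' t)"
  have cx: "continuous_on {a..b} x" "continuous_on {a..b} x'"
    unfolding x_def x'_def using refl_sol_continuous(3)[OF lam(1)] sol by blast+
  have xx: "x' a = x a" using eq by (simp add: x_def x'_def)
  have xa: "x a \<ge> 0" using sol(1) ab by (auto simp: refl_sol_def x_def)
  show ?thesis
  proof (cases "x a = 0")
    case False
    then have xp: "x a > 0" using xa by simp
    have "\<forall>\<^sub>F t in at_right a. x t > 0" "\<forall>\<^sub>F t in at_right a. x' t > 0"
      using order_tendstoD(1)[OF continuous_on_at_right[OF cx(1) order_refl ab]]
        order_tendstoD(1)[OF continuous_on_at_right[OF cx(2) order_refl ab]] xp xx by auto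
    then have "\<forall>\<^sub>F t in at_right a. x t > 0 \<and> x' t > 0" by eventually_elim simp
    then obtain e where e: "e > a" "\<And>t. a < t \<Longrightarrow> t < e \<Longrightarrow> x t > 0 \<and> x' t > 0"
      unfolding eventually_at_right[OF ab] by blast
    define c where "c = min b ((a + e) / 2)"
    have c: "a < c" "c \<le> b" "c < e" using ab e by (auto simp: c_def min_def)
    have pos: "x t > 0" "x' t > 0" if "t \<in> {a..c}" for t using e(2)[of t] that c xp xx by (cases "t = a"; force)+
    have D: "incr a c (\<lambda>t. 0) f \<alpha> (\<lambda>t. 0)" if "incr a b k f \<alpha> \<beta>" "\<And>s t. a \<le> s \<Longrightarrow> s \<le> t \<Longrightarrow> t \<le> c \<Longrightarrow> k s = k t" for k f \<alpha> \<beta>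
    proof -
      have "incr a c k f \<alpha> (\<lambda>t. 0)" by (rule incr_congK[OF incr_subset[OF that(1)]]) (use that(2) c in auto)
      then show ?thesis unfolding incr_def
        by (rule negligible_cong[OF negligible_congK]) (use that(2) in auto)
    qed
    have K: "K s = K t" if "a \<le> s" "s \<le> t" "t \<le> c" for s t
    proof -
      have "\<forall>u\<in>{s..t}. x u > 0" using pos(1) that by auto
      then show ?thesis using sol(1) that c unfolding refl_sol_def x_def by (meson order_trans)
    qed
    have K': "K' s = K' t" if "a \<le> s" "s \<le> t" "t \<le> c" for s t
    proof -
      have "\<forall>u\<in>{s..t}. x' u > 0" using pos(2) that by auto
      then show ?thesis using sol(2) that c unfolding refl_sol_def x'_def by (meson order_trans)
    qed
    have m0: "mono_on {a..c} (\<lambda>t. 0 :: real)" by (simp add: mono_on_def)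
    have "p' t = p t \<and> q' t = q t" if t: "t \<in> {a..c}" for t
    proof
      have "p' t - p' a = p t - p a"
        by (rule incr_unique[OF D[OF _ K'] D[OF _ K] m0]) (use sol t c in \<open>auto simp: refl_sol_def\<close>)
      then show "p' t = p t" using eq by simp
      have "q' t - q' a = q t - q a"
        by (rule incr_unique[OF D[OF _ K'] D[OF _ K] m0]) (use sol t c in \<open>auto simp: refl_sol_def\<close>)
      then show "q' t = q t" using eq by simp
    qed
    then show ?thesis using c by blast
  next
    case True
    define y where "y = exp (lam a) * p a"
    note bf = boundary_form[OF True[unfolded x_def], folded y_def]
    have "\<forall>t\<in>{a..b}. p' t = p t \<and> q' t = q t"
    proof
      fix t assume t: "t \<in> {a..b}"
      have aa: "a \<in> {a..b}" using ab by simp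
      consider "y > 0" | "y = 0" | "y < 0" by linarith
      then show "p' t = p t \<and> q' t = q t"
      proof cases
        case 1
        have pa: "p a > 0" "q a < 0" using 1 by (subst bf; simp)+
        have neg: "p a * q a < 0" "p' a * q' a < 0" using pa eq by (simp_all add: mult_less_0_iff)
        have s: "p t > 0 \<and> q t < 0" "p' t > 0 \<and> q' t < 0" if "t \<in> {a..b}" for t
          using refl_sol_sign[OF lam(1) sol(1) neg(1) pa(1) aa that] refl_sol_sign[OF lam(1) sol(2) neg(2) _ aa that] pa eq by auto
        show ?thesis using refl_sol_unique_pos[OF lam(1) 1 _ sol bf eq _ _ _ _ t] s ab by auto
      next
        case 2
        then have z: "p a = 0" "q a = 0" using bf by auto
        then show ?thesis using refl_sol_zero[OF m osg lam sol(1) z, of t] refl_sol_zero[OF m osg lam sol(2), of t] eq t by auto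
      next
        case 3
        then have y: "- y > 0" by simp
        have lam': "continuous_on {a..b} (\<lambda>t. - lam t)" by (intro continuous_intros lam)
        note sol' = refl_sol_swap[OF sol(1)] refl_sol_swap[OF sol(2)]
        have pa: "q a > 0" "p a < 0" using 3 by (subst bf; simp add: mult_less_0_iff zero_less_mult_iff)+
        have neg: "q a * p a < 0" "q' a * p' a < 0" using pa eq by (simp_all add: mult_less_0_iff)
        have s: "q t > 0 \<and> p t < 0" "q' t > 0 \<and> p' t < 0" if "t \<in> {a..b}" for t
          using refl_sol_sign[OF lam' sol'(1) neg(1) pa(1) aa that] refl_sol_sign[OF lam' sol'(2) neg(2) _ aa that] pa eq by auto
        have "q' t = q t" "p' t = p t"
          by (rule refl_sol_unique_pos[OF lam' y _ sol' _ _ eq(2,1) _ _ _ _ t]; use s ab bf in auto)+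
        then show ?thesis by simp
      qed
    qed
    then show ?thesis using ab by auto
  qed
qed

text \<open>At the supremum c of the times of agreement the solutions still agree by continuity, and
  local uniqueness restarted at c would extend the agreement if c < b.\<close>

lemma refl_sol_unique:
  assumes m: "modulus \<omega>" and osg: "\<forall>\<^sub>F a in at_right 0. recip_integral (theta \<omega>) a = \<infinity>"
    and lam: "continuous_on {a..b} lam" "\<And>s t. a \<le> s \<Longrightarrow> s \<le> t \<Longrightarrow> t \<le> b \<Longrightarrow> \<bar>lam t - lam s\<bar> \<le> \<omega> (t - s)"
    and sol: "refl_sol a b lam p q K" "refl_sol a b lam p' q' K'" and eq: "p' a = p a" "q' a = q a" and t: "t \<in> {a..b}"
  shows "p' t = p t \<and> q' t = q t"
proof -
  define S where "S = {t \<in> {a..b}. \<forall>u\<in>{a..t}. p' u = p u \<and> q' u = q u}"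
  have S0: "S \<noteq> {}" "bdd_above S" using t eq by (auto simp: S_def intro!: exI[of _ a] bdd_aboveI[of _ b])
  define c where "c = Sup S"
  have c: "a \<le> c" "c \<le> b"
  proof -
    have "a \<in> S" using t eq by (auto simp: S_def)
    then show "a \<le> c" unfolding c_def by (rule cSup_upper[OF _ S0(2)])
    show "c \<le> b" unfolding c_def by (rule cSup_least[OF S0(1)]) (auto simp: S_def)
  qed
  have ag: "p' u = p u \<and> q' u = q u" if u: "a \<le> u" "u < c" for u
  proof -
    obtain v where "v \<in> S" "u < v" using less_cSup_iff[OF S0] u(2) by (auto simp: c_def)
    then show ?thesis using u by (auto simp: S_def)
  qed
  have agc: "p' c = p c \<and> q' c = q c"
  proof (cases "c = a")
    case False
    then have ac: "a < c" using c by simp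
    have lim: "f c = g c" if f: "continuous_on {a..b} f" and g: "continuous_on {a..b} g" and fg: "\<And>u. a \<le> u \<Longrightarrow> u < c \<Longrightarrow> f u = g u"
      for f g :: "real \<Rightarrow> real"
    proof -
      note l = continuous_on_at_left[OF _ ac c(2)]
      have "\<forall>\<^sub>F u in at_left c. f u = g u" by (rule eventually_at_leftI[OF _ ac]) (use fg in auto)
      then have "(g \<longlongrightarrow> f c) (at_left c)" by (rule Lim_transform_eventually[OF l[OF f]])
      then show ?thesis using l[OF g] tendsto_unique[OF trivial_limit_at_left_real] by blast
    qed
    show ?thesis using lim refl_sol_continuous(1,2)[OF lam(1) sol(1)] refl_sol_continuous(1,2)[OF lam(1) sol(2)] ag by blast
  qed (use eq in auto)
  have "c = b"
  proof (rule ccontr)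
    assume "c \<noteq> b"
    then have cb: "c < b" using c by simp
    have "\<exists>d>c. d \<le> b \<and> (\<forall>t\<in>{c..d}. p' t = p t \<and> q' t = q t)"
    proof (rule refl_sol_unique_local[OF m osg _ _ _ _ _ _ cb])
      show "continuous_on {c..b} lam" using lam(1) by (rule continuous_on_subset) (use c in auto)
      show "refl_sol c b lam p q K" "refl_sol c b lam p' q' K'" using sol c by (auto intro: refl_sol_subset)
    qed (use lam(2) c agc in auto)
    then obtain d where d: "d > c" "d \<le> b" "\<And>t. c \<le> t \<Longrightarrow> t \<le> d \<Longrightarrow> p' t = p t \<and> q' t = q t" by auto
    have "d \<in> S" unfolding S_def using d c ag by (auto simp: not_less) (meson not_less)+
    then have "d \<le> c" unfolding c_def by (rule cSup_upper[OF _ S0(2)])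
    then show False using d by simp
  qed
  then show ?thesis using ag[of t] agc t by (cases "t = b") auto
qed

lemma unique_solution:
  assumes m: "modulus \<omega>" and osg: "\<forall>\<^sub>F a in at_right 0. recip_integral (theta \<omega>) a = \<infinity>"
    and lam: "lam \<in> C_class \<omega>" and z0: "(z0 :: real^2) \<bullet> e1 \<ge> 0"
  shows "\<exists>Z. solution lam Z \<and> Z 0 = z0 \<and> (\<forall>Z'. solution lam Z' \<and> Z' 0 = z0 \<longrightarrow> (\<forall>t\<in>{0..1}. Z' t = Z t))"
proof -
  have cl: "continuous_on {0..1} lam" by (rule C_class_continuous[OF m lam])
  have lw: "\<bar>lam t - lam s\<bar> \<le> \<omega> (t - s)" if "0 \<le> s" "s \<le> t" "t \<le> 1" for s t
    using lam that modulus_simps(1)[OF m] by (cases "s = t") (auto simp: C_class_def)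
  define p0 q0 where "p0 = exp (- lam 0) * (z0 $ 1 + z0 $ 2)" and "q0 = exp (lam 0) * (z0 $ 1 - z0 $ 2)"
  have "exp (lam 0) * p0 + exp (- lam 0) * q0 = 2 * z0 $ 1" by (simp add: p0_def q0_def exp_minus field_simps)
  moreover have "z0 $ 1 \<ge> 0" using z0 by (simp add: e1_def inner_axis)
  ultimately have x0: "exp (lam 0) * p0 + exp (- lam 0) * q0 \<ge> 0" by simp
  obtain p q K where sol: "refl_sol 0 1 lam p q K" and ini: "p 0 = p0" "q 0 = q0" by (rule refl_sol_exists[OF cl _ x0]) auto
  define Z :: "real \<Rightarrow> real^2" where "Z = (\<lambda>t. vector [(exp (lam t) * p t + exp (- lam t) * q t) / 2, (exp (lam t) * p t - exp (- lam t) * q t) / 2])"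
  have "solution lam Z" unfolding Z_def
    by (rule refl_sol_imp_solution[OF cl _ _ refl_sol_continuous(1,2)[OF cl sol], of K])
      (use sol x0 ini refl_sol_subset[OF sol] in \<open>simp_all add: refl_sol_def[of 0 1]\<close>)
  moreover have "Z 0 = z0" unfolding Z_def ini p0_def q0_def
    by (simp add: vec_eq_iff forall_2 exp_minus field_simps)
  moreover have "Z' t = Z t" if Z': "solution lam Z'" "Z' 0 = z0" and t: "t \<in> {0..1}" for Z' t
  proof -
    obtain K' where "solution_pair lam Z' K'" using Z' by (auto simp: solution_def)
    from solution_pair_imp_refl_sol[OF cl this]
    have r: "refl_sol 0 1 lam (\<lambda>t. exp (- lam t) * (Z' t $ 1 + Z' t $ 2)) (\<lambda>t. exp (lam t) * (Z' t $ 1 - Z' t $ 2)) K'" .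
    have "exp (- lam t) * (Z' t $ 1 + Z' t $ 2) = p t \<and> exp (lam t) * (Z' t $ 1 - Z' t $ 2) = q t"
      by (rule refl_sol_unique[OF m osg cl lw sol r _ _ t]) (simp_all add: Z' ini p0_def q0_def)
    then have pq: "p t = exp (- lam t) * (Z' t $ 1 + Z' t $ 2)" "q t = exp (lam t) * (Z' t $ 1 - Z' t $ 2)" by auto
    show ?thesis unfolding Z_def pq by (simp add: vec_eq_iff forall_2 exp_minus field_simps)
  qed
  ultimately show ?thesis by blast
qed

section \<open>Scales extracted from the convergent integral\<close>

text \<open>At most r / d + 1 \<le> 2 (r / d) steps of length d cover [0, r]. The factor 2 is the
  price of subadditivity as compared with concavity.\<close>

lemma modulus_linear_upper:
  assumes m: "modulus \<omega>" and d: "0 < d" "d \<le> r"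
  shows "\<omega> r \<le> 2 * (r / d) * \<omega> d"
proof -
  note modulus_rules = modulus_simps[OF m]
  have mult: "\<omega> (real n * d) \<le> real n * \<omega> d" for n
  proof (induction n)
    case (Suc n)
    have "\<omega> (real (Suc n) * d) = \<omega> (real n * d + d)" by (simp add: algebra_simps)
    also have "\<dots> \<le> \<omega> (real n * d) + \<omega> d" using d by (intro modulus_rules(4)) auto
    also have "\<dots> \<le> real (Suc n) * \<omega> d" using Suc by (simp add: algebra_simps)
    finally show ?case .
  qed (simp add: modulus_rules)
  define n where "n = nat \<lceil>r / d\<rceil>"
  have n: "r / d \<le> real n" unfolding n_def by linarith
  have rd: "1 \<le> r / d" using d by simp
  have "real n \<le> r / d + 1" unfolding n_def using rd by linarith
  then have n2: "real n \<le> 2 * (r / d)" using rd by linarith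
  have "\<omega> r \<le> \<omega> (real n * d)" using n d by (intro modulus_rules(3)) (auto simp: field_simps)
  also have "\<dots> \<le> real n * \<omega> d" by (rule mult)
  also have "\<dots> \<le> 2 * (r / d) * \<omega> d" using n2 modulus_rules(2)[of d] d by (intro mult_right_mono) auto
  finally show ?thesis .
qed

text \<open>If \<omega> vanished at one r > 0, subadditivity would make it vanish everywhere; then
  \<theta> = 0 and the integral of 1 / \<theta> is infinite.\<close>

lemma modulus_pos:
  assumes m: "modulus \<omega>" and fin: "\<forall>\<^sub>F a in at_right 0. recip_integral (theta \<omega>) a < \<infinity>" and r: "r > 0"
  shows "\<omega> r > 0"
proof (rule ccontr)
  note modulus_rules = modulus_simps[OF m]
  assume "\<not> \<omega> r > 0"
  then have "\<omega> r = 0" using modulus_rules(2)[of r] r by simp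
  have z: "\<omega> s = 0" if s: "s \<ge> 0" for s
  proof -
    have "\<omega> s \<le> \<omega> (max r s)" using s by (intro modulus_rules(3)) auto
    also have "\<dots> \<le> 0" using modulus_linear_upper[OF m r, of "max r s"] \<open>\<omega> r = 0\<close> by simp
    finally show ?thesis using modulus_rules(2)[OF s] by simp
  qed
  have th: "theta \<omega> x = 0" if x: "x > 0" for x
  proof (rule antisym)
    show "theta \<omega> x \<le> 0" unfolding theta_def by (rule SUP_least) (use z x in \<open>auto simp: zero_ereal_def\<close>)
    have "ereal (\<omega> 0 - 0 / x) \<le> theta \<omega> x" unfolding theta_def by (rule SUP_upper) simp
    then show "0 \<le> theta \<omega> x" using modulus_rules(1) by (simp add: zero_ereal_def)
  qed
  have "recip_integral (theta \<omega>) a = \<infinity>" if "a > 0" for a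
  proof -
    have "recip_integral (theta \<omega>) a = (\<integral>\<^sup>+x. \<infinity> * indicator {0<..<a} x \<partial>lborel)"
      unfolding recip_integral_def
      by (rule nn_integral_cong) (auto simp: th divide_ereal_def infinity_ennreal_def split: split_indicator)
    also have "\<dots> = \<infinity> * ennreal a" using that by (subst nn_integral_cmult_indicator) auto
    also have "\<dots> = \<infinity>" using that by (simp add: ennreal_top_mult)
    finally show ?thesis .
  qed
  moreover have "\<exists>a>0. recip_integral (theta \<omega>) a < \<infinity>"
    using fin unfolding eventually_at_right[OF zero_less_one] by (metis dense)
  ultimately show False by auto
qed

text \<open>
  The sequence \<open>stage cnt\<close> takes the value $0$ for \<open>cnt 0\<close> times, then $1$ for \<open>cnt 1\<close> times,
  and so on.
\<close>

definition stage :: "(nat \<Rightarrow> nat) \<Rightarrow> nat \<Rightarrow> nat" where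
  "stage cnt k = (LEAST n. k < sum cnt {..n})"

lemma stage_eq:
  assumes "sum cnt {..<n} \<le> k" "k < sum cnt {..n}"
  shows "stage cnt k = n"
  unfolding stage_def
proof (rule Least_equality)
  fix m assume m: "k < sum cnt {..m}"
  show "n \<le> m"
  proof (rule ccontr)
    assume "\<not> n \<le> m"
    then have "sum cnt {..m} \<le> sum cnt {..<n}" by (intro sum_mono2) auto
    then show False using m assms by simp
  qed
qed fact

lemma sum_stage:
  "(\<Sum>k\<in>{sum cnt {..<n}..<sum cnt {..n}}. f (stage cnt k)) = real (cnt n) * (f n :: real)"
proof -
  have "(\<Sum>k\<in>{sum cnt {..<n}..<sum cnt {..n}}. f (stage cnt k)) = (\<Sum>k\<in>{sum cnt {..<n}..<sum cnt {..n}}. f n)"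
    by (rule sum.cong) (auto simp: stage_eq)
  also have "\<dots> = real (sum cnt {..n} - sum cnt {..<n}) * f n" by simp
  also have "sum cnt {..n} - sum cnt {..<n} = cnt n" by (simp add: lessThan_Suc_atMost[symmetric])
  finally show ?thesis .
qed

lemma sum_stages:
  "(\<Sum>k<sum cnt {..<n}. f (stage cnt k)) = (\<Sum>i<n. real (cnt i) * (f i :: real))"
proof (induction n)
  case (Suc n)
  have "{..<sum cnt {..<Suc n}} = {..<sum cnt {..<n}} \<union> {sum cnt {..<n}..<sum cnt {..n}}"
    by (auto simp: lessThan_Suc_atMost[symmetric])
  moreover have "{..<sum cnt {..<n}} \<inter> {sum cnt {..<n}..<sum cnt {..n}} = {}" by auto
  ultimately have "(\<Sum>k<sum cnt {..<Suc n}. f (stage cnt k)) = (\<Sum>k<sum cnt {..<n}. f (stage cnt k)) + (\<Sum>k\<in>{sum cnt {..<n}..<sum cnt {..n}}. f (stage cnt k))"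
    by (metis finite_atLeastLessThan finite_lessThan sum.union_disjoint)
  then show ?case using Suc sum_stage[of f cnt n] by simp
qed simp

text \<open>The partial sums are integrals of step functions that lie below 1 / \<theta> and live on
  the disjoint intervals from \<open>\<psi> (Suc n)\<close> to \<open>\<psi> n\<close> inside (0,
  a).\<close>

lemma recip_integral_lower:
  assumes fin: "recip_integral \<theta> a < \<infinity>"
    and dec: "\<And>n. \<psi> (Suc n) \<le> \<psi> n" "\<And>n. 0 < \<psi> n" and \<psi>a: "\<psi> 0 \<le> a"
    and c: "\<And>n. 0 \<le> c n" "\<And>n x. \<psi> (Suc n) < x \<Longrightarrow> x < \<psi> n \<Longrightarrow> ennreal (c n) \<le> e2ennreal (1 / \<theta> x)"
  shows "summable (\<lambda>n. c n * (\<psi> n - \<psi> (Suc n)))"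
proof (rule summableI_nonneg_bounded)
  define A where "A = (\<lambda>n. {\<psi> (Suc n)<..<\<psi> n})"
  have mono: "\<psi> n \<le> \<psi> m" if "m \<le> n" for m n
    by (rule lift_Suc_antimono_le[of \<psi>, OF dec(1) that])
  fix N
  show "0 \<le> c N * (\<psi> N - \<psi> (Suc N))" using c dec by simp
  have pt: "(\<Sum>n<N. ennreal (c n) * indicator (A n) x) \<le> e2ennreal (1 / \<theta> x) * indicator {0<..<a} x" for x
  proof (cases "\<exists>n<N. x \<in> A n")
    case True
    then obtain n where n: "n < N" "x \<in> A n" by blast
    have "x \<notin> A k" if "k \<noteq> n" for k
    proof (cases "k < n")
      case True
      then have "\<psi> n \<le> \<psi> (Suc k)" by (intro mono) auto
      then show ?thesis using n by (auto simp: A_def)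
    next
      case False
      then have "\<psi> k \<le> \<psi> (Suc n)" using that by (intro mono) auto
      then show ?thesis using n by (auto simp: A_def)
    qed
    then have "(\<Sum>k<N. ennreal (c k) * indicator (A k) x) = (\<Sum>k<N. if k = n then ennreal (c n) else 0)"
      using n by (intro sum.cong) auto
    also have "\<dots> = ennreal (c n)" using n by simp
    also have "\<dots> \<le> e2ennreal (1 / \<theta> x)" using c(2) n by (auto simp: A_def)
    also have "\<dots> = e2ennreal (1 / \<theta> x) * indicator {0<..<a} x"
    proof -
      have "x < a" using n mono[of 0 n] \<psi>a by (auto simp: A_def)
      moreover have "0 < x" using n dec(2)[of "Suc n"] by (auto simp: A_def)
      ultimately show ?thesis by simp
    qed
    finally show ?thesis .
  next
    case False
    then have "(\<Sum>n<N. ennreal (c n) * indicator (A n) x) = 0" by (intro sum.neutral) auto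
    then show ?thesis by simp
  qed
  have "ennreal (\<Sum>n<N. c n * (\<psi> n - \<psi> (Suc n))) = (\<Sum>n<N. ennreal (c n) * emeasure lborel (A n))"
    using c dec by (simp add: A_def sum_ennreal[symmetric] ennreal_mult)
  also have "\<dots> = (\<integral>\<^sup>+x. (\<Sum>n<N. ennreal (c n) * indicator (A n) x) \<partial>lborel)"
    by (subst nn_integral_sum) (auto simp: A_def nn_integral_cmult_indicator)
  also have "\<dots> \<le> recip_integral \<theta> a" unfolding recip_integral_def by (rule nn_integral_mono) (rule pt)
  also have "\<dots> = ennreal (enn2real (recip_integral \<theta> a))" using fin by simp
  finally show "(\<Sum>n<N. c n * (\<psi> n - \<psi> (Suc n))) \<le> enn2real (recip_integral \<theta> a)"
    by (simp add: ennreal_le_iff)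
qed

text \<open>The doubling condition makes \<psi> decay geometrically, so \<open>\<psi> n\<close> is
  at most a constant times \<open>\<psi> n - \<psi> (Suc n)\<close>. Between these two scales
  \<theta> is, for large n, at most a multiple of \<open>\<omega> (\<delta> n)\<close>. The series
  is thus dominated by a lower sum of the integral of 1 / \<theta>.\<close>

lemma dyadic_summable:
  assumes m: "modulus \<omega>" and fin: "\<forall>\<^sub>F a in at_right 0. recip_integral (theta \<omega>) a < \<infinity>"
    and wpos: "\<And>r. r > 0 \<Longrightarrow> \<omega> r > 0"
    and c: "0 < c" "c < 1" and D: "D > 0" and dbl: "\<And>\<delta>. 0 < \<delta> \<Longrightarrow> \<delta> \<le> D \<Longrightarrow> \<omega> (2 * \<delta>) \<le> 2 * c * \<omega> \<delta>"
  defines "\<delta> \<equiv> \<lambda>n::nat. D / 2 ^ n" and "\<psi> \<equiv> \<lambda>n::nat. (D / 2 ^ n) / \<omega> (D / 2 ^ n)"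
  shows "summable (\<lambda>n. \<psi> n / \<omega> (\<delta> n))"
proof -
  note modulus_rules = modulus_simps[OF m]
  have \<delta>: "\<delta> n > 0" "\<delta> n = 2 * \<delta> (Suc n)" "\<delta> n \<le> D" for n using D by (auto simp: \<delta>_def field_simps)
  have \<omega>p: "\<omega> (\<delta> n) > 0" for n using wpos \<delta>(1) by blast
  have \<psi>_eq: "\<psi> n = \<delta> n / \<omega> (\<delta> n)" for n by (simp add: \<psi>_def \<delta>_def)
  have \<psi>: "\<psi> n > 0" for n unfolding \<psi>_eq using \<delta>(1) \<omega>p by simp
  have dec: "\<psi> (Suc n) \<le> c * \<psi> n" for n
  proof -
    have "\<omega> (\<delta> n) \<le> 2 * c * \<omega> (\<delta> (Suc n))" using dbl[of "\<delta> (Suc n)"] \<delta>[of n] \<delta>[of "Suc n"] by simp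
    then have "\<delta> (Suc n) * \<omega> (\<delta> n) \<le> c * \<delta> n * \<omega> (\<delta> (Suc n))"
      using mult_left_mono[of "\<omega> (\<delta> n)" "2 * c * \<omega> (\<delta> (Suc n))" "\<delta> (Suc n)"] \<delta>(1)[of "Suc n"] \<delta>(2)[of n] by (simp add: mult_ac)
    then show ?thesis unfolding \<psi>_eq using \<omega>p[of n] \<omega>p[of "Suc n"] by (simp add: field_simps)
  qed
  have decp: "\<psi> (n + k) \<le> c ^ k * \<psi> n" for n k
  proof (induction k)
    case (Suc k)
    have "\<psi> (n + Suc k) \<le> c * \<psi> (n + k)" using dec[of "n + k"] by simp
    also have "\<dots> \<le> c * (c ^ k * \<psi> n)" using Suc c by (intro mult_left_mono) auto
    finally show ?case by simp
  qed simp
  have dec1: "\<psi> (Suc n) \<le> \<psi> n" for n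
  proof -
    have "c * \<psi> n \<le> 1 * \<psi> n" using c \<psi>[of n] by (intro mult_right_mono) auto
    then show ?thesis using dec[of n] by simp
  qed
  \<comment> \<open>P dyadic steps shrink \<psi> by at least the factor 2, which absorbs the 2 in
    \<open>modulus_linear_upper\<close>: for x \<le> \<open>\<psi> (n + P)\<close> no r >
    \<open>\<delta> n\<close> makes \<omega> r - r / x positive.\<close>
  obtain P where P: "c ^ P < 1 / 2" using real_arch_pow_inv[of "1/2" c] c by auto
  have \<omega>P: "\<omega> (\<delta> n) \<le> 2 ^ k * \<omega> (\<delta> (n + k))" for n k
  proof (induction k)
    case (Suc k)
    have "\<omega> (\<delta> (n + k)) \<le> \<omega> (\<delta> (n + Suc k)) + \<omega> (\<delta> (n + Suc k))"
      using modulus_rules(4)[of "\<delta> (n + Suc k)" "\<delta> (n + Suc k)"] \<delta>(1)[of "n + Suc k"] \<delta>(2)[of "n + k"] by simp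
    then have "2 ^ k * \<omega> (\<delta> (n + k)) \<le> 2 ^ k * (2 * \<omega> (\<delta> (n + Suc k)))" by (intro mult_left_mono) auto
    from order_trans[OF Suc.IH this] show ?case by (simp add: mult_ac)
  qed simp
  have theta: "theta \<omega> x \<le> ereal (2 ^ P * \<omega> (\<delta> (n + P)))" if x: "0 < x" "x \<le> \<psi> (n + P)" for x n
    unfolding theta_def
  proof (rule SUP_least)
    fix r :: real assume r: "r \<in> {0..}"
    show "ereal (\<omega> r - r / x) \<le> ereal (2 ^ P * \<omega> (\<delta> (n + P)))"
    proof (cases "r \<le> \<delta> n")
      case True
      then have "\<omega> r \<le> \<omega> (\<delta> n)" using r by (intro modulus_rules(3)) auto
      moreover have "r / x \<ge> 0" using r x by simp
      ultimately show ?thesis using \<omega>P[of n P] by simp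
    next
      case False
      then have "\<omega> r \<le> 2 * (r / \<delta> n) * \<omega> (\<delta> n)" using \<delta>(1)[of n] by (intro modulus_linear_upper[OF m]) auto
      also have "\<dots> = r * (2 / \<psi> n)" unfolding \<psi>_eq by simp
      also have "\<dots> \<le> r * (1 / x)"
      proof (intro mult_left_mono)
        have "c ^ P * \<psi> n \<le> 1 / 2 * \<psi> n" using P \<psi>[of n] by (intro mult_right_mono) auto
        then have "2 * x \<le> \<psi> n" using decp[of n P] x by linarith
        then show "2 / \<psi> n \<le> 1 / x" using x \<psi>[of n] by (simp add: field_simps)
      qed (use r in auto)
      finally have "\<omega> r - r / x \<le> 0" by simp
      also have "0 \<le> 2 ^ P * \<omega> (\<delta> (n + P))" using \<omega>p[of "n + P"] by simp
      finally show ?thesis by simp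
    qed
  qed
  obtain a where a: "a > 0" "recip_integral (theta \<omega>) a < \<infinity>"
    using fin unfolding eventually_at_right[OF zero_less_one] by (metis dense)
  obtain N where N: "P \<le> N" "\<psi> N \<le> a"
  proof -
    obtain k where k: "c ^ k < a / \<psi> P" using real_arch_pow_inv[of "a / \<psi> P" c] c a \<psi> by auto
    have "\<psi> (P + k) \<le> a" using decp[of P k] k \<psi>[of P] by (simp add: field_simps)
    then show thesis by (intro that[of "P + k"]) auto
  qed
  define cc where "cc = (\<lambda>n. 1 / (2 ^ P * \<omega> (\<delta> (n + N))))"
  have "summable (\<lambda>n. cc n * (\<psi> (n + N) - \<psi> (Suc n + N)))"
  proof (rule recip_integral_lower[OF a(2), where \<psi> = "\<lambda>n. \<psi> (n + N)"])
    show "0 \<le> cc n" for n using \<omega>p[of "n + N"] by (simp add: cc_def)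
    fix n x assume x: "\<psi> (Suc n + N) < x" "x < \<psi> (n + N)"
    have x0: "x > 0" using x(1) \<psi>[of "Suc n + N"] by linarith
    have "n + N - P + P = n + N" using N by simp
    then have th: "theta \<omega> x \<le> ereal (2 ^ P * \<omega> (\<delta> (n + N)))" using theta[OF x0, of "n + N - P"] x by simp
    have th0: "theta \<omega> x \<ge> 0"
    proof -
      have "ereal (\<omega> 0 - 0 / x) \<le> theta \<omega> x" unfolding theta_def by (rule SUP_upper) simp
      then show ?thesis using modulus_rules(1) by (simp add: zero_ereal_def)
    qed
    have "ereal (cc n) \<le> 1 / theta \<omega> x"
    proof (cases "theta \<omega> x = 0")
      case True
      then show ?thesis by (simp add: divide_ereal_def)
    next
      case False
      then have "theta \<omega> x > 0" using th0 by simp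
      then have "1 / ereal (2 ^ P * \<omega> (\<delta> (n + N))) \<le> 1 / theta \<omega> x"
        using th \<omega>p[of "n + N"] by (intro ereal_divide_left_mono) (auto simp: ereal_zero_less_0_iff)
      then show ?thesis using \<omega>p[of "n + N"] by (simp add: cc_def one_ereal_def)
    qed
    then show "ennreal (cc n) \<le> e2ennreal (1 / theta \<omega> x)"
      using e2ennreal_mono by (metis e2ennreal_ereal)
  qed (use dec1 \<psi> N in auto)
  then have "summable (\<lambda>n. (2 ^ P / (1 - c)) * (cc n * (\<psi> (n + N) - \<psi> (Suc n + N))))" by (rule summable_mult)
  then have "summable (\<lambda>n. \<psi> (n + N) / \<omega> (\<delta> (n + N)))"
  proof (rule summable_comparison_test_ev[rotated], intro always_eventually allI)
    fix n
    have w: "\<omega> (\<delta> (n + N)) > 0" by (rule \<omega>p)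
    have "(1 - c) * \<psi> (n + N) \<le> \<psi> (n + N) - \<psi> (Suc n + N)" using dec[of "n + N"] by (simp add: algebra_simps)
    then have "(1 - c) * \<psi> (n + N) / ((1 - c) * \<omega> (\<delta> (n + N))) \<le> (\<psi> (n + N) - \<psi> (Suc n + N)) / ((1 - c) * \<omega> (\<delta> (n + N)))"
      using w c by (intro divide_right_mono) auto
    then show "norm (\<psi> (n + N) / \<omega> (\<delta> (n + N))) \<le> (2 ^ P / (1 - c)) * (cc n * (\<psi> (n + N) - \<psi> (Suc n + N)))"
      using w c \<psi>[of "n + N"] by (simp add: cc_def)
  qed
  then show ?thesis using summable_iff_shift[of "\<lambda>n. \<psi> n / \<omega> (\<delta> n)" N] by simp
qed

text \<open>A block of length \<rho> will raise the radius by order \<rho> \<omega>(\<rho>), and its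
  tent needs a radius of order \<rho> / \<omega>(\<rho>) beforehand. Dyadic lengths are therefore
  repeated so often that each stage is paid for by the next finer one, which comes earlier in
  time.\<close>

lemma block_lengths_exist:
  assumes m: "modulus \<omega>" and fin: "\<forall>\<^sub>F a in at_right 0. recip_integral (theta \<omega>) a < \<infinity>"
    and lim: "Limsup (at_right 0) (\<lambda>\<delta>. ereal (\<omega> (2 * \<delta>) / (2 * \<omega> \<delta>))) < 1" and C: "C > 0" and w: "w > 0"
  obtains \<rho> :: "nat \<Rightarrow> real" where "\<And>k. \<rho> k > 0" "\<And>k. \<omega> (\<rho> k) \<le> w" "summable \<rho>" "suminf \<rho> \<ge> 1"
    "\<And>k. \<exists>n. C * (\<rho> k / \<omega> (\<rho> k)) \<le> (\<Sum>j\<in>{k<..n}. \<rho> j * \<omega> (\<rho> j))"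
proof -
  note modulus_rules = modulus_simps[OF m]
  have wpos: "\<omega> r > 0" if "r > 0" for r by (rule modulus_pos[OF m fin that])
  obtain c where c: "0 < c" "c < 1" "\<forall>\<^sub>F \<delta> in at_right 0. \<omega> (2 * \<delta>) / (2 * \<omega> \<delta>) < c"
  proof -
    obtain c' where c': "Limsup (at_right 0) (\<lambda>\<delta>. ereal (\<omega> (2 * \<delta>) / (2 * \<omega> \<delta>))) < ereal c'" "ereal c' < 1"
      using ereal_dense2[OF lim] by blast
    \<comment> \<open>The constant c' need not be positive, hence the maximum with 1/2.\<close>
    from Limsup_lessD[OF c'(1)] have "\<forall>\<^sub>F \<delta> in at_right 0. \<omega> (2 * \<delta>) / (2 * \<omega> \<delta>) < max c' (1/2)"
      by eventually_elim auto
    then show thesis using c'(2) by (intro that[of "max c' (1/2)"]) auto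
  qed
  have "(\<omega> \<longlongrightarrow> \<omega> 0) (at 0 within {0..})" using modulus_rules(5) by (auto simp: continuous_on_def)
  then have "(\<omega> \<longlongrightarrow> 0) (at_right 0)" using modulus_rules(1) by (auto intro: tendsto_within_subset)
  then have "\<forall>\<^sub>F \<delta> in at_right 0. \<omega> \<delta> < w" using w by (rule order_tendstoD)
  then have "\<forall>\<^sub>F \<delta> in at_right 0. \<omega> \<delta> < w \<and> \<omega> (2 * \<delta>) / (2 * \<omega> \<delta>) < c" using c(3) by eventually_elim simp
  then obtain d where d: "d > 0" "\<And>\<delta>. 0 < \<delta> \<Longrightarrow> \<delta> < d \<Longrightarrow> \<omega> \<delta> < w \<and> \<omega> (2 * \<delta>) / (2 * \<omega> \<delta>) < c"
    unfolding eventually_at_right[OF zero_less_one] by blast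
  define D where "D = d / 2"
  have D: "D > 0" using d by (simp add: D_def)
  have dbl: "\<omega> (2 * \<delta>) \<le> 2 * c * \<omega> \<delta>" if \<delta>: "0 < \<delta>" "\<delta> \<le> D" for \<delta>
  proof -
    have "\<omega> (2 * \<delta>) / (2 * \<omega> \<delta>) < c" using d(2)[of \<delta>] \<delta> d(1) by (simp add: D_def)
    then show ?thesis using wpos[OF \<delta>(1)] by (simp add: field_simps)
  qed
  define \<delta> where "\<delta> = (\<lambda>n::nat. D / 2 ^ n)"
  define \<psi> where "\<psi> = (\<lambda>n. \<delta> n / \<omega> (\<delta> n))"
  have \<delta>: "\<delta> n > 0" "\<delta> n = 2 * \<delta> (Suc n)" "\<delta> n \<le> D" for n using D by (auto simp: \<delta>_def field_simps)
  have \<omega>p: "\<omega> (\<delta> n) > 0" for n using wpos \<delta>(1) by blast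
  have sm: "summable (\<lambda>n. \<psi> n / \<omega> (\<delta> n))"
    using dyadic_summable[OF m fin wpos c(1,2) D dbl] unfolding \<psi>_def \<delta>_def by simp
  have \<psi>2: "\<psi> n \<le> 2 * \<psi> (Suc n)" for n
  proof -
    have "\<omega> (\<delta> (Suc n)) \<le> \<omega> (\<delta> n)" using \<delta>[of n] \<delta>(1)[of "Suc n"] by (intro modulus_rules(3)) auto
    then have "\<delta> n / \<omega> (\<delta> n) \<le> \<delta> n / \<omega> (\<delta> (Suc n))" using \<delta>(1)[of n] \<omega>p[of n] \<omega>p[of "Suc n"] by (intro divide_left_mono) auto
    also have "\<dots> = 2 * \<psi> (Suc n)" using \<delta>(2)[of n] by (simp add: \<psi>_def)
    finally show ?thesis by (simp add: \<psi>_def)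
  qed
  \<comment> \<open>\<open>u (Suc n)\<close> blocks of length \<open>\<delta> (Suc n)\<close> supply
    the amount C * \<open>\<psi> n\<close> required by stage n. Their total length is C *
    \<open>\<psi> n\<close> / \<open>\<omega> (\<delta> (Suc n))\<close>, summable since \<psi> n
    \<le> 2 * \<psi> (Suc n). The value 1 / \<delta> 0 makes stage 0 alone fill a time of at least
    1.\<close>
  define u where "u = (\<lambda>n. case n of 0 \<Rightarrow> 1 / \<delta> 0 | Suc n \<Rightarrow> C * \<psi> n / (\<delta> (Suc n) * \<omega> (\<delta> (Suc n))))"
  \<comment> \<open>Rounding up gives enough blocks, and the added 1 guarantees that every stage
    occurs, so that \<open>stage cnt k\<close> is attained for every k. The excess length is at most
    2 * \<open>\<delta> n\<close>, which is summable.\<close>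
  define cnt where "cnt = (\<lambda>n. nat \<lceil>u n\<rceil> + 1)"
  have u0: "u n \<ge> 0" for n using C \<delta>(1) \<omega>p by (auto simp: u_def \<psi>_def less_imp_le split: nat.splits)
  have cnt: "u n \<le> real (cnt n)" "real (cnt n) \<le> u n + 2" "cnt n \<ge> 1" for n
    using u0[of n] unfolding cnt_def by (auto; linarith)+
  have "summable (\<lambda>n. 2 * C * (\<psi> (Suc n) / \<omega> (\<delta> (Suc n))) + 2 * \<delta> (Suc n))"
  proof (intro summable_add summable_mult)
    show "summable (\<lambda>n. \<psi> (Suc n) / \<omega> (\<delta> (Suc n)))" 
      using sm summable_Suc_iff[of "\<lambda>n. \<psi> n / \<omega> (\<delta> n)"] by simp
    have "summable (\<lambda>n. D * (1 / 2) ^ n)" by (intro summable_mult summable_geometric) simp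
    then have "summable \<delta>" unfolding \<delta>_def by (simp add: power_one_over)
    then show "summable (\<lambda>n. \<delta> (Suc n))" 
      using summable_Suc_iff[of \<delta>] by simp
  qed
  then have "summable (\<lambda>n. real (cnt (Suc n)) * \<delta> (Suc n))"
  proof (rule summable_comparison_test_ev[rotated], intro always_eventually allI)
    fix n
    have "real (cnt (Suc n)) * \<delta> (Suc n) \<le> (u (Suc n) + 2) * \<delta> (Suc n)"
      using cnt(2)[of "Suc n"] \<delta>(1)[of "Suc n"] by (intro mult_right_mono) auto
    also have "\<dots> = C * \<psi> n / \<omega> (\<delta> (Suc n)) + 2 * \<delta> (Suc n)"
      using \<delta>(1)[of "Suc n"] \<omega>p[of "Suc n"] by (simp add: u_def field_simps)
    also have "\<dots> \<le> C * (2 * \<psi> (Suc n)) / \<omega> (\<delta> (Suc n)) + 2 * \<delta> (Suc n)"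
      using \<psi>2[of n] C \<omega>p[of "Suc n"] by (intro add_right_mono divide_right_mono mult_left_mono) auto
    finally show "norm (real (cnt (Suc n)) * \<delta> (Suc n)) \<le> 2 * C * (\<psi> (Suc n) / \<omega> (\<delta> (Suc n))) + 2 * \<delta> (Suc n)"
      using \<delta>(1)[of "Suc n"] by (simp add: mult_ac)
  qed
  then have sc: "summable (\<lambda>n. real (cnt n) * \<delta> n)" 
    using summable_Suc_iff[of "\<lambda>n. real (cnt n) * \<delta> n"] by simp
  define \<rho> where "\<rho> = (\<lambda>k. \<delta> (stage cnt k))"
  have \<rho>0: "\<rho> k > 0" for k using \<delta>(1) by (simp add: \<rho>_def)
  have Sge: "n \<le> sum cnt {..<n}" for n
  proof (induction n)
    case (Suc n) then show ?case using cnt(3)[of n] by simp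
  qed simp
  have sr: "summable \<rho>"
  proof (rule summableI_nonneg_bounded)
    fix n
    have "(\<Sum>k<n. \<rho> k) \<le> (\<Sum>k<sum cnt {..<n}. \<rho> k)"
      using Sge[of n] \<rho>0 by (intro sum_mono2) (auto simp: less_imp_le)
    also have "\<dots> = (\<Sum>i<n. real (cnt i) * \<delta> i)" unfolding \<rho>_def by (rule sum_stages)
    also have "\<dots> \<le> (\<Sum>n. real (cnt n) * \<delta> n)" using \<delta>(1) by (intro sum_le_suminf sc) (auto simp: less_imp_le)
    finally show "(\<Sum>k<n. \<rho> k) \<le> (\<Sum>n. real (cnt n) * \<delta> n)" .
    show "0 \<le> \<rho> n" using \<rho>0[of n] by simp
  qed
  show thesis
  proof (rule that[OF \<rho>0 _ sr])
    show "\<omega> (\<rho> k) \<le> w" for k using d(2)[of "\<rho> k"] \<rho>0[of k] \<delta>(3)[of "stage cnt k"] d(1) by (auto simp: \<rho>_def D_def less_imp_le)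
    have "1 \<le> real (cnt 0) * \<delta> 0" using cnt(1)[of 0] \<delta>(1)[of 0] by (simp add: u_def field_simps)
    also have "\<dots> = (\<Sum>k<sum cnt {..<Suc 0}. \<rho> k)" unfolding \<rho>_def by (subst sum_stages) simp
    also have "\<dots> \<le> suminf \<rho>" by (intro sum_le_suminf sr) (auto simp: less_imp_le \<rho>0)
    finally show "1 \<le> suminf \<rho>" .
    fix k
    define n where "n = stage cnt k"
    have "\<exists>n. k < sum cnt {..n}" using Sge[of "Suc k"] by (intro exI[of _ k]) (simp add: lessThan_Suc_atMost)
    then have kn: "k < sum cnt {..n}" unfolding n_def stage_def by (rule LeastI_ex)
    have "C * (\<rho> k / \<omega> (\<rho> k)) = u (Suc n) * (\<delta> (Suc n) * \<omega> (\<delta> (Suc n)))"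
      using \<delta>(1)[of "Suc n"] \<omega>p[of "Suc n"] by (simp add: u_def \<rho>_def n_def \<psi>_def)
    also have "\<dots> \<le> real (cnt (Suc n)) * (\<delta> (Suc n) * \<omega> (\<delta> (Suc n)))"
      using cnt(1)[of "Suc n"] \<delta>(1)[of "Suc n"] \<omega>p[of "Suc n"] by (intro mult_right_mono) auto
    also have "\<dots> = (\<Sum>j\<in>{sum cnt {..<Suc n}..<sum cnt {..Suc n}}. \<rho> j * \<omega> (\<rho> j))"
      unfolding \<rho>_def by (rule sum_stage[of "\<lambda>n. \<delta> n * \<omega> (\<delta> n)", symmetric])
    also have "\<dots> \<le> (\<Sum>j\<in>{k<..sum cnt {..Suc n}}. \<rho> j * \<omega> (\<rho> j))"
      using kn \<rho>0 wpos by (intro sum_mono2) (auto simp: lessThan_Suc_atMost less_imp_le intro!: mult_nonneg_nonneg)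
    finally show "\<exists>n. C * (\<rho> k / \<omega> (\<rho> k)) \<le> (\<Sum>j\<in>{k<..n}. \<rho> j * \<omega> (\<rho> j))" by blast
  qed
qed

section \<open>A driving path with two solutions\<close>

lemma refl_sol_shift:
  assumes sol: "refl_sol a b lam p q K" and eq: "\<And>t. t \<in> {a..b} \<Longrightarrow> K t = K' t - c"
  shows "refl_sol a b lam p q K'"
proof -
  have eq': "K' t = K t + c" if "t \<in> {a..b}" for t using eq[OF that] by simp
  have "mono_on {a..b} K'" using sol by (auto simp: refl_sol_def mono_on_def eq')
  moreover have "continuous_on {a..b} (\<lambda>t. K t + c)" using sol by (auto simp: refl_sol_def intro!: continuous_intros)
  then have "continuous_on {a..b} K'" by (rule continuous_on_eq) (simp add: eq')
  moreover have "incr a b K' f \<alpha> \<beta>" if "incr a b K f \<alpha> \<beta>" for f \<alpha> \<beta>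
    using that unfolding incr_def by (elim negligible_cong[OF negligible_congK]) (simp_all add: eq')
  moreover have "K' s = K' t" if st: "a \<le> s \<and> s \<le> t \<and> t \<le> b \<and> (\<forall>u\<in>{s..t}. exp (lam u) * p u + exp (- lam u) * q u > 0)" for s t
  proof -
    have "K s = K t" using sol st unfolding refl_sol_def by blast
    then show ?thesis using eq'[of s] eq'[of t] st by simp
  qed
  ultimately show ?thesis using sol unfolding refl_sol_def by blast
qed

text \<open>Since dp = exp(- lam)(dK - dt) with exp(- lam) bounded below and p bounded, K stays
  bounded as t decreases to 0. Its infimum over (0,1) becomes the value at 0.\<close>

lemma refl_sol_extend_0:
  assumes lam: "continuous_on {0..1} lam" and cp: "continuous_on {0..1} p"
    and sol: "\<And>a. 0 < a \<Longrightarrow> a < 1 \<Longrightarrow> refl_sol a 1 lam p q K"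
  shows "\<exists>K'. mono_on {0..1} K' \<and> continuous_on {0..1} K' \<and> (\<forall>a. 0 < a \<and> a < 1 \<longrightarrow> refl_sol a 1 lam p q K')"
proof -
  obtain B where B: "\<And>t. t \<in> {0..1} \<Longrightarrow> \<bar>lam t\<bar> \<le> B" using continuous_abs_bound[OF lam] by blast
  obtain P where P: "\<And>t. t \<in> {0..1} \<Longrightarrow> \<bar>p t\<bar> \<le> P" using continuous_abs_bound[OF cp] by blast
  have Km: "K s \<le> K t" if "0 < s" "s \<le> t" "t \<le> 1" for s t
  proof (cases "s = 1")
    case False
    then show ?thesis using sol[of s] that by (auto simp: refl_sol_def mono_on_def)
  qed (use that in auto)
  have low: "K 1 - exp B * (2 * P + exp B) \<le> K a" if a: "0 < a" "a < 1" for a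
  proof -
    have mK: "mono_on {a..1} K" and D: "incr a 1 K p (\<lambda>t. - exp (- lam t)) (\<lambda>t. exp (- lam t))"
      using sol[OF a] by (auto simp: refl_sol_def)
    have lB: "exp (- B) \<le> exp (- lam t)" "exp (- lam t) \<le> exp B" if "t \<in> {a..1}" for t
      using B[of t] that a by auto
    have "mono_on {a..1} (\<lambda>t. (p t + exp B * t) - exp (- B) * K t)"
      by (rule incr_mono[OF incr_diff[OF incr_add[OF D incr_cmult[OF incr_id[OF mK]]] incr_cmult[OF incr_K[OF mK]]] mK])
        (use lB in auto)
    then have "(p a + exp B * a) - exp (- B) * K a \<le> (p 1 + exp B * 1) - exp (- B) * K 1"
      by (rule mono_onD) (use a in auto)
    then have "exp (- B) * (K 1 - K a) \<le> p 1 - p a + exp B * (1 - a)" by (simp add: algebra_simps)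
    also have "\<dots> \<le> 2 * P + exp B * 1" using P[of 1] P[of a] a by (intro add_mono mult_left_mono) auto
    finally have "exp B * (exp (- B) * (K 1 - K a)) \<le> exp B * (2 * P + exp B)" by simp
    moreover have "exp B * (exp (- B) * (K 1 - K a)) = K 1 - K a" by (simp add: exp_minus)
    ultimately show ?thesis by simp
  qed
  have bd: "bdd_below (K ` {0<..<1})" by (rule bdd_belowI2[of _ "K 1 - exp B * (2 * P + exp B)"]) (use low in auto)
  define k0 where "k0 = Inf (K ` {0<..<1})"
  have k0: "k0 \<le> K t" if "0 < t" "t \<le> 1" for t
  proof -
    have "k0 \<le> K (t / 2)" unfolding k0_def by (rule cInf_lower[OF _ bd]) (use that in auto)
    also have "\<dots> \<le> K t" by (rule Km) (use that in auto)
    finally show ?thesis .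
  qed
  define K' where "K' = (\<lambda>t. if t \<le> 0 then k0 else K t)"
  have sol': "refl_sol a 1 lam p q K'" if "0 < a" "a < 1" for a
    by (rule refl_sol_shift[OF sol[OF that], of K' 0]) (use that in \<open>auto simp: K'_def\<close>)
  have "mono_on {0..1} K'" by (rule mono_onI) (use k0 Km in \<open>auto simp: K'_def\<close>)
  moreover have "continuous_on {0..1} K'"
  proof (rule continuous_on_Icc_one_sided)
    have cK': "continuous_on {a..1} K'" if "0 < a" "a < 1" for a using sol'[OF that] by (simp add: refl_sol_def)
    show "(K' \<longlongrightarrow> K' t) (at_left t)" if t: "0 < t" "t \<le> 1" for t
      using continuous_on_at_left[OF cK'[of "t/2"]] t by simp
    show "(K' \<longlongrightarrow> K' t) (at_right t)" if t: "0 \<le> t" "t < 1" for t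
    proof (cases "t = 0")
      case False
      then show ?thesis using continuous_on_at_right[OF cK' order_refl] t by simp
    next
      case True
      have "(K' \<longlongrightarrow> k0) (at_right 0)"
      proof (rule order_tendstoI)
        fix y assume "y < k0"
        then show "\<forall>\<^sub>F u in at_right 0. y < K' u"
          by (intro eventually_at_rightI[of 0 1]) (use k0 in \<open>auto simp: K'_def intro: less_le_trans\<close>)
      next
        fix y assume "k0 < y"
        then obtain u where u: "0 < u" "u < 1" "K u < y" unfolding k0_def using cInf_less_iff[OF _ bd, of y] by auto
        then show "\<forall>\<^sub>F v in at_right 0. K' v < y"
        proof (intro eventually_at_rightI[of 0 u])
          show "K' v < y" if "v \<in> {0<..<u}" for v using Km[of v u] that u by (simp add: K'_def)
        qed (use u in auto)
      qed
      then show ?thesis using True by (simp add: K'_def)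
    qed
  qed simp
  ultimately show ?thesis using sol' by blast
qed

lemma sinh_ge_self: "0 \<le> x \<Longrightarrow> x \<le> sinh (x :: real)"
  using DERIV_nonneg_imp_nondecreasing[of 0 x "\<lambda>x. sinh x - x"]
  by (force intro!: derivative_eq_intros exI simp: cosh_real_ge_1)

definition clip :: "real \<Rightarrow> real \<Rightarrow> real" where "clip c x = max 0 (min c x)"

lemma clip_simps:
  "x \<le> 0 \<Longrightarrow> 0 \<le> c \<Longrightarrow> clip c x = 0" "0 \<le> x \<Longrightarrow> x \<le> c \<Longrightarrow> clip c x = x" "0 \<le> c \<Longrightarrow> c \<le> x \<Longrightarrow> clip c x = c"
  by (auto simp: clip_def)

lemma clip_mono: "x \<le> y \<Longrightarrow> clip c x \<le> clip c y" by (auto simp: clip_def)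

lemma clip_lip: "\<bar>clip c x - clip c y\<bar> \<le> \<bar>x - y\<bar>" by (auto simp: clip_def max_def min_def)

text \<open>
  The blocks $[t_{k+1},t_k]$ have length $\rho_k$ and accumulate at $0$. The angle is a tent on the
  first two thirds of a block and vanishes on the last third, where \<open>L\<close> grows linearly at the
  rate \<open>s k\<close> that makes \<open>lam\<close> vanish at the ends of all blocks. The growth condition gives
  $\cosh\varphi/R \le$ \<open>sl k\<close>, the slope of the tent.
\<close>

locale zigzag =
  fixes \<omega> :: "real \<Rightarrow> real" and \<rho> :: "nat \<Rightarrow> real"
  assumes mod: "modulus \<omega>" and \<omega>pos: "\<And>r. r > 0 \<Longrightarrow> \<omega> r > 0"
    and \<rho>: "\<And>k. \<rho> k > 0" and \<rho>small: "\<And>k. \<omega> (\<rho> k) \<le> 60" and sum\<rho>: "summable \<rho>" "suminf \<rho> \<ge> 1"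
    and growth: "\<And>k. \<exists>n. 14400 * (\<rho> k / \<omega> (\<rho> k)) \<le> (\<Sum>j\<in>{k<..n}. \<rho> j * \<omega> (\<rho> j))"
begin

lemmas modulus_rules = modulus_simps[OF mod]

definition tm :: "nat \<Rightarrow> real" where "tm k = (\<Sum>j. \<rho> (j + k))"
definition r :: "nat \<Rightarrow> real" where "r k = \<rho> k / 3"
definition sl :: "nat \<Rightarrow> real" where "sl k = \<omega> (\<rho> k) / (20 * \<rho> k)"
definition tent :: "nat \<Rightarrow> real \<Rightarrow> real" where "tent j t = max 0 (min (t - tm (Suc j)) (tm j - r j - t))"
definition \<phi> :: "real \<Rightarrow> real" where "\<phi> t = (\<Sum>j. sl j * tent j t)"
definition R :: "real \<Rightarrow> real" where "R t = integral {0..t} (\<lambda>u. sinh (\<phi> u))"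
definition g :: "real \<Rightarrow> real" where "g t = cosh (\<phi> t) / R t"
definition T :: real where "T = tm 0"
definition s :: "nat \<Rightarrow> real" where "s j = integral {tm (Suc j)..tm j} g / r j"
text \<open>Counted backwards from T, where it is 0, so that at each t > 0 only finitely many blocks
  contribute; convergence of the growth accumulated since time 0 is never asked for.\<close>

definition L :: "real \<Rightarrow> real" where "L t = - (\<Sum>j. s j * clip (r j) (tm j - t))"
text \<open>The drift is integrated from t to T, away from time 0, where R = 0 and g need not be
  integrable. The value 0 at time 0 matches that at all ends of blocks.\<close>

definition lam :: "real \<Rightarrow> real" where "lam t = (if t \<le> 0 then 0 else \<phi> t - integral {t..T} g - L t)"

section \<open>Geometry of the blocks and of the tents\<close>

lemma tm_Suc: "tm k = \<rho> k + tm (Suc k)"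
  using suminf_split_head[of "\<lambda>j. \<rho> (j + k)"] sum\<rho>(1) by (simp add: tm_def summable_iff_shift)

lemma r_pos: "r k > 0" using \<rho>[of k] by (simp add: r_def)

lemma sl_pos: "sl k > 0" using \<rho>[of k] \<omega>pos[OF \<rho>[of k]] by (simp add: sl_def)

lemma tm_r: "tm k = tm (Suc k) + 3 * r k" using tm_Suc[of k] by (simp add: r_def)

lemma tm_pos: "tm k > 0"
  unfolding tm_def by (rule suminf_pos) (use sum\<rho> \<rho> in \<open>auto simp: summable_iff_shift\<close>)

lemma tm_Suc_less: "tm (Suc k) < tm k" using tm_Suc[of k] \<rho>[of k] by simp

lemma tm_antimono: "m \<le> n \<Longrightarrow> tm n \<le> tm m"
  by (rule lift_Suc_antimono_le[of tm]) (use tm_Suc_less in \<open>auto simp: less_imp_le\<close>)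

lemma tm_lim: "tm \<longlonglongrightarrow> 0"
proof -
  have "tm = (\<lambda>k. suminf \<rho> - (\<Sum>j<k. \<rho> j))" unfolding tm_def by (intro ext suminf_minus_initial_segment[OF sum\<rho>(1)])
  moreover have "(\<lambda>k. suminf \<rho> - (\<Sum>j<k. \<rho> j)) \<longlonglongrightarrow> suminf \<rho> - suminf \<rho>"
    by (intro tendsto_intros summable_LIMSEQ sum\<rho>)
  ultimately show ?thesis by simp
qed

lemma T_ge: "1 \<le> T" using sum\<rho>(2) by (simp add: T_def tm_def)

lemma tm_below: assumes "t > 0" obtains n where "tm n < t"
proof -
  have "\<forall>\<^sub>F n in sequentially. tm n < t" using order_tendstoD(2)[OF tm_lim assms] .
  then show thesis using that by (auto simp: eventually_sequentially)
qed

lemma block_of: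
  assumes t: "0 < t" "t \<le> T"
  obtains k where "tm (Suc k) < t" "t \<le> tm k"
proof -
  define n where "n = (LEAST n. tm n < t)"
  obtain m where "tm m < t" using tm_below[OF t(1)] .
  then have n: "tm n < t" unfolding n_def by (rule LeastI)
  then obtain k where k: "n = Suc k" using t by (cases n) (auto simp: T_def)
  have "\<not> tm k < t" using not_less_Least[of k "\<lambda>n. tm n < t"] k unfolding n_def by auto
  then show thesis using that n k by auto
qed

lemma tent_zero:
  "t \<le> tm (Suc j) \<Longrightarrow> tent j t = 0" "tm j - r j \<le> t \<Longrightarrow> tent j t = 0"
  by (auto simp: tent_def)

lemma tent_nonneg: "0 \<le> tent j t" by (simp add: tent_def)

lemma \<phi>_sum:
  assumes "tm n \<le> t" shows "\<phi> t = (\<Sum>j<n. sl j * tent j t)"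
  unfolding \<phi>_def
proof (rule suminf_finite)
  fix j assume "j \<notin> {..<n}"
  then have "tm j \<le> t" using tm_antimono[of n j] assms by auto
  then show "sl j * tent j t = 0" using tent_zero(2)[of j t] r_pos[of j] by simp
qed simp

lemma \<phi>_block:
  assumes t: "tm (Suc k) \<le> t" "t \<le> tm k"
  shows "\<phi> t = sl k * tent k t"
proof -
  have "sl j * tent j t = 0" if "j < k" for j
    using tent_zero(1)[of t j] tm_antimono[of "Suc j" k] that t by simp
  then have "(\<Sum>j<k. sl j * tent j t) = 0" by (intro sum.neutral) auto
  then show ?thesis using \<phi>_sum[OF t(1)] by simp
qed

lemma \<phi>_neg: "t \<le> 0 \<Longrightarrow> \<phi> t = 0"
proof -
  assume t: "t \<le> 0"
  have "tent j t = 0" for j using tent_zero(1)[of t j] tm_pos[of "Suc j"] t by linarith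
  then show ?thesis by (simp add: \<phi>_def)
qed

lemma \<phi>_tm: "\<phi> (tm k) = 0"
  using \<phi>_block[of k "tm k"] tm_Suc_less[of k] tent_zero(2)[of k "tm k"] r_pos[of k] by simp

text \<open>\<open>modulus_linear_upper\<close> costs a factor 2, which leaves 10 of the 20 in the
  definition of \<open>sl\<close>.\<close>

lemma sl_modulus:
  assumes "0 \<le> d" "d \<le> \<rho> k" shows "10 * sl k * d \<le> \<omega> d"
proof (cases "d = 0")
  case False
  then have d: "0 < d" using assms by simp
  have "\<omega> (\<rho> k) \<le> 2 * (\<rho> k / d) * \<omega> d" by (rule modulus_linear_upper[OF mod d assms(2)])
  then show ?thesis using d \<rho>[of k] by (simp add: sl_def field_simps)
qed (simp add: modulus_rules)

text \<open>The bound by \<omega> t gives continuity at 0, the bound by 1 controls cosh \<phi>; the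
  latter holds because \<open>sl k * r k\<close> is \<omega>(\<rho> k) / 60.\<close>

lemma \<phi>_bounds:
  assumes t: "0 \<le> t" "t \<le> T"
  shows "0 \<le> \<phi> t" "\<phi> t \<le> \<omega> t" "\<phi> t \<le> 1"
proof -
  have "0 \<le> \<phi> t \<and> \<phi> t \<le> \<omega> t \<and> \<phi> t \<le> 1"
  proof (cases "t = 0")
    case True then show ?thesis using \<phi>_neg[of 0] modulus_rules(1) by simp
  next
    case False
    then obtain k where k: "tm (Suc k) < t" "t \<le> tm k" using block_of[of t] t by auto
    have ph: "\<phi> t = sl k * tent k t" using \<phi>_block k by simp
    define d where "d = t - tm (Suc k)"
    have d: "0 \<le> d" "d \<le> \<rho> k" using k tm_Suc[of k] by (auto simp: d_def)
    have "tent k t \<le> d" using k by (auto simp: tent_def d_def)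
    then have 1: "\<phi> t \<le> sl k * d" using sl_pos[of k] by (simp add: ph)
    have "10 * (sl k * d) \<le> \<omega> d" using sl_modulus[OF d] by simp
    moreover have "0 \<le> sl k * d" using sl_pos[of k] d by simp
    moreover have "\<omega> d \<le> \<omega> t" using d tm_pos[of "Suc k"] by (intro modulus_rules(3)) (auto simp: d_def)
    moreover have "sl k * d \<le> sl k * \<rho> k" using d sl_pos[of k] by (intro mult_left_mono) auto
    moreover have "sl k * \<rho> k \<le> 3" using \<rho>[of k] \<rho>small[of k] by (simp add: sl_def)
    moreover have "tent k t \<le> r k" using tm_r[of k] by (auto simp: tent_def max_def min_def r_pos less_imp_le)
    then have "\<phi> t \<le> sl k * r k" using sl_pos[of k] by (simp add: ph)
    moreover have "sl k * r k \<le> 1" using \<rho>[of k] \<rho>small[of k] by (simp add: sl_def r_def)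
    moreover have "0 \<le> \<phi> t" using sl_pos[of k] tent_nonneg[of k t] by (simp add: ph)
    ultimately show ?thesis using 1 by linarith
  qed
  then show "0 \<le> \<phi> t" "\<phi> t \<le> \<omega> t" "\<phi> t \<le> 1" by auto
qed

lemma cont_\<phi>_pos: "0 < a \<Longrightarrow> continuous_on {a..} \<phi>"
proof -
  assume "0 < a"
  then obtain n where n: "tm n < a" using tm_below by blast
  have "continuous_on {a..} (\<lambda>t. \<Sum>j<n. sl j * tent j t)" unfolding tent_def by (intro continuous_intros)
  then show ?thesis by (rule continuous_on_eq) (use n in \<open>auto intro!: \<phi>_sum[symmetric]\<close>)
qed

lemma cont_\<phi>: "continuous_on {0..T} \<phi>"
proof (rule continuous_on_Icc_one_sided)
  have pos: "isCont \<phi> t" if "t > 0" for t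
    using continuous_on_interior[OF cont_\<phi>_pos[of "t/2"], of t] that by simp
  show "(\<phi> \<longlongrightarrow> \<phi> t) (at_left t)" if "0 < t" for t
    using pos[OF that] by (auto simp: isCont_def intro: tendsto_within_subset)
  show "(\<phi> \<longlongrightarrow> \<phi> t) (at_right t)" if t: "0 \<le> t" for t
  proof (cases "t = 0")
    case True
    have "(\<omega> \<longlongrightarrow> \<omega> 0) (at 0 within {0..})" using modulus_rules(5) by (auto simp: continuous_on_def)
    then have "(\<omega> \<longlongrightarrow> 0) (at_right 0)" using modulus_rules(1) by (auto intro: tendsto_within_subset)
    moreover have "\<forall>\<^sub>F u in at_right 0. norm (\<phi> u) \<le> \<omega> u"
      by (rule eventually_at_rightI[of 0 T]) (use \<phi>_bounds T_ge in auto)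
    ultimately have "(\<phi> \<longlongrightarrow> 0) (at_right 0)" by (rule Lim_null_comparison[rotated])
    then show ?thesis using True \<phi>_neg[of 0] by simp
  next
    case False
    then show ?thesis using pos[of t] t by (auto simp: isCont_def intro: tendsto_within_subset)
  qed
qed (use T_ge in auto)

section \<open>Growth of the radius\<close>

lemma cont_sinh: "continuous_on {0..T} (\<lambda>u. sinh (\<phi> u))"
  by (intro continuous_intros cont_\<phi>)

lemma R_diff: "0 \<le> u \<Longrightarrow> u \<le> t \<Longrightarrow> t \<le> T \<Longrightarrow> R t - R u = integral {u..t} (\<lambda>u. sinh (\<phi> u))"
  unfolding R_def by (rule integral_diff_cont[OF cont_sinh])

lemma R_0: "R 0 = 0" by (simp add: R_def)

lemma cont_R: "continuous_on {0..T} R"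
  unfolding R_def by (intro indefinite_integral_continuous_1 integrable_continuous_interval cont_sinh)

lemma R_mono: "0 \<le> u \<Longrightarrow> u \<le> t \<Longrightarrow> t \<le> T \<Longrightarrow> R u \<le> R t"
proof -
  assume ut: "0 \<le> u" "u \<le> t" "t \<le> T"
  have "0 \<le> integral {u..t} (\<lambda>u. sinh (\<phi> u))"
    using ut \<phi>_bounds(1) by (intro integral_nonneg integrable_continuous_interval continuous_on_subset[OF cont_sinh]) auto
  then show ?thesis using R_diff[OF ut] by simp
qed

lemma tm_T: "tm k \<le> T" using tm_antimono[of 0 k] by (simp add: T_def)

text \<open>The tent has base 2 * \<open>r k\<close> and height \<open>r k\<close>, hence is at
  least half its height on its middle half [a, b], of length \<open>r k\<close>. With sinh \<phi>
  \<ge> \<phi> the gain is at least \<open>sl k * r k / 2 * r k\<close>.\<close>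

lemma R_block: "R (tm (Suc k)) + \<rho> k * \<omega> (\<rho> k) / 360 \<le> R (tm k)"
proof -
  define a b where "a = tm (Suc k) + r k / 2" and "b = tm (Suc k) + 3 * r k / 2"
  have ab: "tm (Suc k) \<le> a" "a \<le> b" "b \<le> tm k" using r_pos[of k] tm_r[of k] by (auto simp: a_def b_def)
  have ab0: "0 \<le> a" "b \<le> T" using ab tm_pos[of "Suc k"] tm_T[of k] by auto
  have "integral {a..b} (\<lambda>u. sl k * r k / 2) \<le> integral {a..b} (\<lambda>u. sinh (\<phi> u))"
  proof (rule integral_le)
    show "(\<lambda>u. sinh (\<phi> u)) integrable_on {a..b}"
      by (intro integrable_continuous_interval continuous_on_subset[OF cont_sinh]) (use ab0 in auto)
    fix u assume u: "u \<in> {a..b}"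
    have "r k / 2 \<le> tent k u" using u tm_r[of k] by (auto simp: tent_def a_def b_def)
    then have "sl k * (r k / 2) \<le> sl k * tent k u" using sl_pos[of k] by (intro mult_left_mono) auto
    also have "\<dots> = \<phi> u" using \<phi>_block[of k u] u ab by simp
    also have "\<dots> \<le> sinh (\<phi> u)"
      using \<phi>_bounds(1)[of u] u ab0 sinh_ge_self[of "\<phi> u"] by auto
    finally show "sl k * r k / 2 \<le> sinh (\<phi> u)" by simp
  qed (rule integrable_const_ivl)
  moreover have "integral {a..b} (\<lambda>u. sl k * r k / 2) = sl k * r k / 2 * r k" using ab r_pos[of k] by (simp add: a_def b_def)
  moreover have "sl k * r k / 2 * r k = \<rho> k * \<omega> (\<rho> k) / 360" using \<rho>[of k] by (simp add: sl_def r_def field_simps)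
  moreover have "R b - R a = integral {a..b} (\<lambda>u. sinh (\<phi> u))" by (rule R_diff) (use ab ab0 in auto)
  moreover have "R (tm (Suc k)) \<le> R a" "R b \<le> R (tm k)"
    using ab ab0 tm_pos[of "Suc k"] tm_T[of k] by (auto intro!: R_mono)
  ultimately show ?thesis by linarith
qed

lemma R_tm_sum: "k \<le> n \<Longrightarrow> (\<Sum>j\<in>{k<..n}. \<rho> j * \<omega> (\<rho> j)) / 360 \<le> R (tm (Suc k)) - R (tm (Suc n))"
proof (induction n rule: dec_induct)
  case (step n)
  have "{k<..Suc n} = insert (Suc n) {k<..n}" using step by auto
  then show ?case using step R_block[of "Suc n"] by (simp add: add_divide_distrib)
qed simp

text \<open>Blocks with index greater than k lie between 0 and \<open>tm (Suc k)\<close>, so their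
  gains are already contained in the radius there; 14400 / 360 = 40.\<close>

lemma R_tm: "40 * (\<rho> k / \<omega> (\<rho> k)) \<le> R (tm (Suc k))"
proof -
  obtain n where n: "14400 * (\<rho> k / \<omega> (\<rho> k)) \<le> (\<Sum>j\<in>{k<..n}. \<rho> j * \<omega> (\<rho> j))" using growth by blast
  have "\<rho> k / \<omega> (\<rho> k) > 0" using \<rho> \<omega>pos by simp
  then have "k \<le> n" using n by (cases "k \<le> n") auto
  moreover have "0 \<le> R (tm (Suc n))" using R_mono[of 0 "tm (Suc n)"] R_0 tm_pos[of "Suc n"] tm_T[of "Suc n"] by simp
  ultimately show ?thesis using R_tm_sum[of k n] n by simp
qed

lemma R_pos: assumes t: "0 < t" "t \<le> T" shows "0 < R t"
proof -
  obtain k where k: "tm (Suc k) < t" "t \<le> tm k" using block_of[OF t] .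
  have "0 < 40 * (\<rho> k / \<omega> (\<rho> k))" using \<rho> \<omega>pos by simp
  also have "\<dots> \<le> R (tm (Suc k))" by (rule R_tm)
  also have "\<dots> \<le> R t" by (rule R_mono) (use k t tm_pos[of "Suc k"] in auto)
  finally show ?thesis .
qed

lemma cont_g: assumes "0 < a" shows "continuous_on {a..T} g"
proof -
  have "R t \<noteq> 0" if "t \<in> {a..T}" for t using R_pos[of t] that assms by simp
  then show ?thesis unfolding g_def
    by (intro continuous_intros continuous_on_subset[OF cont_\<phi>] continuous_on_subset[OF cont_R]) (use assms in auto)
qed

lemma g_block:
  assumes t: "tm (Suc k) \<le> t" "t \<le> tm k"
  shows "0 \<le> g t" "g t \<le> sl k"
proof -
  have t0: "0 < t" "t \<le> T" using t tm_pos[of "Suc k"] tm_T[of k] by auto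
  have Rt: "0 < R t" by (rule R_pos[OF t0])
  then show "0 \<le> g t" by (simp add: g_def)
  have ph: "0 \<le> \<phi> t" "\<phi> t \<le> 1" using \<phi>_bounds[of t] t0 by auto
  have "cosh (\<phi> t) \<le> cosh (1 :: real)" using ph by (simp add: cosh_real_nonneg_le_iff)
  \<comment> \<open>From e \<le> 3 and exp(-1) \<le> 1.\<close>
  also have "\<dots> \<le> 2" using exp_le by (simp add: cosh_def field_simps) (smt (verit) exp_le_one_iff)
  finally have c: "cosh (\<phi> t) \<le> 2" .
  have "R (tm (Suc k)) \<le> R t" by (rule R_mono) (use t t0 tm_pos[of "Suc k"] in auto)
  then have R: "40 * (\<rho> k / \<omega> (\<rho> k)) \<le> R t" using R_tm[of k] by linarith
  have p: "0 < 40 * (\<rho> k / \<omega> (\<rho> k))" using \<rho> \<omega>pos by simp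
  have "g t \<le> 2 / (40 * (\<rho> k / \<omega> (\<rho> k)))" unfolding g_def using c R p by (intro frac_le) auto
  also have "\<dots> = sl k" using \<rho>[of k] \<omega>pos[OF \<rho>[of k]] by (simp add: sl_def field_simps)
  finally show "g t \<le> sl k" .
qed

lemma g_int:
  assumes t: "tm (Suc k) \<le> u" "u \<le> t" "t \<le> tm k"
  shows "0 \<le> integral {u..t} g" "integral {u..t} g \<le> sl k * (t - u)"
proof -
  have i: "g integrable_on {u..t}"
    by (intro integrable_continuous_interval continuous_on_subset[OF cont_g[OF tm_pos[of "Suc k"]]]) (use t tm_T[of k] in auto)
  show "0 \<le> integral {u..t} g" by (rule integral_nonneg[OF i]) (use g_block(1)[of k] t in auto)
  have "integral {u..t} g \<le> integral {u..t} (\<lambda>_. sl k)" by (rule integral_le[OF i]) (use g_block(2)[of k] t in auto)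
  also have "\<dots> = sl k * (t - u)" using t by simp
  finally show "integral {u..t} g \<le> sl k * (t - u)" .
qed

lemma s_bounds: "0 \<le> s k" "s k \<le> 3 * sl k"
proof -
  have i: "0 \<le> integral {tm (Suc k)..tm k} g" "integral {tm (Suc k)..tm k} g \<le> sl k * (tm k - tm (Suc k))"
    using g_int[of k "tm (Suc k)" "tm k"] tm_Suc_less[of k] by auto
  then show "0 \<le> s k" using r_pos[of k] by (simp add: s_def)
  show "s k \<le> 3 * sl k" using i(2) r_pos[of k] tm_r[of k] by (simp add: s_def field_simps)
qed

section \<open>The driving path and its modulus of continuity\<close>

lemma L_sum: "tm n \<le> t \<Longrightarrow> L t = - (\<Sum>j<n. s j * clip (r j) (tm j - t))"
proof -
  assume t: "tm n \<le> t"
  have "(\<Sum>j. s j * clip (r j) (tm j - t)) = (\<Sum>j<n. s j * clip (r j) (tm j - t))"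
  proof (rule suminf_finite)
    fix j assume "j \<notin> {..<n}"
    then have "tm j \<le> t" using tm_antimono[of n j] t by auto
    then show "s j * clip (r j) (tm j - t) = 0" using r_pos[of j] by (simp add: clip_simps)
  qed simp
  then show ?thesis by (simp add: L_def)
qed

lemma L_T: "L T = 0" using L_sum[of 0 T] by (simp add: T_def)

lemma L_block:
  assumes t: "tm (Suc k) \<le> u" "u \<le> t" "t \<le> tm k"
  shows "L t - L u = s k * (clip (r k) (tm k - u) - clip (r k) (tm k - t))"
proof -
  have full: "clip (r j) (tm j - v) = r j" if "j < k" "v \<le> tm k" for j v
  proof -
    have "tm (Suc j) \<ge> tm k" using that by (intro tm_antimono) auto
    then have "r j \<le> tm j - v" using that tm_r[of j] r_pos[of j] by simp
    then show ?thesis using r_pos[of j] by (simp add: clip_simps)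
  qed
  have "L v = - (\<Sum>j<k. s j * r j) - s k * clip (r k) (tm k - v)" if "tm (Suc k) \<le> v" "v \<le> tm k" for v
    using L_sum[OF that(1)] full that by simp
  from this[of t] this[of u] show ?thesis using t by (simp add: algebra_simps)
qed

lemma lam_diff:
  assumes "0 < u" "u \<le> t" "t \<le> T"
  shows "lam t - lam u = \<phi> t - \<phi> u + integral {u..t} g - (L t - L u)"
proof -
  have "g integrable_on {u..T}" by (rule integrable_continuous_interval[OF cont_g]) (use assms in auto)
  then have "integral {u..t} g + integral {t..T} g = integral {u..T} g"
    by (rule Henstock_Kurzweil_Integration.integral_combine[rotated 2]) (use assms in auto)
  then show ?thesis using assms by (simp add: lam_def)
qed

text \<open>At both ends of a block \<phi> = 0, and \<open>s k\<close> was chosen so that L grows by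
  exactly the drift integral over the block; so lam takes the same value at all ends, and it is 0 at
  T.\<close>

lemma lam_tm: "lam (tm k) = 0"
proof (induction k)
  case 0
  show ?case using tm_pos[of 0] \<phi>_tm[of 0] L_T by (simp add: lam_def T_def)
next
  case (Suc k)
  have "lam (tm k) - lam (tm (Suc k)) = \<phi> (tm k) - \<phi> (tm (Suc k)) + integral {tm (Suc k)..tm k} g - (L (tm k) - L (tm (Suc k)))"
    by (rule lam_diff) (use tm_pos tm_Suc_less[of k] tm_T in \<open>auto simp: less_imp_le\<close>)
  also have "L (tm k) - L (tm (Suc k)) = s k * r k"
    using L_block[of k "tm (Suc k)" "tm k"] tm_Suc_less[of k] tm_r[of k] r_pos[of k] by (simp add: clip_simps)
  also have "\<dots> = integral {tm (Suc k)..tm k} g" using r_pos[of k] by (simp add: s_def)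
  finally show ?case using Suc by (simp add: \<phi>_tm)
qed

text \<open>The factor 1/2 is kept so that \<open>lam_modulus\<close> can add two such
  increments.\<close>

lemma lam_block:
  assumes t: "tm (Suc k) \<le> u" "u \<le> t" "t \<le> tm k"
  shows "\<bar>lam t - lam u\<bar> \<le> \<omega> (t - u) / 2"
proof -
  have "\<bar>\<phi> t - \<phi> u\<bar> \<le> sl k * (t - u)"
  proof -
    have "\<bar>tent k t - tent k u\<bar> \<le> t - u" using t by (auto simp: tent_def max_def min_def)
    then have "sl k * \<bar>tent k t - tent k u\<bar> \<le> sl k * (t - u)" using sl_pos[of k] by (intro mult_left_mono) auto
    moreover have "\<bar>\<phi> t - \<phi> u\<bar> = sl k * \<bar>tent k t - tent k u\<bar>"
      using \<phi>_block[of k t] \<phi>_block[of k u] t sl_pos[of k] by (simp add: abs_mult flip: right_diff_distrib)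
    ultimately show ?thesis by simp
  qed
  moreover have "\<bar>integral {u..t} g\<bar> \<le> sl k * (t - u)" using g_int[OF t] by simp
  moreover have "\<bar>L t - L u\<bar> \<le> 3 * sl k * (t - u)"
  proof -
    have "\<bar>L t - L u\<bar> = s k * \<bar>clip (r k) (tm k - u) - clip (r k) (tm k - t)\<bar>"
      unfolding L_block[OF t] using s_bounds(1)[of k] by (simp add: abs_mult)
    also have "\<dots> \<le> 3 * sl k * (t - u)"
      using s_bounds[of k] clip_lip[of "r k" "tm k - u" "tm k - t"] t by (intro mult_mono) auto
    finally show ?thesis .
  qed
  moreover have "lam t - lam u = \<phi> t - \<phi> u + integral {u..t} g - (L t - L u)"
    by (rule lam_diff) (use t tm_pos[of "Suc k"] tm_T[of k] in auto)
  ultimately have "\<bar>lam t - lam u\<bar> \<le> 5 * sl k * (t - u)" by (simp add: abs_le_iff algebra_simps)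
  moreover have "10 * sl k * (t - u) \<le> \<omega> (t - u)" by (rule sl_modulus) (use t tm_Suc[of k] in auto)
  ultimately show ?thesis by simp
qed

text \<open>For u and t in different blocks, each of the two values is compared with the zero of lam
  at that end of its own block which faces the other point; both distances are at most t - u, and
  the two halves add up.\<close>

lemma lam_modulus:
  assumes ut: "0 \<le> u" "u < t" "t \<le> T"
  shows "\<bar>lam t - lam u\<bar> \<le> \<omega> (t - u)"
proof -
  have nn: "0 \<le> \<omega> (t - u)" using ut by (intro modulus_rules(2)) auto
  obtain k where k: "tm (Suc k) < t" "t \<le> tm k" using block_of[of t] ut by auto
  show ?thesis
  proof (cases "tm (Suc k) \<le> u")
    case True
    then show ?thesis using lam_block[of k u t] k ut nn by auto
  next
    case False
    then have u: "u < tm (Suc k)" by simp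
    have "\<bar>lam t - lam (tm (Suc k))\<bar> \<le> \<omega> (t - tm (Suc k)) / 2" using lam_block[of k "tm (Suc k)" t] k by auto
    also have "\<omega> (t - tm (Suc k)) \<le> \<omega> (t - u)" using k u by (intro modulus_rules(3)) auto
    finally have 1: "\<bar>lam t\<bar> \<le> \<omega> (t - u) / 2" by (simp add: lam_tm)
    have 2: "\<bar>lam u\<bar> \<le> \<omega> (t - u) / 2"
    proof (cases "u = 0")
      case True then show ?thesis using nn by (simp add: lam_def)
    next
      case False
      then obtain j where j: "tm (Suc j) < u" "u \<le> tm j" using block_of[of u] ut by auto
      have "tm (Suc j) < tm (Suc k)" using j u by simp
      then have "k < j" using tm_antimono[of "Suc j" "Suc k"] by (cases "k < j") auto
      then have "tm j \<le> tm (Suc k)" by (intro tm_antimono) auto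
      then have jt: "tm j \<le> t" using k by simp
      have "\<bar>lam (tm j) - lam u\<bar> \<le> \<omega> (tm j - u) / 2" using lam_block[of j u "tm j"] j by auto
      also have "\<omega> (tm j - u) \<le> \<omega> (t - u)" using j jt by (intro modulus_rules(3)) auto
      finally show ?thesis by (simp add: lam_tm)
    qed
    show ?thesis using 1 2 by linarith
  qed
qed

lemma lam_C_class: "lam \<in> C_class \<omega>"
  using lam_modulus T_ge by (auto simp: C_class_def)

section \<open>The second solution\<close>

lemma \<phi>_zero_phase:
  assumes "tm j - r j \<le> u" "u \<le> tm j" shows "\<phi> u = 0"
proof -
  have "tm (Suc j) \<le> u" using assms tm_r[of j] r_pos[of j] by linarith
  then show ?thesis using \<phi>_block[of j u] tent_zero(2)[of j u] assms by simp
qed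

lemma polar: assumes a: "0 < a" "a \<le> 1" shows "polar_system a 1 lam R \<phi> L"
proof -
  obtain n where n: "tm n < a" using tm_below[OF a(1)] .
  have Ls: "L t = - (\<Sum>j<n. s j * clip (r j) (tm j - t))" if "a \<le> t" for t using L_sum[of n t] n that by simp
  have "continuous_on {a..1} (\<lambda>t. - (\<Sum>j<n. s j * clip (r j) (tm j - t)))" unfolding clip_def by (intro continuous_intros)
  then have cL: "continuous_on {a..1} L" by (rule continuous_on_eq) (use Ls in auto)
  have mL: "mono_on {a..1} L"
  proof (rule mono_onI)
    fix x y assume "x \<in> {a..1}" "y \<in> {a..1}" "x \<le> y"
    then show "L x \<le> L y"
      using Ls[of x] Ls[of y] s_bounds(1) by (auto intro!: sum_mono mult_left_mono clip_mono)
  qed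
  \<comment> \<open>The term of block j changes only between \<open>tm j - r j\<close> and
    \<open>tm j\<close>. If this interval meets the inside of [x, t], it contains a time u of
    [x, t], and there \<phi> = 0, contrary to positivity.\<close>
  have flat: "L x = L t" if xt: "a \<le> x" "x \<le> t" "t \<le> 1" and pos: "\<forall>u\<in>{x..t}. \<phi> u > 0" for x t
  proof -
    have "clip (r j) (tm j - x) = clip (r j) (tm j - t)" for j
    proof (cases "tm j \<le> x \<or> t \<le> tm j - r j")
      case True
      then show ?thesis using xt r_pos[of j] by (auto simp: clip_def max_def min_def)
    next
      case False
      define u where "u = max x (tm j - r j)"
      have "u \<in> {x..t}" "tm j - r j \<le> u" "u \<le> tm j" using False xt r_pos[of j] by (auto simp: u_def)
      then show ?thesis using pos \<phi>_zero_phase[of j u] by force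
    qed
    then show ?thesis using Ls[of x] Ls[of t] xt by simp
  qed
  show ?thesis unfolding polar_system_def
  proof (intro conjI ballI cL mL)
    show "continuous_on {a..1} \<phi>" by (rule continuous_on_subset[OF cont_\<phi>]) (use a T_ge in auto)
    fix t assume t: "t \<in> {a..1}"
    show "\<phi> t \<ge> 0" using \<phi>_bounds(1)[of t] t a T_ge by auto
    show "R t > 0" using R_pos[of t] t a T_ge by auto
    show "R t = R a + integral {a..t} (\<lambda>u. sinh (\<phi> u))" using R_diff[of a t] t a T_ge by auto
    show "lam t - lam a = \<phi> t - \<phi> a + integral {a..t} (\<lambda>u. cosh (\<phi> u) / R u) - (L t - L a)"
      using lam_diff[of a t] t a T_ge unfolding g_def by auto
  qed (use flat in blast)
qed

lemma nontrivial_solution: "\<exists>Z. solution lam Z \<and> Z 0 = 0 \<and> Z 1 \<noteq> 0"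
proof -
  have cl: "continuous_on {0..1} lam" by (rule C_class_continuous[OF mod lam_C_class])
  define p where "p = (\<lambda>t. R t * exp (\<phi> t - lam t))"
  define q where "q = (\<lambda>t. - (R t * exp (lam t - \<phi> t)))"
  have T01: "{0..1} \<subseteq> {0..T}" using T_ge by auto
  have cp: "continuous_on {0..1} p" unfolding p_def
    by (intro continuous_intros cl continuous_on_subset[OF cont_\<phi> T01] continuous_on_subset[OF cont_R T01])
  have cq: "continuous_on {0..1} q" unfolding q_def
    by (intro continuous_intros cl continuous_on_subset[OF cont_\<phi> T01] continuous_on_subset[OF cont_R T01])
  \<comment> \<open>The local time of \<open>polar_imp_refl_sol\<close> is normalised at a.
    Integrating from t to 1 instead changes it by a constant and gives one K for all a > 0.\<close>
  define K where "K = (\<lambda>t. R t * L t + integral {t..1} (\<lambda>u. L u * sinh (\<phi> u)))"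
  have solK: "refl_sol a 1 lam p q K" if a: "0 < a" "a < 1" for a
  proof -
    have ca: "continuous_on {a..1} lam" using cl by (rule continuous_on_subset) (use a in auto)
    have ps: "polar_system a 1 lam R \<phi> L" using polar a by simp
    have "refl_sol a 1 lam p q (\<lambda>t. R t * L t - integral {a..t} (\<lambda>u. L u * sinh (\<phi> u)))"
      unfolding p_def q_def by (rule polar_imp_refl_sol[OF ca ps]) (use a in simp)
    moreover have "R t * L t - integral {a..t} (\<lambda>u. L u * sinh (\<phi> u)) = K t - integral {a..1} (\<lambda>u. L u * sinh (\<phi> u))"
      if t: "t \<in> {a..1}" for t
    proof -
      have "continuous_on {a..1} (\<lambda>u. L u * sinh (\<phi> u))"
        using ps by (auto simp: polar_system_def intro!: continuous_intros)
      then have "(\<lambda>u. L u * sinh (\<phi> u)) integrable_on {a..1}" by (rule integrable_continuous_interval)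
      from Henstock_Kurzweil_Integration.integral_combine[OF _ _ this, of t] t show ?thesis by (simp add: K_def)
    qed
    ultimately show ?thesis by (rule refl_sol_shift)
  qed
  have eqK: "\<exists>K'. mono_on {0..1} K' \<and> continuous_on {0..1} K' \<and> (\<forall>a. 0 < a \<and> a < 1 \<longrightarrow> refl_sol a 1 lam p q K')"
    by (rule refl_sol_extend_0[OF cl cp solK])
  then obtain K' where K': "mono_on {0..1} K'" "continuous_on {0..1} K'" "\<And>a. 0 < a \<Longrightarrow> a < 1 \<Longrightarrow> refl_sol a 1 lam p q K'" by blast
  define Z :: "real \<Rightarrow> real^2" where "Z = (\<lambda>t. vector [(exp (lam t) * p t + exp (- lam t) * q t) / 2, (exp (lam t) * p t - exp (- lam t) * q t) / 2])"
  have pq0: "p 0 = 0" "q 0 = 0" by (simp_all add: p_def q_def R_0)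
  have "solution lam Z" unfolding Z_def
    by (rule refl_sol_imp_solution[OF cl K'(1,2) cp cq K'(3)]) (simp_all add: pq0)
  moreover have "Z 0 = 0" by (simp add: Z_def pq0 vec_eq_iff forall_2)
  moreover have "Z 1 $ 2 \<noteq> 0"
  proof -
    have "p 1 > 0" "q 1 < 0" using R_pos[of 1] T_ge by (auto simp: p_def q_def)
    then have "exp (lam 1) * p 1 > 0" "exp (- lam 1) * q 1 < 0" by (auto simp: mult_pos_neg)
    then show ?thesis by (simp add: Z_def)
  qed
  then have "Z 1 \<noteq> 0" by auto
  ultimately show ?thesis by blast
qed

end

lemma zero_solution:
  assumes lam: "continuous_on {0..1} lam"
  shows "solution lam (\<lambda>t. 0)"
proof -
  have "solution lam (\<lambda>t. vector [(exp (lam t) * 0 + exp (- lam t) * 0) / 2, (exp (lam t) * 0 - exp (- lam t) * 0) / 2])"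
    by (rule refl_sol_imp_solution[OF lam _ _ _ _ refl_sol_null]) (auto simp: mono_on_def intro!: continuous_intros)
  moreover have "vector [0, 0] = (0 :: real^2)" by (simp add: vec_eq_iff forall_2)
  ultimately show ?thesis by simp
qed

lemma multiple_solutions:
  assumes m: "modulus \<omega>" and fin: "\<forall>\<^sub>F a in at_right 0. recip_integral (theta \<omega>) a < \<infinity>"
    and lim: "Limsup (at_right 0) (\<lambda>\<delta>. ereal (\<omega> (2 * \<delta>) / (2 * \<omega> \<delta>))) < 1"
  shows "\<exists>lam\<in>C_class \<omega>. \<exists>Z Z'. solution lam Z \<and> solution lam Z' \<and>
           Z 0 = 0 \<and> Z' 0 = 0 \<and> (\<exists>t\<in>{0..1}. Z t \<noteq> Z' t)"
proof -
  obtain \<rho> :: "nat \<Rightarrow> real" where \<rho>: "\<And>k. \<rho> k > 0" "\<And>k. \<omega> (\<rho> k) \<le> 60" "summable \<rho>" "suminf \<rho> \<ge> 1"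
    "\<And>k. \<exists>n. 14400 * (\<rho> k / \<omega> (\<rho> k)) \<le> (\<Sum>j\<in>{k<..n}. \<rho> j * \<omega> (\<rho> j))"
    by (rule block_lengths_exist[OF m fin lim, of 14400 60]) (simp, simp, blast)
  interpret zigzag \<omega> \<rho> by unfold_locales (use m \<rho> modulus_pos[OF m fin] in auto)
  obtain Z where Z: "solution lam Z" "Z 0 = 0" "Z 1 \<noteq> 0" using nontrivial_solution by blast
  have "solution lam (\<lambda>t. 0)" by (rule zero_solution[OF C_class_continuous[OF m lam_C_class]])
  then show ?thesis using Z lam_C_class by (intro bexI[of _ lam] exI[of _ Z] exI[of _ "\<lambda>t. 0"]) (auto intro!: bexI[of _ 1])
qed

theorem theorem2p2:
  fixes \<omega> :: "real \<Rightarrow> real"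
  assumes "modulus \<omega>"
  shows
    "((\<forall>\<^sub>F a in at_right 0. recip_integral (theta \<omega>) a = \<infinity>) \<longrightarrow>
        (\<forall>lam\<in>C_class \<omega>. \<forall>z0::real^2. z0 \<bullet> e1 \<ge> 0 \<longrightarrow>
           (\<exists>Z. solution lam Z \<and> Z 0 = z0 \<and>
              (\<forall>Z'. solution lam Z' \<and> Z' 0 = z0 \<longrightarrow> (\<forall>t\<in>{0..1}. Z' t = Z t)))))
     \<and>
     ((\<forall>\<^sub>F a in at_right 0. recip_integral (theta \<omega>) a < \<infinity>) \<and>
      Limsup (at_right 0) (\<lambda>\<delta>. ereal (\<omega> (2 * \<delta>) / (2 * \<omega> \<delta>))) < 1 \<longrightarrow>
        (\<exists>lam\<in>C_class \<omega>. \<exists>Z Z'. solution lam Z \<and> solution lam Z' \<and>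
           Z 0 = 0 \<and> Z' 0 = 0 \<and> (\<exists>t\<in>{0..1}. Z t \<noteq> Z' t)))"
  using unique_solution[OF assms] multiple_solutions[OF assms] by blast

end
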